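(* (i) Let $f\in L^2(\mathbb{R},H^1_w)$ (a function of $(\xi,v)$ that is $L^2$ in $\xi$ with values in $H^1_w$ in $v$). Then $$f=\mathcal{U}_\xi^*\mathcal{B}_\xi f+P(\xi)f,$$ where the equality is understood in the weak sense (the $H^{-1}_w$-sense), i.e. as an identity in $H^{-1}_w$ for (almost every) $\xi$. (ii) If $f\in L^2(\mathbb{R},L^2_w)$ is compactly supported in $\xi$ on $(-\sqrt\pi,\sqrt\pi)$, then $$f=\mathcal{U}_\xi^*\mathcal{B}_\xi f+P(\xi)f,$$ where the equality is understood in the strong sense (the $L^2_w$-sense).
   Context: Let $w(v)=e^{-v^2}/\sqrt{\pi}$, $L^2_w=L^2_w(\mathbb{R})$ with $(f,g)_{L^2_w}=\int f\bar g\,w\,dv$; $H^1_w=\{f\in L^2_w:f'\in L^2_w\}$, $H^{-1}_w$ its dual with respect to the $L^2_w$ pairing $\langle\cdot,\cdot\rangle$. $\mathbb{1}$ is the constant function $1$, $Vf=(f,\mathbb{1})_{L^2_w}\mathbb{1}$, and $(L_\xi f)(v)=(-iv\xi-1)f(v)+(Vf)(v)$ with maximal domain in $L^2_w$. $\omega(\lambda,\xi)=1-\int_{\mathbb{R}}\frac{w(v)\,dv}{iv\xi+1+\lambda}$ for $\mathrm{Re}\,\lambda\ne-1$. For $\xi\in(-\sqrt\pi,\sqrt\pi)$, $\lambda^*(\xi)\in(-1,0]$ is the unique zero of $\omega(\cdot,\xi)$, a simple isolated eigenvalue of $L_\xi$. For $\xi\neq0$, $\lambda\in\mathbb{R}$: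 $\omega_+(-1-i\lambda\xi,\xi)=\lim_{\delta\to0^+}\omega(-1+\delta-i\lambda\xi,\xi)$, $\omega_-(-1+i\lambda\xi,-\xi)=\lim_{\delta\to0^+}\omega(-1-\delta+i\lambda\xi,-\xi)$. For $h\in L^2(\mathbb{R})$, $(\hat{\mathcal S}_\pm h)(\lambda)=\lim_{\eta\to0^\pm}\int_{\mathbb{R}}\frac{h(z)}{z-(\lambda+i\eta)}\,dz$. Define $$(\mathcal U_\xi f)(\lambda)=f(\lambda)-\frac{(\hat{\mathcal S}_{-\mathrm{sgn}\,\xi}(fw))(\lambda)}{i\xi\,\overline{\omega_+(-1-i\lambda\xi,\xi)}},\qquad (\mathcal B_\xi f)(\lambda)=f(\lambda)+\frac{(\hat{\mathcal S}_{-\mathrm{sgn}\,\xi}(fw))(\lambda)}{i\xi\,\overline{\omega_-(-1+i\lambda\xi,-\xi)}}.$$ $\mathcal U_\xi^*\mathcal B_\xi$ is the operator defined by the form $\langle\mathcal U^*_\xi\mathcal B_\xi f,g\rangle=\int_{\mp}(\mathcal B_\xi f)(\lambda)\overline{(\mathcal U_\xi g)(\lambda)}w(\lambda)\,d\lambda$ ($\int_-$ for $\xi>0$, $\int_+$ for $\xi<0$), and $\mathcal U_0^*\mathcal B_0:=I-V$. For $\xi\neq0,\pm\sqrt\pi$ the integral is the ordinary integral over $\mathbb{R}$ and $\mathcal U_\xi^*\mathcal B_\xi$ is also bounded on $L^2_w$; for $\xi=\pm\sqrt\pi$ (corresponding signs), $\int_{\mp}h\,\overline{\mathcal U_\xi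 g}\,w\,d\lambda:=\lim_{b\to0^\pm}\int_{\mathbb{R}}\frac{\lambda}{\lambda-ib}h\,\overline{\mathcal U_\xi g}\,w\,d\lambda$. $P(\xi)$ is the Riesz projection of $L_\xi$ at $\lambda^*(\xi)$ for $\xi\in(-\sqrt\pi,\sqrt\pi)$; $P(\xi)=0$ for $\xi\notin[-\sqrt\pi,\sqrt\pi]$; and $P(\pm\sqrt\pi)=P_{-1^\pm}$ is minus the residue at $\lambda=-1$ of the continuation, from $\mathrm{Re}\,\lambda>-1$, of $(L_{\pm\sqrt\pi}-\lambda)^{-1}$ in the sense of forms, explicitly $\langle P_{-1^\pm}f,g\rangle=\frac{\pi}{2}\Big(\lim_{b\to0^\pm}\int\frac{f(v)w(v)\,dv}{\pm i\sqrt\pi(v-ib)}\Big)\Big(\lim_{b\to0^\pm}\int\frac{\overline{g(v)}w(v)\,dv}{\pm i\sqrt\pi(v-ib)}\Big)$ for $f,g\in H^1_w$. *)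

theory Defs
  imports "HOL-Complex_Analysis.Complex_Analysis"
begin

text \<open>Elements of the function spaces are represented by Borel measurable functions;
  equality in a space is equality almost everywhere.\<close>

definition w :: "real \<Rightarrow> real" where
  "w v = exp (- v\<^sup>2) / sqrt pi"

definition L2w :: "(real \<Rightarrow> complex) set" where
  "L2w = {f \<in> borel_measurable lborel. integrable lborel (\<lambda>v. (cmod (f v))\<^sup>2 * w v)}"

definition innerw :: "(real \<Rightarrow> complex) \<Rightarrow> (real \<Rightarrow> complex) \<Rightarrow> complex" where
  "innerw f g = (LINT v|lborel. f v * cnj (g v) * of_real (w v))"

definition normw :: "(real \<Rightarrow> complex) \<Rightarrow> real" where
  "normw f = sqrt (LINT v|lborel. (cmod (f v))\<^sup>2 * w v)"

definition test_function :: "(real \<Rightarrow> real) \<Rightarrow> bool" where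
  "test_function \<phi> \<longleftrightarrow> (\<forall>n x. (deriv ^^ n) \<phi> field_differentiable at x) \<and>
     (\<exists>K. compact K \<and> (\<forall>x. x \<notin> K \<longrightarrow> \<phi> x = 0))"

text \<open>Distributional derivative. It is only used for \<open>f, g \<in> L2w\<close>; these are locally
  integrable, so both integrals converge.\<close>

definition has_weak_deriv :: "(real \<Rightarrow> complex) \<Rightarrow> (real \<Rightarrow> complex) \<Rightarrow> bool" where
  "has_weak_deriv f g \<longleftrightarrow> (\<forall>\<phi>. test_function \<phi> \<longrightarrow>
     (LINT v|lborel. f v * of_real (deriv \<phi> v)) = - (LINT v|lborel. g v * of_real (\<phi> v)))"

definition H1w :: "(real \<Rightarrow> complex) set" where
  "H1w = {f \<in> L2w. \<exists>g\<in>L2w. has_weak_deriv f g}"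

text \<open>The dual of \<open>H1w\<close>: bounded antilinear functionals, because \<open>innerw\<close> is antilinear in its
  second argument. In particular \<open>f \<in> L2w\<close> is identified with the functional \<open>innerw f\<close>.\<close>

definition Hm1w :: "((real \<Rightarrow> complex) \<Rightarrow> complex) set" where
  "Hm1w = {\<Phi>.
     (\<forall>g\<in>H1w. \<forall>h\<in>H1w. \<forall>c. \<Phi> (\<lambda>v. g v + c * h v) = \<Phi> g + cnj c * \<Phi> h) \<and>
     (\<exists>C. \<forall>g\<in>L2w. \<forall>g'\<in>L2w. has_weak_deriv g g' \<longrightarrow>
        cmod (\<Phi> g) \<le> C * sqrt ((normw g)\<^sup>2 + (normw g')\<^sup>2))}"

definition Hm1w_eq :: "((real \<Rightarrow> complex) \<Rightarrow> complex) \<Rightarrow> ((real \<Rightarrow> complex) \<Rightarrow> complex) \<Rightarrow> bool" where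
  "Hm1w_eq \<Phi> \<Psi> \<longleftrightarrow> \<Phi> \<in> Hm1w \<and> \<Psi> \<in> Hm1w \<and> (\<forall>g\<in>H1w. \<Phi> g = \<Psi> g)"

text \<open>\<open>h\<close> is the value in \<open>L2w\<close> of the operator defined by a form, where \<open>\<Phi>\<close> is the form with
  its first argument fixed. By the Riesz representation theorem \<open>h\<close> is unique up to null sets,
  and it exists iff \<open>\<Phi>\<close> is bounded and antilinear.\<close>

definition represents :: "(real \<Rightarrow> complex) \<Rightarrow> ((real \<Rightarrow> complex) \<Rightarrow> complex) \<Rightarrow> bool" where
  "represents h \<Phi> \<longleftrightarrow> h \<in> L2w \<and> (\<forall>g\<in>L2w. innerw h g = \<Phi> g)"

text \<open>The Bochner spaces \<open>L\<^sup>2(\<real>, L\<^sup>2\<^sub>w)\<close> and \<open>L\<^sup>2(\<real>, H\<^sup>1\<^sub>w)\<close>, as spaces of jointly measurable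
  functions of \<open>(\<xi>, v)\<close>; the target spaces are separable Hilbert spaces.\<close>

definition L2_L2w :: "(real \<Rightarrow> real \<Rightarrow> complex) set" where
  "L2_L2w = {f. (\<lambda>(\<xi>, v). f \<xi> v) \<in> borel_measurable (lborel \<Otimes>\<^sub>M lborel) \<and>
     integrable (lborel \<Otimes>\<^sub>M lborel) (\<lambda>(\<xi>, v). (cmod (f \<xi> v))\<^sup>2 * w v)}"

definition L2_H1w :: "(real \<Rightarrow> real \<Rightarrow> complex) set" where
  "L2_H1w = {f \<in> L2_L2w. \<exists>g\<in>L2_L2w. AE \<xi> in lborel. has_weak_deriv (f \<xi>) (g \<xi>)}"

definition V :: "(real \<Rightarrow> complex) \<Rightarrow> real \<Rightarrow> complex" where
  "V f = (\<lambda>v. innerw f (\<lambda>_. 1))"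

definition L :: "real \<Rightarrow> (real \<Rightarrow> complex) \<Rightarrow> real \<Rightarrow> complex" where
  "L \<xi> f = (\<lambda>v. (- \<i> * of_real v * of_real \<xi> - 1) * f v + V f v)"

definition dom_L :: "real \<Rightarrow> (real \<Rightarrow> complex) set" where
  "dom_L \<xi> = {f \<in> L2w. L \<xi> f \<in> L2w}"

text \<open>\<open>(L\<^sub>\<xi> - \<lambda>)\<^sup>-\<^sup>1 f\<close> for \<open>\<lambda>\<close> in the resolvent set; determined up to null sets.\<close>

definition resolvent :: "real \<Rightarrow> complex \<Rightarrow> (real \<Rightarrow> complex) \<Rightarrow> real \<Rightarrow> complex" where
  "resolvent \<xi> \<mu> f = (SOME h. h \<in> dom_L \<xi> \<and> (AE v in lborel. L \<xi> h v - \<mu> * h v = f v))"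

definition omega :: "complex \<Rightarrow> real \<Rightarrow> complex" where
  "omega \<mu> \<xi> = 1 - (LINT v|lborel. of_real (w v) / (\<i> * of_real v * of_real \<xi> + 1 + \<mu>))"

definition omega_plus :: "complex \<Rightarrow> real \<Rightarrow> complex" where
  "omega_plus \<mu> \<xi> = Lim (at_right 0) (\<lambda>\<delta>::real. omega (\<mu> + of_real \<delta>) \<xi>)"

definition omega_minus :: "complex \<Rightarrow> real \<Rightarrow> complex" where
  "omega_minus \<mu> \<xi> = Lim (at_right 0) (\<lambda>\<delta>::real. omega (\<mu> - of_real \<delta>) \<xi>)"

definition lambda_star :: "real \<Rightarrow> real" where
  "lambda_star \<xi> = (THE l. l \<in> {-1<..0} \<and> omega (of_real l) \<xi> = 0)"

definition side :: "real \<Rightarrow> real filter" where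
  "side s = (if s > 0 then at_right 0 else at_left 0)"

text \<open>\<open>S_hat s\<close> is the boundary value from the upper half-plane for \<open>s > 0\<close> and from the lower
  one for \<open>s < 0\<close>. For \<open>h\<close> square integrable the limit exists for almost every \<open>l\<close>.\<close>

definition S_hat :: "real \<Rightarrow> (real \<Rightarrow> complex) \<Rightarrow> real \<Rightarrow> complex" where
  "S_hat s h l = Lim (side s)
     (\<lambda>\<eta>. LINT z|lborel. h z / (of_real z - (of_real l + \<i> * of_real \<eta>)))"

definition U_op :: "real \<Rightarrow> (real \<Rightarrow> complex) \<Rightarrow> real \<Rightarrow> complex" where
  "U_op \<xi> f l = f l - S_hat (- sgn \<xi>) (\<lambda>z. f z * of_real (w z)) l /
     (\<i> * of_real \<xi> * cnj (omega_plus (- 1 - \<i> * of_real l * of_real \<xi>) \<xi>))"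

definition B_op :: "real \<Rightarrow> (real \<Rightarrow> complex) \<Rightarrow> real \<Rightarrow> complex" where
  "B_op \<xi> f l = f l + S_hat (- sgn \<xi>) (\<lambda>z. f z * of_real (w z)) l /
     (\<i> * of_real \<xi> * cnj (omega_minus (- 1 + \<i> * of_real l * of_real \<xi>) (- \<xi>)))"

definition UB_form :: "real \<Rightarrow> (real \<Rightarrow> complex) \<Rightarrow> (real \<Rightarrow> complex) \<Rightarrow> complex" where
  "UB_form \<xi> f g =
     (if \<xi> = 0 then innerw (\<lambda>v. f v - V f v) g
      else if \<bar>\<xi>\<bar> = sqrt pi then
        Lim (side \<xi>) (\<lambda>b. LINT l|lborel. of_real l / (of_real l - \<i> * of_real b) *
          B_op \<xi> f l * cnj (U_op \<xi> g l) * of_real (w l))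
      else (LINT l|lborel. B_op \<xi> f l * cnj (U_op \<xi> g l) * of_real (w l)))"

text \<open>The Riesz projection \<open>- 1/(2\<pi>i) \<integral> (L\<^sub>\<xi> - \<mu>)\<^sup>-\<^sup>1 d\<mu>\<close> over a circle around the isolated
  eigenvalue, as a form: the operator-valued integral is determined by its matrix elements. The
  integral does not depend on the radius \<open>r\<close> once the circle encloses no further spectrum.\<close>

definition riesz_form :: "real \<Rightarrow> (real \<Rightarrow> complex) \<Rightarrow> (real \<Rightarrow> complex) \<Rightarrow> complex" where
  "riesz_form \<xi> f g = Lim (at_right 0) (\<lambda>r. - 1 / (2 * of_real pi * \<i>) *
     contour_integral (circlepath (of_real (lambda_star \<xi>)) r) (\<lambda>\<mu>. innerw (resolvent \<xi> \<mu> f) g))"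

text \<open>For \<open>\<xi> = \<plusminus>\<surd>\<pi>\<close> the factor \<open>\<plusminus>\<i>\<surd>\<pi>\<close> in the explicit formula is \<open>\<i>\<xi>\<close>.\<close>

definition P_form :: "real \<Rightarrow> (real \<Rightarrow> complex) \<Rightarrow> (real \<Rightarrow> complex) \<Rightarrow> complex" where
  "P_form \<xi> f g =
     (if \<bar>\<xi>\<bar> < sqrt pi then riesz_form \<xi> f g
      else if \<bar>\<xi>\<bar> > sqrt pi then 0
      else of_real (pi / 2) *
        Lim (side \<xi>) (\<lambda>b. LINT v|lborel. f v * of_real (w v) /
          (\<i> * of_real \<xi> * (of_real v - \<i> * of_real b))) *
        Lim (side \<xi>) (\<lambda>b. LINT v|lborel. cnj (g v) * of_real (w v) /
          (\<i> * of_real \<xi> * (of_real v - \<i> * of_real b))))"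

end

theory Submission
  imports Defs "HOL-Probability.Sinc_Integral" "HOL-Real_Asymp.Real_Asymp"
begin

text \<open>
  Let \<open>F\<^sub>\<plusminus>\<close>, \<open>H\<^sub>\<plusminus>\<close> and \<open>G\<^sub>\<plusminus>\<close> be the boundary values on the real line, from above and below, of the
  Cauchy transforms of \<open>f w\<close>, \<open>cnj g w\<close> and \<open>w\<close>, and put \<open>D\<^sub>\<plusminus> = \<i> \<xi> - G\<^sub>\<plusminus>\<close>. By the jump relations
  \<open>F\<^sub>+ - F\<^sub>- = 2 \<pi> \<i> f w\<close> (and likewise for \<open>H\<close> and \<open>G\<close>), the integrand of the form \<open>UB_form \<xi> f g\<close> is
  \<open>f cnj g w + (F\<^sub>+ H\<^sub>+ / D\<^sub>+ - F\<^sub>- H\<^sub>- / D\<^sub>-) / (2 \<pi> \<i>)\<close>. The two quotients are boundary values of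
  meromorphic functions, so their integrals are residues at the zeros of \<open>D\<close>. Since the Cauchy
  transform \<open>G\<close> of the Gaussian solves \<open>G' = - 2 - 2 z G\<close>, it continues to an entire function, and
  \<open>D\<close> has at most one zero, simple and on the imaginary axis; it corresponds to the eigenvalue
  \<open>\<lambda>\<^sup>*\<close>, and its residue cancels against the Riesz projection.

  The boundary values exist in \<open>L\<^sup>2\<close> because the Gram kernel of the transforms at different heights
  depends only on the sum of the heights, and almost everywhere by a Vitali maximal inequality. The
  exceptional values \<open>\<xi> = 0, \<plusminus>\<surd>\<pi>\<close> form a null set, so no limits in \<open>b\<close> occur.
\<close>

section \<open>Integrals over the real line by residues\<close>

text \<open>The Cauchy transform of a general integrable function has no rate of decay at infinity,
  and its boundary values are controlled only in \<open>L\<^sup>2\<close>, so contours are not moved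
  through the transforms themselves. The residue calculus is applied to explicit kernels: at a
  height \<eta> > 0 below the zero of \<open>D\<close>, Fubini reduces the integral to those of
  \<open>1 / (D (s - z) (t - z))\<close>, whose values do not change with \<eta>. Only then does
  \<eta> tend to 0, with norm convergence for the transforms and dominated convergence for
  \<open>1 / D\<close>. This needs \<open>1 / D\<close> bounded up to the real line and at infinity.
  Bounding the Gaussian transform by \<open>1 / Im z\<close> is useless near the line; a uniform
  bound for \<open>z G\<close> takes its place. On the line the real part of
  \<open>G\<^sub>\<plusminus>\<close> vanishes only at 0, where
  \<open>G\<^sub>\<plusminus> = \<plusminus> \<i> sqrt pi\<close>; this is the origin of the
  critical values of \<xi> other than 0. The inequality \<open>y * Im (G (\<i> y)) < 1\<close>
  governs the rest: it gives strict monotonicity along the imaginary axis, hence at most one zero,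
  and makes that zero simple.\<close>

lemma integrable_inverse_square_plus_one:
  "integrable lborel (\<lambda>x::real. 1 / (1 + x\<^sup>2))"
  and integral_inverse_square_plus_one: "(LINT x|lborel. 1 / (1 + x\<^sup>2)) = pi"
  using integrable_inverse_1_plus_square LBINT_inverse_1_plus_square
  by (simp_all add: set_integrable_def interval_lebesgue_integral_def set_lebesgue_integral_def
      inverse_eq_divide)

lemma integrable_of_inverse_square_decay:
  fixes g :: "real \<Rightarrow> complex"
  assumes cont: "continuous_on UNIV g"
    and decay: "\<And>x. \<bar>x\<bar> \<ge> R \<Longrightarrow> norm (g x) \<le> C / x\<^sup>2"
  shows "integrable lborel g"
proof -
  define K where "K = max R 1"
  have "compact ((\<lambda>x. (1 + x\<^sup>2) * norm (g x)) ` {-K..K})"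
    by (intro compact_continuous_image continuous_intros continuous_on_subset[OF cont]) auto
  then obtain M where M: "\<And>x. \<bar>x\<bar> \<le> K \<Longrightarrow> (1 + x\<^sup>2) * norm (g x) \<le> M"
  proof -
    assume cmp: "compact ((\<lambda>x. (1 + x\<^sup>2) * norm (g x)) ` {-K..K})"
    assume step: "\<And>M. (\<And>x. \<bar>x\<bar> \<le> K \<Longrightarrow> (1 + x\<^sup>2) * norm (g x) \<le> M) \<Longrightarrow> thesis"
    from cmp obtain M where "\<forall>y\<in>(\<lambda>x. (1 + x\<^sup>2) * norm (g x)) ` {-K..K}. norm y \<le> M"
      using compact_imp_bounded bounded_iff by metis
    then have "(1 + x\<^sup>2) * norm (g x) \<le> M" if "\<bar>x\<bar> \<le> K" for x
      using that by (force simp: abs_le_iff)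
    then show thesis by (rule step)
  qed
  have bound: "norm (g x) \<le> max M (2 * C) * (1 / (1 + x\<^sup>2))" for x
  proof -
    have "(1 + x\<^sup>2) * norm (g x) \<le> max M (2 * C)"
    proof (cases "\<bar>x\<bar> \<le> K")
      case True
      then show ?thesis using M by fastforce
    next
      case False
      then have x: "\<bar>x\<bar> \<ge> R" "x\<^sup>2 \<ge> 1" "x\<^sup>2 > 0"
        using abs_le_square_iff[of 1 x] by (auto simp: K_def)
      have le: "norm (g x) * x\<^sup>2 \<le> C"
        using decay[OF x(1)] x(3) by (simp add: pos_le_divide_eq)
      have "(1 + x\<^sup>2) * norm (g x) \<le> (2 * x\<^sup>2) * norm (g x)"
        using x by (intro mult_right_mono) auto
      also have "\<dots> \<le> 2 * C"
        using le by (simp add: mult.commute)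
      finally show ?thesis by simp
    qed
    moreover have "1 + x\<^sup>2 > 0" by (simp add: add_pos_nonneg)
    ultimately show ?thesis
      by (simp add: pos_le_divide_eq mult.commute)
  qed
  show ?thesis
  proof (rule Bochner_Integration.integrable_bound)
    show "integrable lborel (\<lambda>x. max M (2 * C) * (1 / (1 + x\<^sup>2)))"
      by (intro integrable_mult_right integrable_inverse_square_plus_one)
    show "g \<in> borel_measurable lborel"
      using borel_measurable_continuous_onI[OF cont] by simp
    show "AE x in lborel. norm (g x) \<le> norm (max M (2 * C) * (1 / (1 + x\<^sup>2)))"
      using bound by (intro always_eventually allI) (smt (verit) real_norm_def)
  qed
qed

lemma eventually_between_at_right:
  assumes "b > (0::real)"
  shows "\<forall>\<^sub>F \<eta> in at_right 0. 0 < \<eta> \<and> \<eta> < b"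
  using assms by (auto simp: eventually_at_right_field)

lemma measurable_cnj [measurable (raw)]:
  "f \<in> borel_measurable M \<Longrightarrow> (\<lambda>x. cnj (f x)) \<in> borel_measurable M"
  by (rule borel_measurable_continuous_on[of cnj, OF continuous_on_cnj[OF continuous_on_id]])

text \<open>The line has positive measure. This is how strict inequalities between integrals are
  obtained below: a nonnegative integrand with integral 0 would vanish almost everywhere, against
  its positivity.\<close>

lemma not_AE_lborel_False: "\<not> (AE x::real in lborel. False)"
  by (simp add: AE_iff_measurable ae_filter_eq_bot_iff flip: trivial_limit_def)

lemma tendsto_integral_symmetric_interval:
  fixes g :: "real \<Rightarrow> complex"
  assumes g: "integrable lborel g"
  shows "(\<lambda>n. LINT x|lborel. indicator {-real n..real n} x *\<^sub>R g x) \<longlonglongrightarrow> (LINT x|lborel. g x)"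
proof (rule integral_dominated_convergence[where w = "\<lambda>x. norm (g x)"])
  show "AE x in lborel. (\<lambda>n. indicator {-real n..real n} x *\<^sub>R g x) \<longlonglongrightarrow> g x"
  proof (intro always_eventually allI)
    fix x :: real
    obtain N :: nat where N: "\<bar>x\<bar> \<le> real N" using real_arch_simple by blast
    have "\<forall>\<^sub>F n in sequentially. indicator {-real n..real n} x *\<^sub>R g x = g x"
      using eventually_ge_at_top[of N] by eventually_elim (use N in \<open>auto simp: indicator_def\<close>)
    then show "(\<lambda>n. indicator {-real n..real n} x *\<^sub>R g x) \<longlonglongrightarrow> g x"
      by (rule tendsto_eventually)
  qed
qed (use g in \<open>auto simp: indicator_def\<close>)

text \<open>Cauchy's formula on the rectangle with corners \<open>-r\<close>, \<open>r\<close>,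
  \<open>r + \<i> r\<close>, \<open>-r + \<i> r\<close>. On the three far sides, of total length
  \<open>4 r\<close>, the integrand is at most \<open>C / r\<^sup>2\<close>, so they contribute
  \<open>O(1 / r)\<close>. The strip of width \<delta> keeps the bottom side inside the domain of
  holomorphy. Absolute integrability is a separate conclusion because the limit over symmetric
  intervals alone would only be a principal value.\<close>

lemma real_line_Cauchy_formula:
  fixes \<phi> :: "complex \<Rightarrow> complex"
  assumes \<delta>: "\<delta> > 0" and hol: "\<phi> holomorphic_on {z. Im z > - \<delta>}" and z0: "Im z0 > 0"
    and decay: "\<And>z. Im z \<ge> 0 \<Longrightarrow> norm z \<ge> R0 \<Longrightarrow> norm (\<phi> z / (z - z0)) \<le> C / (norm z)\<^sup>2"
  shows "integrable lborel (\<lambda>x. \<phi> (of_real x) / (of_real x - z0))"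
    and "(LINT x|lborel. \<phi> (of_real x) / (of_real x - z0)) = 2 * of_real pi * \<i> * \<phi> z0"
proof -
  define g where "g = (\<lambda>x::real. \<phi> (of_real x) / (of_real x - z0))"
  have ne: "of_real x - z0 \<noteq> 0" for x :: real
    using z0 by (auto simp: complex_eq_iff)
  have contphi: "continuous_on UNIV (\<lambda>x::real. \<phi> (of_real x))"
    by (rule continuous_on_compose2[OF holomorphic_on_imp_continuous_on[OF hol]])
      (use \<delta> in \<open>auto intro!: continuous_intros\<close>)
  have contg: "continuous_on UNIV g"
    unfolding g_def using ne by (intro continuous_intros contphi) auto
  have int: "integrable lborel g"
  proof (rule integrable_of_inverse_square_decay[OF contg])
    show "norm (g x) \<le> C / x\<^sup>2" if "\<bar>x\<bar> \<ge> R0" for x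
      using decay[of "of_real x"] that by (simp add: g_def)
  qed
  then show "integrable lborel (\<lambda>x. \<phi> (of_real x) / (of_real x - z0))"
    by (simp add: g_def)
  define I where "I = (\<lambda>r::real. integral {-r..r} g)"
  define R1 where "R1 = max (max R0 1) (norm z0 + 1)"
  have C0: "C \<ge> 0"
  proof -
    have "0 \<le> C / (norm (of_real (max R0 1) :: complex))\<^sup>2"
      by (rule order_trans[OF norm_ge_zero decay]) auto
    then show ?thesis by (auto simp: zero_le_divide_iff)
  qed
  have est: "norm (I r - 2 * of_real pi * \<i> * \<phi> z0) \<le> 4 * C / r" if r: "r \<ge> R1" for r
  proof -
    have rpos: "r > 0" "r \<ge> R0" "r > norm z0" using r by (auto simp: R1_def)
    define a1 where "a1 = Complex (-r) 0"
    define a2 where "a2 = Complex r 0"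
    define a3 where "a3 = Complex r r"
    define a4 where "a4 = Complex (-r) r"
    have rect: "rectpath a1 a3 = linepath a1 a2 +++ linepath a2 a3 +++ linepath a3 a4 +++ linepath a4 a1"
      by (simp add: rectpath_def Let_def a1_def a2_def a3_def a4_def)
    have "\<bar>Re z0\<bar> < r" "\<bar>Im z0\<bar> < r"
      using abs_Re_le_cmod[of z0] abs_Im_le_cmod[of z0] rpos by linarith+
    then have inbox: "z0 \<in> box a1 a3"
      using z0 by (auto simp: in_box_complex_iff a1_def a3_def)
    have sub: "path_image (rectpath a1 a3) \<subseteq> {z. Im z > - \<delta>} - {z0}"
    proof -
      have "path_image (rectpath a1 a3) = cbox a1 a3 - box a1 a3"
        by (rule path_image_rectpath_cbox_minus_box) (use rpos in \<open>simp_all add: a1_def a3_def\<close>)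
      moreover have "Im z > - \<delta>" if "z \<in> cbox a1 a3" for z
        using that \<delta> by (simp add: in_cbox_complex_iff a1_def a3_def)
      ultimately show ?thesis
        using inbox by auto
    qed
    define f where "f = (\<lambda>w. \<phi> w / (w - z0))"
    have opn: "open {z. Im z > - \<delta>}"
      by (intro open_Collect_less continuous_intros)
    have hc: "(f has_contour_integral (2 * pi * \<i> * winding_number (rectpath a1 a3) z0 * \<phi> z0)) (rectpath a1 a3)"
      unfolding f_def
    proof (rule Cauchy_integral_formula_convex_simple[OF _ hol])
      show "convex {z. Im z > - \<delta>}"
        using convex_halfspace_Im_gt[of "-\<delta>"] by simp
      show "z0 \<in> interior {z. Im z > - \<delta>}" using z0 \<delta> opn by (simp add: interior_open)
    qed (use sub in auto)
    have wn: "winding_number (rectpath a1 a3) z0 = 1"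
      by (rule winding_number_rectpath[OF inbox])
    have contf: "continuous_on ({z. Im z > - \<delta>} - {z0}) f"
      unfolding f_def
      by (intro continuous_intros continuous_on_subset[OF holomorphic_on_imp_continuous_on[OF hol]]) auto
    have ci: "f contour_integrable_on linepath a b"
      if "closed_segment a b \<subseteq> path_image (rectpath a1 a3)" for a b
      by (rule contour_integrable_continuous_linepath[OF continuous_on_subset[OF contf]])
        (use that sub in blast)
    have segs: "closed_segment a1 a2 \<subseteq> path_image (rectpath a1 a3)"
      "closed_segment a2 a3 \<subseteq> path_image (rectpath a1 a3)"
      "closed_segment a3 a4 \<subseteq> path_image (rectpath a1 a3)"
      "closed_segment a4 a1 \<subseteq> path_image (rectpath a1 a3)"
      by (auto simp: rect path_image_join)
    note cis = segs[THEN ci]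
    have sum: "2 * of_real pi * \<i> * \<phi> z0 = contour_integral (linepath a1 a2) f +
        (contour_integral (linepath a2 a3) f + (contour_integral (linepath a3 a4) f
        + contour_integral (linepath a4 a1) f))"
      using contour_integral_unique[OF hc] cis wn
      by (simp add: rect contour_integrable_joinI valid_path_join)
    have "contour_integral (linepath a1 a2) f = integral {-r..r} (\<lambda>x. f (of_real x))"
      using contour_integral_linepath_Reals_eq[of a1 a2 f] rpos
      by (simp add: a1_def a2_def complex_is_Real_iff)
    also have "\<dots> = I r" by (simp add: I_def g_def f_def)
    finally have bottom: "contour_integral (linepath a1 a2) f = I r" .
    have bd: "norm (f z) \<le> C / r\<^sup>2" if "norm z \<ge> r" "Im z \<ge> 0" for z
    proof -
      have "norm (f z) \<le> C / (norm z)\<^sup>2"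
        unfolding f_def using decay that rpos by auto
      also have "\<dots> \<le> C / r\<^sup>2"
        using that rpos C0 by (intro divide_left_mono power_mono mult_pos_pos) auto
      finally show ?thesis .
    qed
    have far: "norm z \<ge> r \<and> Im z \<ge> 0" if "z \<in> closed_segment a b"
      "(a, b) \<in> {(a2, a3), (a3, a4), (a4, a1)}" for a b z
    proof -
      have "(Re z = r \<or> Re z = -r \<or> Im z = r) \<and> Im z \<ge> 0"
        using that rpos
        by (auto simp: a1_def a2_def a3_def a4_def closed_segment_same_Re closed_segment_same_Im
            closed_segment_eq_real_ivl split: if_splits)
      then show ?thesis
        using abs_Re_le_cmod[of z] abs_Im_le_cmod[of z] rpos by auto
    qed
    have side: "norm (contour_integral (linepath a b) f) \<le> C / r\<^sup>2 * norm (b - a)"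
      if "(a, b) \<in> {(a2, a3), (a3, a4), (a4, a1)}" for a b
      using that cis far[OF _ that] bd C0 rpos
      by (intro contour_integral_bound_linepath) auto
    have lens: "norm (a3 - a2) = r" "norm (a4 - a3) = 2 * r" "norm (a1 - a4) = r"
      using rpos by (simp_all add: a1_def a2_def a3_def a4_def cmod_def real_sqrt_mult)
    have "I r - 2 * of_real pi * \<i> * \<phi> z0 = - (contour_integral (linepath a2 a3) f
       + (contour_integral (linepath a3 a4) f + contour_integral (linepath a4 a1) f))"
      using sum bottom by simp
    then have "norm (I r - 2 * of_real pi * \<i> * \<phi> z0) \<le>
       norm (contour_integral (linepath a2 a3) f) + (norm (contour_integral (linepath a3 a4) f)
        + norm (contour_integral (linepath a4 a1) f))"
      by (metis (no_types, lifting) add_left_mono norm_minus_cancel norm_triangle_ineq order_trans)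
    also have "\<dots> \<le> C / r\<^sup>2 * r + (C / r\<^sup>2 * (2 * r) + C / r\<^sup>2 * r)"
      using side[of a2 a3] side[of a3 a4] side[of a4 a1] unfolding lens by (intro add_mono) auto
    also have "\<dots> = 4 * C / r"
      using rpos by (simp add: field_simps power2_eq_square)
    finally show ?thesis .
  qed
  have "((\<lambda>r. I r - 2 * of_real pi * \<i> * \<phi> z0) \<longlongrightarrow> 0) at_top"
  proof (rule Lim_null_comparison)
    show "\<forall>\<^sub>F r in at_top. norm (I r - 2 * of_real pi * \<i> * \<phi> z0) \<le> 4 * C / r"
      using eventually_ge_at_top[of R1] by eventually_elim (rule est)
    show "((\<lambda>r. 4 * C / r) \<longlongrightarrow> 0) at_top" by real_asymp
  qed
  then have lim1: "(I \<longlongrightarrow> 2 * of_real pi * \<i> * \<phi> z0) at_top"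
    by (simp add: LIM_zero_iff)
  have lim2: "(\<lambda>n. I (real n)) \<longlonglongrightarrow> (LINT x|lborel. g x)"
  proof -
    have "I (real n) = (LINT x|lborel. indicator {-real n..real n} x *\<^sub>R g x)" for n
      unfolding I_def using int
      by (subst set_borel_integral_eq_integral(2)[symmetric])
        (auto simp: set_lebesgue_integral_def set_integrable_def intro: integrable_mult_indicator)
    then show ?thesis using tendsto_integral_symmetric_interval[OF int] by simp
  qed
  have "(\<lambda>n. I (real n)) \<longlonglongrightarrow> 2 * of_real pi * \<i> * \<phi> z0"
    using filterlim_compose[OF lim1 filterlim_real_sequentially] by simp
  then show "(LINT x|lborel. \<phi> (of_real x) / (of_real x - z0)) = 2 * of_real pi * \<i> * \<phi> z0"
    using LIMSEQ_unique[OF lim2] by (simp add: g_def)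
qed

section \<open>The Cauchy transform\<close>

definition cauchy :: "(real \<Rightarrow> complex) \<Rightarrow> complex \<Rightarrow> complex" where
  "cauchy h z = (LINT t|lborel. h t / (of_real t - z))"

section \<open>The unweighted space of square integrable functions\<close>

definition L2 :: "(real \<Rightarrow> complex) set" where
  "L2 = {f \<in> borel_measurable lborel. integrable lborel (\<lambda>x. (cmod (f x))\<^sup>2)}"

lemma L2_measurable: "f \<in> L2 \<Longrightarrow> f \<in> borel_measurable borel"
  and L2_integrable: "f \<in> L2 \<Longrightarrow> integrable lborel (\<lambda>x. (cmod (f x))\<^sup>2)"
  by (auto simp: L2_def)

lemma prod_le_sum_squares: "(a::real) * b \<le> a\<^sup>2 + b\<^sup>2"
  using sum_squares_bound[of a b] sum_power2_ge_zero[of a b] by linarith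

lemma L2_mult_integrable:
  assumes f: "f \<in> L2" and g: "g \<in> L2"
  shows "integrable lborel (\<lambda>x. f x * g x)"
proof (rule Bochner_Integration.integrable_bound)
  show "integrable lborel (\<lambda>x. (cmod (f x))\<^sup>2 + (cmod (g x))\<^sup>2)"
    using f g by (simp add: L2_integrable)
  show "(\<lambda>x. f x * g x) \<in> borel_measurable lborel"
    using f g by (auto simp: L2_def)
  have "cmod (f x) * cmod (g x) \<le> (cmod (f x))\<^sup>2 + (cmod (g x))\<^sup>2" for x
    by (rule prod_le_sum_squares)
  then show "AE x in lborel. norm (f x * g x) \<le> norm ((cmod (f x))\<^sup>2 + (cmod (g x))\<^sup>2)"
    by (simp add: norm_mult)
qed

lemma L2_add:
  assumes f: "f \<in> L2" and g: "g \<in> L2"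
  shows "(\<lambda>x. f x + g x) \<in> L2"
proof -
  have "integrable lborel (\<lambda>x. (cmod (f x + g x))\<^sup>2)"
  proof (rule Bochner_Integration.integrable_bound)
    show "integrable lborel (\<lambda>x. 2 * (cmod (f x))\<^sup>2 + 2 * (cmod (g x))\<^sup>2)"
      using f g by (simp add: L2_integrable)
    show "(\<lambda>x. (cmod (f x + g x))\<^sup>2) \<in> borel_measurable lborel"
      using f g by (auto simp: L2_def)
    have "(cmod (f x + g x))\<^sup>2 \<le> 2 * (cmod (f x))\<^sup>2 + 2 * (cmod (g x))\<^sup>2" for x
    proof -
      have "(cmod (f x + g x))\<^sup>2 \<le> (cmod (f x) + cmod (g x))\<^sup>2"
        by (intro power_mono norm_triangle_ineq) auto
      then show ?thesis
        using sum_squares_bound[of "cmod (f x)" "cmod (g x)"] by (simp add: power2_sum)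
    qed
    then show "AE x in lborel. norm ((cmod (f x + g x))\<^sup>2) \<le> norm (2 * (cmod (f x))\<^sup>2 + 2 * (cmod (g x))\<^sup>2)"
      by simp
  qed
  then show ?thesis using f g by (auto simp: L2_def)
qed

lemma L2_mult_bounded:
  assumes f: "f \<in> L2" and r: "r \<in> borel_measurable borel" and B: "\<And>x. cmod (r x) \<le> B"
  shows "(\<lambda>x. r x * f x) \<in> L2"
proof -
  have "integrable lborel (\<lambda>x. (cmod (r x * f x))\<^sup>2)"
  proof (rule Bochner_Integration.integrable_bound)
    show "integrable lborel (\<lambda>x. B\<^sup>2 * (cmod (f x))\<^sup>2)"
      using f by (simp add: L2_integrable)
    show "(\<lambda>x. (cmod (r x * f x))\<^sup>2) \<in> borel_measurable lborel"
      using f r by (auto simp: L2_def)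
    show "AE x in lborel. norm ((cmod (r x * f x))\<^sup>2) \<le> norm (B\<^sup>2 * (cmod (f x))\<^sup>2)"
      using B by (auto simp: norm_mult power_mult_distrib intro!: mult_right_mono power_mono)
  qed
  then show ?thesis using f r by (auto simp: L2_def)
qed

lemma L2_scale: "f \<in> L2 \<Longrightarrow> (\<lambda>x. c * f x) \<in> L2"
  using L2_mult_bounded[of f "\<lambda>_. c" "cmod c"] by simp

lemma L2_diff: "f \<in> L2 \<Longrightarrow> g \<in> L2 \<Longrightarrow> (\<lambda>x. f x - g x) \<in> L2"
  using L2_add[of f "\<lambda>x. -1 * g x"] L2_scale[of g "-1"] by simp

lemma L2_cnj: "f \<in> L2 \<Longrightarrow> (\<lambda>x. cnj (f x)) \<in> L2"
  by (simp add: L2_def measurable_cnj)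

section \<open>Poisson and Cauchy kernels\<close>

lemma has_bochner_integral_poisson_kernel:
  assumes "\<eta> > 0"
  shows "has_bochner_integral lborel (\<lambda>x. \<eta> / ((x - a)\<^sup>2 + \<eta>\<^sup>2)) pi"
proof -
  have "has_bochner_integral lborel (\<lambda>x::real. 1 / (1 + x\<^sup>2)) pi"
    using integrable_inverse_square_plus_one integral_inverse_square_plus_one
    by (simp add: has_bochner_integral_iff)
  then have "has_bochner_integral lborel (\<lambda>x. 1 / (1 + (- a / \<eta> + 1 / \<eta> * x)\<^sup>2)) (pi /\<^sub>R \<bar>1 / \<eta>\<bar>)"
    using lborel_has_bochner_integral_real_affine_iff[of "1/\<eta>" "\<lambda>x. 1 / (1 + x\<^sup>2)" pi "-a/\<eta>"] assms by simp
  then have "has_bochner_integral lborel (\<lambda>x. (1 / \<eta>) * (1 / (1 + (- a / \<eta> + 1 / \<eta> * x)\<^sup>2))) ((1 / \<eta>) * (pi /\<^sub>R \<bar>1 / \<eta>\<bar>))"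
    by (rule has_bochner_integral_mult_right)
  moreover have "(1 / \<eta>) * (1 / (1 + (- a / \<eta> + 1 / \<eta> * x)\<^sup>2)) = \<eta> / ((x - a)\<^sup>2 + \<eta>\<^sup>2)" for x
  proof -
    have "- a / \<eta> + 1 / \<eta> * x = (x - a) / \<eta>" using assms by (simp add: field_simps)
    moreover have "(1 + ((x - a) / \<eta>)\<^sup>2) * \<eta>\<^sup>2 = (x - a)\<^sup>2 + \<eta>\<^sup>2"
      using assms by (simp add: field_simps)
    then have "1 / (1 + ((x - a) / \<eta>)\<^sup>2) = \<eta>\<^sup>2 / ((x - a)\<^sup>2 + \<eta>\<^sup>2)"
      using assms by (metis div_by_1 mult_divide_mult_cancel_right nonzero_mult_div_cancel_right
          mult_1 power_not_zero less_irrefl)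
    ultimately show ?thesis using assms
      by (simp add: power2_eq_square)
  qed
  ultimately show ?thesis using assms by simp
qed

lemma cmod_kernel_square: "(cmod (of_real t - Complex x \<eta>))\<^sup>2 = (x - t)\<^sup>2 + \<eta>\<^sup>2"
  unfolding cmod_power2 by (simp add: power2_commute)

lemma cmod_kernel_ge: "\<bar>Im z\<bar> \<le> cmod (of_real t - z)"
  using abs_Im_le_cmod[of "of_real t - z"] by simp

lemma kernel_nonzero: "Im z \<noteq> 0 \<Longrightarrow> of_real t - z \<noteq> 0"
  by (auto simp: complex_eq_iff)

lemma integrable_mult_bounded:
  fixes h :: "real \<Rightarrow> complex"
  assumes h: "integrable lborel h" and r: "r \<in> borel_measurable borel" and B: "\<And>x. cmod (r x) \<le> B"
  shows "integrable lborel (\<lambda>x. h x * r x)"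
proof (rule Bochner_Integration.integrable_bound)
  show "integrable lborel (\<lambda>x. B * norm (h x))" using h by simp
  show "(\<lambda>x. h x * r x) \<in> borel_measurable lborel" using h r by auto
  show "AE x in lborel. norm (h x * r x) \<le> norm (B * norm (h x))"
  proof (intro always_eventually allI)
    fix x
    have "B \<ge> 0" using B[of x] norm_ge_zero order_trans by blast
    then show "norm (h x * r x) \<le> norm (B * norm (h x))"
      using mult_right_mono[OF B[of x], of "cmod (h x)"] by (simp add: norm_mult mult.commute)
  qed
qed

lemma cauchy_integrable:
  assumes h: "integrable lborel h" and z: "Im z \<noteq> 0"
  shows "integrable lborel (\<lambda>t. h t / (of_real t - z))"
proof -
  have "cmod (1 / (of_real t - z)) \<le> 1 / \<bar>Im z\<bar>" for t
    unfolding norm_divide using cmod_kernel_ge[of z t] z by (simp add: frac_le)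
  from integrable_mult_bounded[OF h _ this] show ?thesis by simp
qed

lemma cauchy_cnj: "cauchy h (cnj z) = cnj (cauchy (\<lambda>t. cnj (h t)) z)"
proof -
  have "cnj (cauchy (\<lambda>t. cnj (h t)) z) = (LINT t|lborel. cnj (cnj (h t) / (of_real t - z)))"
    unfolding cauchy_def by (rule Bochner_Integration.integral_cnj[symmetric])
  also have "\<dots> = cauchy h (cnj z)" by (simp add: cauchy_def)
  finally show ?thesis by simp
qed

lemma cauchy_measurable [measurable]:
  assumes [measurable]: "h \<in> borel_measurable borel"
  shows "(\<lambda>x. cauchy h (Complex x \<eta>)) \<in> borel_measurable borel"
proof -
  have "(\<lambda>x. cauchy h (Complex x \<eta>)) = (\<lambda>x. LINT t|lborel. h t / (of_real t - (of_real x + \<i> * of_real \<eta>)))"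
    by (simp add: cauchy_def complex_eq_iff Complex_eq)
  also have "\<dots> \<in> borel_measurable borel"
    by measurable
  finally show ?thesis .
qed

lemma kernel_L2:
  assumes "\<eta> \<noteq> 0"
  shows "(\<lambda>x. 1 / (of_real t - Complex x \<eta>)) \<in> L2"
    and "(LINT x|lborel. (cmod (1 / (of_real t - Complex x \<eta>)))\<^sup>2) = pi / \<bar>\<eta>\<bar>"
proof -
  have "has_bochner_integral lborel (\<lambda>x. (1 / \<bar>\<eta>\<bar>) * (\<bar>\<eta>\<bar> / ((x - t)\<^sup>2 + \<bar>\<eta>\<bar>\<^sup>2))) ((1 / \<bar>\<eta>\<bar>) * pi)"
    using assms by (intro has_bochner_integral_mult_right has_bochner_integral_poisson_kernel) auto
  moreover have "(1 / \<bar>\<eta>\<bar>) * (\<bar>\<eta>\<bar> / ((x - t)\<^sup>2 + \<bar>\<eta>\<bar>\<^sup>2)) = (cmod (1 / (of_real t - Complex x \<eta>)))\<^sup>2" for x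
    using assms by (simp add: norm_divide power_divide cmod_kernel_square)
  ultimately have *: "has_bochner_integral lborel (\<lambda>x. (cmod (1 / (of_real t - Complex x \<eta>)))\<^sup>2) (pi / \<bar>\<eta>\<bar>)"
    by simp
  have "(\<lambda>x. 1 / (of_real t - Complex x \<eta>)) \<in> borel_measurable borel"
    unfolding Complex_eq by measurable
  with * show "(\<lambda>x. 1 / (of_real t - Complex x \<eta>)) \<in> L2"
    by (simp add: L2_def has_bochner_integral_iff)
  show "(LINT x|lborel. (cmod (1 / (of_real t - Complex x \<eta>)))\<^sup>2) = pi / \<bar>\<eta>\<bar>"
    using * by (simp add: has_bochner_integral_iff)
qed

text \<open>Fubini. Its hypothesis holds because \<open>|K| * |kernel|\<close> is at most the sum of
  the two squares, and the square integral of the kernel along the line at height \<eta> does not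
  depend on \<open>s\<close>; so the inner integral is bounded by the constant \<open>B\<close>, and
  \<open>h\<close> is integrable.\<close>

lemma cauchy_pairing:
  assumes K: "K \<in> L2" and h: "integrable lborel h" and \<eta>: "\<eta> \<noteq> 0"
  shows "(LINT x|lborel. K x * cauchy h (Complex x \<eta>)) =
      (LINT s|lborel. h s * (LINT x|lborel. K x / (of_real s - Complex x \<eta>)))"
proof -
  have [measurable]: "K \<in> borel_measurable borel" "h \<in> borel_measurable borel"
    using K h by (auto simp: L2_def)
  define B where "B = (LINT x|lborel. (cmod (K x))\<^sup>2) + pi / \<bar>\<eta>\<bar>"
  define f where "f = (\<lambda>s x. h s * (K x * (1 / (of_real s - Complex x \<eta>))))"
  have meas: "case_prod f \<in> borel_measurable (lborel \<Otimes>\<^sub>M lborel)"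
    unfolding f_def Complex_eq by measurable
  have inner: "integrable lborel (\<lambda>x. K x * (1 / (of_real s - Complex x \<eta>)))" for s
    by (intro L2_mult_integrable K kernel_L2 \<eta>)
  have inner_le: "(LINT x|lborel. cmod (K x * (1 / (of_real s - Complex x \<eta>)))) \<le> B" for s
  proof -
    have "(LINT x|lborel. cmod (K x * (1 / (of_real s - Complex x \<eta>)))) \<le>
       (LINT x|lborel. (cmod (K x))\<^sup>2 + (cmod (1 / (of_real s - Complex x \<eta>)))\<^sup>2)"
    proof (rule integral_mono)
      show "integrable lborel (\<lambda>x. (cmod (K x))\<^sup>2 + (cmod (1 / (of_real s - Complex x \<eta>)))\<^sup>2)"
        using K kernel_L2(1)[OF \<eta>] by (intro Bochner_Integration.integrable_add L2_integrable)
      show "cmod (K x * (1 / (of_real s - Complex x \<eta>))) \<le> (cmod (K x))\<^sup>2 + (cmod (1 / (of_real s - Complex x \<eta>)))\<^sup>2" for x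
        unfolding norm_mult by (rule prod_le_sum_squares)
    qed (use inner in auto)
    also have "\<dots> = B"
      unfolding B_def using K kernel_L2[OF \<eta>, of s]
      by (subst Bochner_Integration.integral_add) (auto simp: L2_integrable)
    finally show ?thesis .
  qed
  have int: "integrable (lborel \<Otimes>\<^sub>M lborel) (case_prod f)"
  proof (rule lborel_pair.Fubini_integrable[OF meas])
    show "integrable lborel (\<lambda>s. LINT x|lborel. norm (case_prod f (s, x)))"
    proof (rule Bochner_Integration.integrable_bound)
      show "integrable lborel (\<lambda>s. norm (h s) * B)" using h by simp
      show "(\<lambda>s. LINT x|lborel. norm (case_prod f (s, x))) \<in> borel_measurable lborel"
        using meas by measurable
      show "AE s in lborel. norm (LINT x|lborel. norm (case_prod f (s, x))) \<le> norm (norm (h s) * B)"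
      proof (intro always_eventually allI)
        fix s
        have "(LINT x|lborel. norm (case_prod f (s, x))) =
          norm (h s) * (LINT x|lborel. cmod (K x * (1 / (of_real s - Complex x \<eta>))))"
          by (simp only: f_def prod.case norm_mult integral_mult_right_zero)
        moreover have "0 \<le> (LINT x|lborel. cmod (K x * (1 / (of_real s - Complex x \<eta>))))"
          by simp
        ultimately show "norm (LINT x|lborel. norm (case_prod f (s, x))) \<le> norm (norm (h s) * B)"
          using inner_le[of s]
          by (simp add: abs_mult mult_left_mono del: integral_nonneg_AE)
      qed
    qed
    show "AE s in lborel. integrable lborel (\<lambda>x. case_prod f (s, x))"
      unfolding f_def prod.case by (intro always_eventually allI integrable_mult_right inner)
  qed
  have "(LINT x|lborel. K x * cauchy h (Complex x \<eta>)) = (LINT x|lborel. LINT s|lborel. f s x)"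
    unfolding f_def cauchy_def
    by (simp add: algebra_simps flip: integral_mult_right_zero)
  also have "\<dots> = (LINT s|lborel. LINT x|lborel. f s x)"
    by (rule lborel_pair.Fubini_integral[OF int])
  also have "\<dots> = (LINT s|lborel. h s * (LINT x|lborel. K x / (of_real s - Complex x \<eta>)))"
    unfolding f_def integral_mult_right_zero by simp
  finally show ?thesis .
qed

section \<open>Residue integrals of products of two kernels\<close>

lemma norm_diff_ge_half:
  fixes a z :: complex
  assumes "2 * norm a \<le> norm z"
  shows "norm z / 2 \<le> norm (a - z)"
  using norm_triangle_ineq2[of z a] assms by (simp add: norm_minus_commute)

lemma kernel_decay:
  fixes a b z :: complex
  assumes "2 * norm a \<le> norm z" "2 * norm b \<le> norm z" "1 \<le> norm z"
  shows "norm (1 / ((a - z) * (b - z))) \<le> 4 / (norm z)\<^sup>2"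
proof -
  have "norm z / 2 * (norm z / 2) \<le> norm (a - z) * norm (b - z)"
    using norm_diff_ge_half assms by (intro mult_mono) auto
  moreover have "norm z / 2 * (norm z / 2) > 0" using assms(3) by (intro mult_pos_pos) linarith+
  ultimately have "1 / (norm (a - z) * norm (b - z)) \<le> 1 / (norm z / 2 * (norm z / 2))"
    by (intro divide_left_mono mult_pos_pos) auto
  then show ?thesis by (simp add: norm_divide norm_mult power2_eq_square)
qed

text \<open>Moves the integration line from height \<eta> to the real axis and the pole of the
  kernel down by \<eta>, so that the Cauchy formula on the real axis serves every height.\<close>

lemma shifted_kernel: "of_real t - Complex x \<eta> = (of_real t - \<i> * of_real \<eta>) - of_real x"
  by (simp add: complex_eq_iff)

lemma kernel_product_holomorphic:
  assumes "\<eta> > 0" "\<epsilon> > 0"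
  shows "(\<lambda>z. 1 / ((of_real s - \<i> * of_real \<eta> - z) * (of_real t - \<i> * of_real \<epsilon> - z)))
           holomorphic_on {z. Im z > - min \<eta> \<epsilon>}"
proof -
  have "of_real s - \<i> * of_real \<eta> - z \<noteq> 0" "of_real t - \<i> * of_real \<epsilon> - z \<noteq> 0"
    if "z \<in> {z. Im z > - min \<eta> \<epsilon>}" for z
    using that by (auto simp: complex_eq_iff)
  then show ?thesis by (intro holomorphic_intros) simp
qed

text \<open>After the shift both kernels have their poles in the lower half-plane, so the explicit
  pole \<open>p\<close> is the only one enclosed. The two heights may differ while \<open>e\<close>
  is taken at height \<eta>, which is why the second kernel appears at
  \<open>p - \<i> (\<eta> - \<epsilon>)\<close>.\<close>

lemma integral_kernel_same_side_pole:
  assumes e: "e holomorphic_on {z. Im z > 0}" and \<eta>: "\<eta> > 0" and \<epsilon>: "\<epsilon> > 0" and p: "Im p > \<eta>"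
    and bd: "\<And>z. Im z \<ge> \<eta> \<Longrightarrow> norm z \<ge> R \<Longrightarrow> norm (e z / (z - p)) \<le> C"
  shows "(LINT x|lborel. e (Complex x \<eta>) / (Complex x \<eta> - p) / ((of_real s - Complex x \<eta>) * (of_real t - Complex x \<epsilon>))) =
    2 * of_real pi * \<i> * (e p / ((of_real s - p) * (of_real t - (p - \<i> * of_real (\<eta> - \<epsilon>)))))"
proof -
  define a where "a = of_real s - \<i> * of_real \<eta>"
  define b where "b = of_real t - \<i> * of_real \<epsilon>"
  define \<delta> where "\<delta> = min \<eta> \<epsilon>"
  have \<delta>: "\<delta> > 0" using \<eta> \<epsilon> by (simp add: \<delta>_def)
  define q where "q = p - \<i> * of_real \<eta>"
  define \<phi> where "\<phi> = (\<lambda>z. e (z + \<i> * of_real \<eta>) * (1 / ((a - z) * (b - z))))"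
  have hol: "\<phi> holomorphic_on {z. Im z > - \<delta>}"
  proof -
    have "(e \<circ> (\<lambda>z. z + \<i> * of_real \<eta>)) holomorphic_on {z. Im z > - \<delta>}"
      by (rule holomorphic_on_compose_gen[OF _ e]) (auto intro!: holomorphic_intros simp: \<delta>_def)
    then show ?thesis
      using kernel_product_holomorphic[OF \<eta> \<epsilon>, of s t]
      unfolding \<phi>_def a_def b_def \<delta>_def o_def by (intro holomorphic_on_mult) simp_all
  qed
  define R0 where "R0 = max (max (2 * norm a) (2 * norm b)) (max 1 (\<bar>R\<bar> + \<eta>))"
  have dec: "norm (\<phi> z / (z - q)) \<le> (\<bar>C\<bar> * 4) / (norm z)\<^sup>2" if z: "Im z \<ge> 0" "norm z \<ge> R0" for z
  proof -
    have "\<phi> z / (z - q) = e (z + \<i> * of_real \<eta>) / ((z + \<i> * of_real \<eta>) - p) * (1 / ((a - z) * (b - z)))"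
      by (simp add: \<phi>_def q_def algebra_simps)
    then have "norm (\<phi> z / (z - q)) = norm (e (z + \<i> * of_real \<eta>) / ((z + \<i> * of_real \<eta>) - p)) * norm (1 / ((a - z) * (b - z)))"
      by (simp only: norm_mult)
    also have "\<dots> \<le> \<bar>C\<bar> * (4 / (norm z)\<^sup>2)"
    proof (rule mult_mono)
      have "norm (\<i> * of_real \<eta>) = \<eta>" using \<eta> by (simp add: norm_mult)
      then have "norm (z + \<i> * of_real \<eta>) \<ge> norm z - \<eta>"
        using norm_diff_ineq[of z "\<i> * of_real \<eta>"] by simp
      moreover have "\<bar>R\<bar> + \<eta> \<le> norm z" using z by (simp add: R0_def)
      ultimately have "norm (z + \<i> * of_real \<eta>) \<ge> R" by linarith
      then have "norm (e (z + \<i> * of_real \<eta>) / ((z + \<i> * of_real \<eta>) - p)) \<le> C"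
        using bd[of "z + \<i> * of_real \<eta>"] z by simp
      then show "norm (e (z + \<i> * of_real \<eta>) / ((z + \<i> * of_real \<eta>) - p)) \<le> \<bar>C\<bar>" by linarith
      show "norm (1 / ((a - z) * (b - z))) \<le> 4 / (norm z)\<^sup>2"
        using z by (intro kernel_decay) (auto simp: R0_def)
    qed auto
    finally show ?thesis by simp
  qed
  have "(LINT x|lborel. \<phi> (of_real x) / (of_real x - q)) = 2 * of_real pi * \<i> * \<phi> q"
    by (rule real_line_Cauchy_formula[OF \<delta> hol _ dec]) (use p in \<open>auto simp: q_def\<close>)
  moreover have "\<phi> (of_real x) / (of_real x - q) =
     e (Complex x \<eta>) / (Complex x \<eta> - p) / ((of_real s - Complex x \<eta>) * (of_real t - Complex x \<epsilon>))" for x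
  proof -
    have "of_real x + \<i> * of_real \<eta> = Complex x \<eta>" by (simp add: complex_eq_iff)
    moreover have "of_real x - q = Complex x \<eta> - p" by (simp add: q_def complex_eq_iff)
    ultimately show ?thesis
      by (simp add: \<phi>_def a_def b_def shifted_kernel)
  qed
  moreover have "\<phi> q = e p / ((of_real s - p) * (of_real t - (p - \<i> * of_real (\<eta> - \<epsilon>))))"
    by (simp add: \<phi>_def q_def a_def b_def algebra_simps)
  ultimately show ?thesis by simp
qed

lemma integral_kernel_same_side:
  assumes e: "e holomorphic_on {z. Im z > 0}" and \<eta>: "\<eta> > 0" and \<epsilon>: "\<epsilon> > 0"
    and bd: "\<And>z. Im z \<ge> \<eta> \<Longrightarrow> norm z \<ge> R \<Longrightarrow> norm (e z) \<le> C"
  shows "(LINT x|lborel. e (Complex x \<eta>) / ((of_real s - Complex x \<eta>) * (of_real t - Complex x \<epsilon>))) = 0"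
proof -
  \<comment> \<open>An artificial pole above the line: the factor \<open>(z - p) / (z - p)\<close>
    brings the integrand into the form of the previous lemma, and since the numerator vanishes at
    \<open>p\<close> the residue is 0.\<close>
  define p where "p = Complex 0 (\<eta> + 1)"
  have "(LINT x|lborel. e (Complex x \<eta>) * (Complex x \<eta> - p) / (Complex x \<eta> - p) /
      ((of_real s - Complex x \<eta>) * (of_real t - Complex x \<epsilon>))) =
    2 * of_real pi * \<i> * (e p * (p - p) / ((of_real s - p) * (of_real t - (p - \<i> * of_real (\<eta> - \<epsilon>)))))"
  proof (rule integral_kernel_same_side_pole[OF _ \<eta> \<epsilon>])
    show "(\<lambda>z. e z * (z - p)) holomorphic_on {z. Im z > 0}" by (intro holomorphic_intros e)
    show "norm (e z * (z - p) / (z - p)) \<le> \<bar>C\<bar>" if "Im z \<ge> \<eta>" "norm z \<ge> R" for z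
      using bd[OF that] by (cases "z = p") auto
  qed (simp add: p_def)
  moreover have "Complex x \<eta> - p \<noteq> 0" for x by (simp add: p_def complex_eq_iff)
  ultimately show ?thesis by simp
qed

text \<open>Only the second kernel, at height -\<epsilon>, has its pole above the line of
  integration. That the value involves the heights through \<eta> + \<epsilon> alone is the fact on
  which the convergence theory in \<open>L2\<close> rests.\<close>

lemma integral_kernel_opposite_sides:
  assumes \<eta>: "\<eta> > 0" and \<epsilon>: "\<epsilon> > 0"
  shows "(LINT x|lborel. 1 / ((of_real s - Complex x \<eta>) * (of_real t - Complex x (- \<epsilon>)))) =
      2 * of_real pi * \<i> / (of_real t - of_real s + \<i> * of_real (\<eta> + \<epsilon>))"
proof -
  define a where "a = of_real s - \<i> * of_real \<eta>"
  define b where "b = of_real t + \<i> * of_real \<epsilon>"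
  define \<phi> where "\<phi> = (\<lambda>z. - 1 / (a - z))"
  have hol: "\<phi> holomorphic_on {z. Im z > - \<eta>}"
    unfolding \<phi>_def a_def by (intro holomorphic_intros) (auto simp: complex_eq_iff)
  define R0 where "R0 = max (max (2 * norm a) (2 * norm b)) 1"
  have eq: "\<phi> z / (z - b) = 1 / ((a - z) * (b - z))" for z
    unfolding \<phi>_def divide_divide_eq_left
    by (metis minus_diff_eq minus_divide_left minus_divide_right mult_minus_right)
  have dec: "norm (\<phi> z / (z - b)) \<le> 4 / (norm z)\<^sup>2" if z: "Im z \<ge> 0" "norm z \<ge> R0" for z
    unfolding eq using z by (intro kernel_decay) (auto simp: R0_def)
  have "(LINT x|lborel. \<phi> (of_real x) / (of_real x - b)) = 2 * of_real pi * \<i> * \<phi> b"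
    by (rule real_line_Cauchy_formula[OF \<eta> hol _ dec]) (use \<epsilon> in \<open>auto simp: b_def\<close>)
  moreover have "\<phi> (of_real x) / (of_real x - b) =
      1 / ((of_real s - Complex x \<eta>) * (of_real t - Complex x (- \<epsilon>)))" for x
    unfolding eq shifted_kernel by (simp add: a_def b_def)
  moreover have "\<phi> b = 1 / (of_real t - of_real s + \<i> * of_real (\<eta> + \<epsilon>))"
  proof -
    have "a - b = - (of_real t - of_real s + \<i> * of_real (\<eta> + \<epsilon>))"
      by (simp add: a_def b_def algebra_simps)
    then show ?thesis by (simp only: \<phi>_def minus_divide_divide)
  qed
  ultimately show ?thesis by simp
qed

text \<open>Cauchy-Schwarz for the splitting of \<open>|h| * k\<close> into \<open>sqrt |h|\<close>
  and \<open>sqrt |h| * k\<close>, followed by Tonelli. Integrability of \<open>h\<close> is enough,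
  but the resulting bound grows like \<open>1 / |\<eta>|\<close>; a bound uniform in \<eta> comes
  later, for \<open>h\<close> in \<open>L2\<close>.\<close>

lemma cauchy_L2:
  assumes h: "integrable lborel h" and \<eta>: "\<eta> \<noteq> 0"
  shows "(\<lambda>x. cauchy h (Complex x \<eta>)) \<in> L2"
proof -
  have [measurable]: "h \<in> borel_measurable borel" using h by auto
  define k where "k = (\<lambda>x t. ennreal (cmod (1 / (of_real t - Complex x \<eta>))))"
  define H where "H = (\<integral>\<^sup>+t. ennreal (cmod (h t)) \<partial>lborel)"
  have [measurable]: "case_prod k \<in> borel_measurable (lborel \<Otimes>\<^sub>M lborel)"
    unfolding k_def Complex_eq by measurable
  have [measurable]: "(\<lambda>t. k x t) \<in> borel_measurable borel" for x
    unfolding k_def Complex_eq by measurable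
  have [measurable]: "(\<lambda>x. k x t) \<in> borel_measurable borel" for t
    unfolding k_def Complex_eq by measurable
  have H: "H < \<infinity>" using h by (simp add: H_def integrable_iff_bounded)
  have pt: "ennreal ((cmod (cauchy h (Complex x \<eta>)))\<^sup>2) \<le> H * (\<integral>\<^sup>+t. ennreal (cmod (h t)) * (k x t)\<^sup>2 \<partial>lborel)" for x
  proof -
    have "ennreal (cmod (cauchy h (Complex x \<eta>))) \<le> (\<integral>\<^sup>+t. ennreal (cmod (h t / (of_real t - Complex x \<eta>))) \<partial>lborel)"
      unfolding cauchy_def
      by (rule integral_norm_bound_ennreal) (use cauchy_integrable[OF h, of "Complex x \<eta>"] \<eta> in simp)
    also have "\<dots> = (\<integral>\<^sup>+t. ennreal (sqrt (cmod (h t))) * (ennreal (sqrt (cmod (h t))) * k x t) \<partial>lborel)"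
      unfolding k_def
      by (intro nn_integral_cong) (simp add: norm_divide ennreal_mult[symmetric] mult.assoc[symmetric])
    finally have "(ennreal (cmod (cauchy h (Complex x \<eta>))))\<^sup>2 \<le>
       (\<integral>\<^sup>+t. ennreal (sqrt (cmod (h t))) * (ennreal (sqrt (cmod (h t))) * k x t) \<partial>lborel)\<^sup>2"
      by (intro power_mono) auto
    also have "\<dots> \<le> (\<integral>\<^sup>+t. (ennreal (sqrt (cmod (h t))))\<^sup>2 \<partial>lborel) *
        (\<integral>\<^sup>+t. (ennreal (sqrt (cmod (h t))) * k x t)\<^sup>2 \<partial>lborel)"
      by (rule Cauchy_Schwarz_nn_integral) measurable
    also have "\<dots> = H * (\<integral>\<^sup>+t. ennreal (cmod (h t)) * (k x t)\<^sup>2 \<partial>lborel)"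
      unfolding H_def by (simp add: power_mult_distrib ennreal_power)
    finally show ?thesis by (simp add: ennreal_power)
  qed
  have "(\<integral>\<^sup>+x. ennreal ((cmod (cauchy h (Complex x \<eta>)))\<^sup>2) \<partial>lborel) \<le>
      (\<integral>\<^sup>+x. H * (\<integral>\<^sup>+t. ennreal (cmod (h t)) * (k x t)\<^sup>2 \<partial>lborel) \<partial>lborel)"
    by (intro nn_integral_mono pt)
  also have "\<dots> = H * (\<integral>\<^sup>+x. \<integral>\<^sup>+t. ennreal (cmod (h t)) * (k x t)\<^sup>2 \<partial>lborel \<partial>lborel)"
    by (rule nn_integral_cmult) measurable
  also have "(\<integral>\<^sup>+x. \<integral>\<^sup>+t. ennreal (cmod (h t)) * (k x t)\<^sup>2 \<partial>lborel \<partial>lborel) =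
      (\<integral>\<^sup>+t. \<integral>\<^sup>+x. ennreal (cmod (h t)) * (k x t)\<^sup>2 \<partial>lborel \<partial>lborel)"
    by (rule lborel_pair.Fubini') measurable
  also have "\<dots> = (\<integral>\<^sup>+t. ennreal (cmod (h t)) * ennreal (pi / \<bar>\<eta>\<bar>) \<partial>lborel)"
  proof (intro nn_integral_cong)
    fix t
    have "(\<integral>\<^sup>+x. (k x t)\<^sup>2 \<partial>lborel) = ennreal (LINT x|lborel. (cmod (1 / (of_real t - Complex x \<eta>)))\<^sup>2)"
      unfolding k_def using L2_integrable[OF kernel_L2(1)[OF \<eta>, of t]]
      by (subst nn_integral_eq_integral[symmetric]) (auto simp: ennreal_power)
    then show "(\<integral>\<^sup>+x. ennreal (cmod (h t)) * (k x t)\<^sup>2 \<partial>lborel) = ennreal (cmod (h t)) * ennreal (pi / \<bar>\<eta>\<bar>)"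
      by (subst nn_integral_cmult) (auto simp: kernel_L2(2)[OF \<eta>])
  qed
  also have "\<dots> = H * ennreal (pi / \<bar>\<eta>\<bar>)"
    unfolding H_def by (rule nn_integral_multc) measurable
  also have "H * (H * ennreal (pi / \<bar>\<eta>\<bar>)) < \<infinity>"
    using H by (simp add: ennreal_mult_less_top)
  finally show ?thesis
    by (simp add: L2_def integrable_iff_bounded)
qed

text \<open>This transfers contour integration from the transforms to the kernels: \<open>r\<close>
  ends up in the innermost integral, next to two explicit rational factors. It is
  \<open>cauchy_pairing\<close> twice, with \<open>r * cauchy k\<close> and then \<open>r\<close>
  times the first kernel as the square integrable factor.\<close>

lemma cauchy_double_pairing:
  assumes h: "integrable lborel h" and k: "integrable lborel k" and \<eta>: "\<eta> \<noteq> 0" and \<epsilon>: "\<epsilon> \<noteq> 0"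
    and r: "r \<in> borel_measurable borel" and B: "\<And>x. cmod (r x) \<le> B"
  shows "(LINT x|lborel. r x * cauchy h (Complex x \<eta>) * cauchy k (Complex x \<epsilon>)) =
    (LINT s|lborel. h s * (LINT t|lborel. k t *
        (LINT x|lborel. r x / ((of_real s - Complex x \<eta>) * (of_real t - Complex x \<epsilon>)))))"
proof -
  have "(LINT x|lborel. r x * cauchy h (Complex x \<eta>) * cauchy k (Complex x \<epsilon>)) =
     (LINT x|lborel. (r x * cauchy k (Complex x \<epsilon>)) * cauchy h (Complex x \<eta>))"
    by (simp add: mult_ac)
  also have "\<dots> = (LINT s|lborel. h s * (LINT x|lborel. (r x * cauchy k (Complex x \<epsilon>)) / (of_real s - Complex x \<eta>)))"
    by (intro cauchy_pairing L2_mult_bounded[OF _ r B] cauchy_L2 assms)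
  also have "\<dots> = (LINT s|lborel. h s * (LINT x|lborel. (r x * (1 / (of_real s - Complex x \<eta>))) * cauchy k (Complex x \<epsilon>)))"
    by (simp add: mult_ac)
  also have "\<dots> = (LINT s|lborel. h s * (LINT t|lborel. k t *
        (LINT x|lborel. (r x * (1 / (of_real s - Complex x \<eta>))) / (of_real t - Complex x \<epsilon>))))"
    by (subst cauchy_pairing[OF L2_mult_bounded[OF kernel_L2(1)[OF \<eta>] r B] k \<epsilon>]) simp
  finally show ?thesis by simp
qed

section \<open>Boundary values in \<open>L\<^sup>2\<close>\<close>

text \<open>Meaningful only together with membership in \<open>L2\<close>, since the integral of a
  function that is not integrable is 0.\<close>

definition normsq :: "(real \<Rightarrow> complex) \<Rightarrow> real" where
  "normsq f = (LINT x|lborel. (cmod (f x))\<^sup>2)"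

lemma normsq_nonneg: "normsq f \<ge> 0"
  by (simp add: normsq_def)

lemma nn_integral_normsq:
  assumes "f \<in> L2"
  shows "(\<integral>\<^sup>+x. ennreal ((cmod (f x))\<^sup>2) \<partial>lborel) = ennreal (normsq f)"
  unfolding normsq_def using L2_integrable[OF assms] by (intro nn_integral_eq_integral) auto

lemma L2_normsq_leI:
  assumes f: "f \<in> borel_measurable borel" and B: "B \<ge> 0"
    and le: "(\<integral>\<^sup>+x. ennreal ((cmod (f x))\<^sup>2) \<partial>lborel) \<le> ennreal B"
  shows "f \<in> L2" "normsq f \<le> B"
proof -
  show L2: "f \<in> L2"
    using f le_less_trans[OF le] by (simp add: L2_def integrable_iff_bounded)
  show "normsq f \<le> B"
    using le B by (simp add: nn_integral_normsq[OF L2])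
qed

lemma of_real_normsq:
  assumes "f \<in> L2"
  shows "complex_of_real (normsq f) = (LINT x|lborel. f x * cnj (f x))"
  by (simp only: normsq_def complex_norm_square flip: integral_complex_of_real)

lemma normsq_diff:
  assumes f: "f \<in> L2" and g: "g \<in> L2"
  shows "complex_of_real (normsq (\<lambda>x. f x - g x)) =
    (LINT x|lborel. f x * cnj (f x)) - (LINT x|lborel. f x * cnj (g x))
     - (LINT x|lborel. g x * cnj (f x)) + (LINT x|lborel. g x * cnj (g x))"
proof -
  note int = L2_mult_integrable[OF f L2_cnj[OF f]] L2_mult_integrable[OF f L2_cnj[OF g]]
    L2_mult_integrable[OF g L2_cnj[OF f]] L2_mult_integrable[OF g L2_cnj[OF g]]
  have "complex_of_real (normsq (\<lambda>x. f x - g x)) = (LINT x|lborel. f x * cnj (f x) - f x * cnj (g x)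
      - g x * cnj (f x) + g x * cnj (g x))"
    unfolding of_real_normsq[OF L2_diff[OF f g]] by (simp add: algebra_simps)
  then show ?thesis using int by simp
qed

text \<open>The Gram function of the family of transforms on horizontal lines. Conjugation moves the
  second transform to the opposite height, so the kernel is the residue value for two kernels on
  opposite sides, and \<sigma> is the sum of the heights.\<close>

definition cauchy_gram :: "(real \<Rightarrow> complex) \<Rightarrow> real \<Rightarrow> complex" where
  "cauchy_gram h \<sigma> = (LINT s|lborel. h s * (LINT t|lborel. cnj (h t) *
      (2 * of_real pi * \<i> / (of_real t - of_real s + \<i> * of_real \<sigma>))))"

lemma cnj_cauchy: "cnj (cauchy h (Complex x \<eta>)) = cauchy (\<lambda>t. cnj (h t)) (Complex x (- \<eta>))"
proof -
  have "cnj (Complex x \<eta>) = Complex x (- \<eta>)" by (simp add: complex_eq_iff)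
  then show ?thesis
    using cauchy_cnj[of "\<lambda>t. cnj (h t)" "Complex x \<eta>"] by (simp only: complex_cnj_cnj)
qed

lemma cauchy_inner_same_side:
  assumes h: "integrable lborel h" and "\<eta> > 0" "\<epsilon> > 0"
  shows "(LINT x|lborel. cauchy h (Complex x \<eta>) * cnj (cauchy h (Complex x \<epsilon>))) = cauchy_gram h (\<eta> + \<epsilon>)"
  using cauchy_double_pairing[of h "\<lambda>t. cnj (h t)" \<eta> "- \<epsilon>" "\<lambda>_. 1" 1] assms
  by (simp add: cnj_cauchy cauchy_gram_def integral_kernel_opposite_sides)

text \<open>Conjugation now brings both transforms to the same side, and neither kernel has a pole
  above the line. This is the orthogonality of the Hardy spaces of the two half-planes.\<close>

lemma cauchy_inner_opposite_sides:
  assumes h: "integrable lborel h" and "\<eta> > 0"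
  shows "(LINT x|lborel. cauchy h (Complex x \<eta>) * cnj (cauchy h (Complex x (- \<eta>)))) = 0"
    "(LINT x|lborel. cauchy h (Complex x (- \<eta>)) * cnj (cauchy h (Complex x \<eta>))) = 0"
proof -
  have 1: "(LINT x|lborel. 1 / ((of_real s - Complex x \<eta>) * (of_real t - Complex x \<eta>))) = 0" for s t
    using integral_kernel_same_side[of "\<lambda>_. 1" \<eta> \<eta> 0 1 s t] assms by simp
  show eq: "(LINT x|lborel. cauchy h (Complex x \<eta>) * cnj (cauchy h (Complex x (- \<eta>)))) = 0"
    using cauchy_double_pairing[of h "\<lambda>t. cnj (h t)" \<eta> \<eta> "\<lambda>_. 1" 1] assms 1
    by (simp add: cnj_cauchy)
  have "(LINT x|lborel. cauchy h (Complex x (- \<eta>)) * cnj (cauchy h (Complex x \<eta>))) =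
     (LINT x|lborel. cnj (cauchy h (Complex x \<eta>) * cnj (cauchy h (Complex x (- \<eta>)))))"
    by (simp add: mult.commute)
  also have "\<dots> = 0" unfolding Bochner_Integration.integral_cnj eq by simp
  finally show "(LINT x|lborel. cauchy h (Complex x (- \<eta>)) * cnj (cauchy h (Complex x \<eta>))) = 0" .
qed

text \<open>Not normalised: the usual Poisson integral carries the additional factor \<open>1 / pi\<close>.\<close>

definition poisson :: "(real \<Rightarrow> complex) \<Rightarrow> real \<Rightarrow> real \<Rightarrow> complex" where
  "poisson h \<eta> x = (LINT t|lborel. h t * of_real (\<eta> / ((t - x)\<^sup>2 + \<eta>\<^sup>2)))"

lemma kernel_jump:
  assumes "\<eta> > 0"
  shows "1 / (of_real t - Complex x \<eta>) - 1 / (of_real t - Complex x (- \<eta>)) =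
    2 * \<i> * of_real (\<eta> / ((t - x)\<^sup>2 + \<eta>\<^sup>2))"
proof -
  have nz: "of_real t - Complex x \<eta> \<noteq> 0" "of_real t - Complex x (- \<eta>) \<noteq> 0"
    using assms by (auto simp: complex_eq_iff)
  have "(of_real t - Complex x \<eta>) * (of_real t - Complex x (- \<eta>)) = of_real ((t - x)\<^sup>2 + \<eta>\<^sup>2)"
    by (simp add: complex_eq_iff power2_eq_square algebra_simps)
  moreover have "1 / (of_real t - Complex x \<eta>) - 1 / (of_real t - Complex x (- \<eta>)) =
     (Complex x \<eta> - Complex x (- \<eta>)) / ((of_real t - Complex x \<eta>) * (of_real t - Complex x (- \<eta>)))"
    using nz by (simp add: diff_frac_eq)
  moreover have "Complex x \<eta> - Complex x (- \<eta>) = 2 * \<i> * of_real \<eta>"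
    by (simp add: complex_eq_iff)
  ultimately show ?thesis by simp
qed

lemma cauchy_jump:
  assumes h: "integrable lborel h" and \<eta>: "\<eta> > 0"
  shows "cauchy h (Complex x \<eta>) - cauchy h (Complex x (- \<eta>)) = 2 * \<i> * poisson h \<eta> x"
proof -
  have "cauchy h (Complex x \<eta>) - cauchy h (Complex x (- \<eta>)) =
    (LINT t|lborel. h t / (of_real t - Complex x \<eta>) - h t / (of_real t - Complex x (- \<eta>)))"
    unfolding cauchy_def
    using cauchy_integrable[OF h, of "Complex x \<eta>"] cauchy_integrable[OF h, of "Complex x (-\<eta>)"] \<eta>
    by (intro Bochner_Integration.integral_diff[symmetric]) auto
  also have "\<dots> = (LINT t|lborel. 2 * \<i> * (h t * of_real (\<eta> / ((t - x)\<^sup>2 + \<eta>\<^sup>2))))"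
  proof (intro Bochner_Integration.integral_cong refl)
    fix t
    have "h t / (of_real t - Complex x \<eta>) - h t / (of_real t - Complex x (- \<eta>)) =
      h t * (1 / (of_real t - Complex x \<eta>) - 1 / (of_real t - Complex x (- \<eta>)))"
      by (simp add: right_diff_distrib)
    then show "h t / (of_real t - Complex x \<eta>) - h t / (of_real t - Complex x (- \<eta>)) =
      2 * \<i> * (h t * of_real (\<eta> / ((t - x)\<^sup>2 + \<eta>\<^sup>2)))"
      unfolding kernel_jump[OF \<eta>] by (simp add: mult_ac)
  qed
  also have "\<dots> = 2 * \<i> * poisson h \<eta> x"
    unfolding poisson_def by (rule integral_mult_right_zero)
  finally show ?thesis .
qed

lemma nn_integral_poisson_kernel:
  assumes "\<eta> > 0"
  shows "(\<integral>\<^sup>+t. ennreal (\<eta> / ((t - x)\<^sup>2 + \<eta>\<^sup>2)) \<partial>lborel) = ennreal pi"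
proof -
  have nn: "\<eta> / ((t - x)\<^sup>2 + \<eta>\<^sup>2) \<ge> 0" for t using assms by simp
  show ?thesis
    using has_bochner_integral_poisson_kernel[OF assms, of x] nn
    by (subst nn_integral_eq_integral) (auto simp: has_bochner_integral_iff)
qed

text \<open>Cauchy-Schwarz with the kernel split into two square roots. The integral of the kernel
  is \<pi> in either variable, and each of the two contributes one factor \<pi>.\<close>

lemma poisson_normsq_le:
  assumes h: "h \<in> L2" and \<eta>: "\<eta> > 0"
  shows "poisson h \<eta> \<in> L2" "normsq (poisson h \<eta>) \<le> pi\<^sup>2 * normsq h"
proof -
  have [measurable]: "h \<in> borel_measurable borel" using h by (rule L2_measurable)
  define k where "k = (\<lambda>x t. \<eta> / ((t - x)\<^sup>2 + \<eta>\<^sup>2))"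
  have k0: "k x t \<ge> 0" for x t using \<eta> by (simp add: k_def)
  have [measurable]: "(\<lambda>(x, t). k x t) \<in> borel_measurable (lborel \<Otimes>\<^sub>M lborel)"
    unfolding k_def by measurable
  have [measurable]: "(\<lambda>t. k x t) \<in> borel_measurable borel" for x
    unfolding k_def by measurable
  have [measurable]: "(\<lambda>x. k x t) \<in> borel_measurable borel" for t
    unfolding k_def by measurable
  have intk: "(\<integral>\<^sup>+t. ennreal (k x t) \<partial>lborel) = ennreal pi" "(\<integral>\<^sup>+x. ennreal (k x t) \<partial>lborel) = ennreal pi" for x t
    using nn_integral_poisson_kernel[OF \<eta>, of x] nn_integral_poisson_kernel[OF \<eta>, of t]
    by (simp_all add: k_def power2_commute)
  have meas: "poisson h \<eta> \<in> borel_measurable borel"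
    unfolding poisson_def by measurable
  have pt: "ennreal ((cmod (poisson h \<eta> x))\<^sup>2) \<le> (\<integral>\<^sup>+t. ennreal ((cmod (h t))\<^sup>2) * ennreal (k x t) \<partial>lborel) * ennreal pi" for x
  proof -
    have "ennreal (cmod (poisson h \<eta> x)) \<le> (\<integral>\<^sup>+t. ennreal (cmod (h t * of_real (k x t))) \<partial>lborel)"
    proof (cases "integrable lborel (\<lambda>t. h t * of_real (k x t))")
      case True
      then show ?thesis unfolding poisson_def k_def by (rule integral_norm_bound_ennreal)
    next
      case False
      then show ?thesis unfolding poisson_def k_def by (simp add: not_integrable_integral_eq)
    qed
    also have "\<dots> = (\<integral>\<^sup>+t. (ennreal (cmod (h t)) * ennreal (sqrt (k x t))) * ennreal (sqrt (k x t)) \<partial>lborel)"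
      using k0 by (intro nn_integral_cong) (simp add: norm_mult ennreal_mult[symmetric] mult.assoc)
    finally have "(ennreal (cmod (poisson h \<eta> x)))\<^sup>2 \<le>
       (\<integral>\<^sup>+t. (ennreal (cmod (h t)) * ennreal (sqrt (k x t))) * ennreal (sqrt (k x t)) \<partial>lborel)\<^sup>2"
      by (intro power_mono) auto
    also have "\<dots> \<le> (\<integral>\<^sup>+t. (ennreal (cmod (h t)) * ennreal (sqrt (k x t)))\<^sup>2 \<partial>lborel) *
        (\<integral>\<^sup>+t. (ennreal (sqrt (k x t)))\<^sup>2 \<partial>lborel)"
      by (rule Cauchy_Schwarz_nn_integral) measurable
    also have "\<dots> = (\<integral>\<^sup>+t. ennreal ((cmod (h t))\<^sup>2) * ennreal (k x t) \<partial>lborel) * ennreal pi"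
      using k0 by (simp add: power_mult_distrib ennreal_power intk)
    finally show ?thesis by (simp add: ennreal_power)
  qed
  have "(\<integral>\<^sup>+x. ennreal ((cmod (poisson h \<eta> x))\<^sup>2) \<partial>lborel) \<le>
      (\<integral>\<^sup>+x. (\<integral>\<^sup>+t. ennreal ((cmod (h t))\<^sup>2) * ennreal (k x t) \<partial>lborel) * ennreal pi \<partial>lborel)"
    by (intro nn_integral_mono pt)
  also have "\<dots> = (\<integral>\<^sup>+x. \<integral>\<^sup>+t. ennreal ((cmod (h t))\<^sup>2) * ennreal (k x t) \<partial>lborel \<partial>lborel) * ennreal pi"
    by (rule nn_integral_multc) measurable
  also have "(\<integral>\<^sup>+x. \<integral>\<^sup>+t. ennreal ((cmod (h t))\<^sup>2) * ennreal (k x t) \<partial>lborel \<partial>lborel) =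
      (\<integral>\<^sup>+t. \<integral>\<^sup>+x. ennreal ((cmod (h t))\<^sup>2) * ennreal (k x t) \<partial>lborel \<partial>lborel)"
    by (rule lborel_pair.Fubini') measurable
  also have "\<dots> = (\<integral>\<^sup>+t. ennreal ((cmod (h t))\<^sup>2) * ennreal pi \<partial>lborel)"
    by (intro nn_integral_cong) (simp add: nn_integral_cmult intk)
  also have "\<dots> = ennreal (normsq h) * ennreal pi"
    by (subst nn_integral_multc) (simp_all add: nn_integral_normsq[OF h])
  also have "\<dots> * ennreal pi = ennreal (pi\<^sup>2 * normsq h)"
    using normsq_nonneg[of h] by (simp add: ennreal_mult[symmetric] power2_eq_square mult_ac)
  finally have *: "(\<integral>\<^sup>+x. ennreal ((cmod (poisson h \<eta> x))\<^sup>2) \<partial>lborel) \<le> ennreal (pi\<^sup>2 * normsq h)" .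
  show "poisson h \<eta> \<in> L2" "normsq (poisson h \<eta>) \<le> pi\<^sup>2 * normsq h"
    using L2_normsq_leI[OF meas _ *] normsq_nonneg[of h] by auto
qed

lemma normsq_scale: "normsq (\<lambda>x. c * f x) = (cmod c)\<^sup>2 * normsq f"
  by (simp add: normsq_def norm_mult power_mult_distrib)

text \<open>The transforms at heights \<open>\<eta>\<close> and \<open>- \<eta>\<close> are orthogonal, so each is bounded by their
  difference, which is a Poisson integral.\<close>

lemma cauchy_normsq_le:
  assumes h: "integrable lborel h" "h \<in> L2" and \<eta>: "\<eta> > 0"
  shows "normsq (\<lambda>x. cauchy h (Complex x \<eta>)) \<le> 4 * pi\<^sup>2 * normsq h"
proof -
  let ?f = "\<lambda>x. cauchy h (Complex x \<eta>)" and ?g = "\<lambda>x. cauchy h (Complex x (- \<eta>))"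
  have L2: "?f \<in> L2" "?g \<in> L2" using cauchy_L2[OF h(1)] \<eta> by auto
  have "complex_of_real (normsq (\<lambda>x. ?f x - ?g x)) = of_real (normsq ?f + normsq ?g)"
    using normsq_diff[OF L2] cauchy_inner_opposite_sides[OF h(1) \<eta>] of_real_normsq[OF L2(1)] of_real_normsq[OF L2(2)]
    by simp
  then have "normsq ?f \<le> normsq (\<lambda>x. ?f x - ?g x)"
    using normsq_nonneg[of ?g] unfolding of_real_eq_iff by linarith
  also have "\<dots> = 4 * normsq (poisson h \<eta>)"
    using normsq_scale[of "2 * \<i>" "poisson h \<eta>"] unfolding cauchy_jump[OF h(1) \<eta>] by (simp add: norm_mult)
  also have "\<dots> \<le> 4 * pi\<^sup>2 * normsq h"
    using poisson_normsq_le[OF h(2) \<eta>] by simp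
  finally show ?thesis .
qed

text \<open>A midpoint convex function that is bounded above on the half-line cannot increase: a
  gain \<open>d\<close> over a step \<open>c\<close> would recur in every further step of the same
  length and eventually exceed \<open>B\<close>. So \<open>p\<close> approaches its supremum at 0,
  and all three values in the second difference are close to that supremum there.\<close>

lemma midpoint_convex_bounded_near_zero:
  fixes p :: "real \<Rightarrow> real"
  assumes bd: "\<And>x. x > 0 \<Longrightarrow> p x \<le> B"
    and mid: "\<And>a b. a > 0 \<Longrightarrow> b > 0 \<Longrightarrow> 2 * p (a + b) \<le> p (2 * a) + p (2 * b)"
    and tol: "tol > 0"
  obtains \<delta> where "\<delta> > 0"
    "\<And>a b. 0 < a \<Longrightarrow> a < \<delta> \<Longrightarrow> 0 < b \<Longrightarrow> b < \<delta> \<Longrightarrow> p (2 * a) + p (2 * b) - 2 * p (a + b) \<le> tol"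
proof -
  have mid': "2 * p (u / 2 + v / 2) \<le> p u + p v" if "u > 0" "v > 0" for u v
    using mid[of "u / 2" "v / 2"] that by simp
  have anti: "p b \<le> p a" if "0 < a" "a < b" for a b
  proof (rule ccontr)
    assume "\<not> p b \<le> p a"
    define d where "d = p b - p a"
    define c where "c = b - a"
    have d: "d > 0" and c: "c > 0" using \<open>\<not> p b \<le> p a\<close> that by (auto simp: d_def c_def)
    have step: "p (a + real (Suc n) * c) - p (a + real n * c) \<ge> d" for n
    proof (induction n)
      case 0
      then show ?case by (simp add: d_def c_def)
    next
      case (Suc n)
      let ?x = "a + real n * c" and ?y = "a + real (Suc (Suc n)) * c"
      have "0 \<le> real n * c" "0 \<le> real (Suc (Suc n)) * c"
        using c by (simp_all only: mult_nonneg_nonneg of_nat_0_le_iff less_imp_le)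
      then have "?x > 0" "?y > 0" using that by linarith+
      then have "2 * p (?x / 2 + ?y / 2) \<le> p ?x + p ?y"
        by (rule mid')
      moreover have eq: "?x / 2 + ?y / 2 = a + real (Suc n) * c"
        by (simp add: field_simps)
      ultimately show ?case using Suc unfolding eq by linarith
    qed
    have lower: "p (a + real n * c) \<ge> p a + real n * d" for n
    proof (induction n)
      case (Suc n)
      then show ?case using step[of n] by (simp add: algebra_simps)
    qed simp
    obtain n where "B - p a < real n * d"
      using reals_Archimedean3[OF d] by blast
    then have "p (a + real n * c) > B" using lower[of n] by linarith
    moreover have "a + real n * c > 0" using that c by (auto intro: add_pos_nonneg)
    ultimately show False using bd by fastforce
  qed
  define S where "S = Sup (p ` {0<..})"
  have bdd: "bdd_above (p ` {0<..})" using bd by (auto simp: bdd_above_def)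
  have le_S: "p x \<le> S" if "x > 0" for x
    unfolding S_def using that by (intro cSup_upper bdd) auto
  \<comment> \<open>The tolerance is halved because the middle value \<open>p (a + b)\<close> counts
    twice, against two values that are at most \<open>S\<close>.\<close>
  have "\<exists>y\<in>p ` {0<..}. S - tol / 2 < y"
    using less_cSup_iff[OF _ bdd, of "S - tol / 2"] tol by (force simp: S_def)
  then obtain \<delta> where \<delta>: "\<delta> > 0" "S - tol / 2 < p \<delta>" by auto
  show thesis
  proof (rule that[of "\<delta> / 2"])
    show "p (2 * a) + p (2 * b) - 2 * p (a + b) \<le> tol"
      if "0 < a" "a < \<delta> / 2" "0 < b" "b < \<delta> / 2" for a b
      using anti[of "a + b" \<delta>] le_S[of "2 * a"] le_S[of "2 * b"] \<delta> that by simp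
  qed (use \<delta> in simp)
qed

text \<open>The inner product of the transforms at heights \<open>a\<close> and \<open>b\<close> depends only on \<open>a + b\<close>. Hence their
  squared distance is a second difference of \<open>cauchy_gram h\<close>, whose nonnegativity makes
  \<open>cauchy_gram h\<close> midpoint convex.\<close>

lemma cauchy_L2_Cauchy:
  assumes h: "integrable lborel h" "h \<in> L2" and tol: "tol > 0"
  obtains \<delta> where "\<delta> > 0"
    "\<And>a b. 0 < a \<Longrightarrow> a < \<delta> \<Longrightarrow> 0 < b \<Longrightarrow> b < \<delta> \<Longrightarrow>
       normsq (\<lambda>x. cauchy h (Complex x a) - cauchy h (Complex x b)) \<le> tol"
proof -
  define p where "p = (\<lambda>\<sigma>. Re (cauchy_gram h \<sigma>))"
  have diff: "normsq (\<lambda>x. cauchy h (Complex x a) - cauchy h (Complex x b)) = p (2 * a) + p (2 * b) - 2 * p (a + b)"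
    if "a > 0" "b > 0" for a b
  proof -
    have "complex_of_real (normsq (\<lambda>x. cauchy h (Complex x a) - cauchy h (Complex x b))) =
      cauchy_gram h (a + a) - cauchy_gram h (a + b) - cauchy_gram h (b + a) + cauchy_gram h (b + b)"
      using that by (subst normsq_diff) (auto intro!: cauchy_L2[OF h(1)] simp: cauchy_inner_same_side[OF h(1)])
    from arg_cong[OF this, of Re] show ?thesis by (simp add: p_def add.commute)
  qed
  have single: "normsq (\<lambda>x. cauchy h (Complex x a)) = p (2 * a)" if "a > 0" for a
  proof -
    have "complex_of_real (normsq (\<lambda>x. cauchy h (Complex x a))) = cauchy_gram h (a + a)"
      using that by (subst of_real_normsq) (auto intro!: cauchy_L2[OF h(1)] simp: cauchy_inner_same_side[OF h(1)])
    from arg_cong[OF this, of Re] show ?thesis by (simp add: p_def)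
  qed
  have bd: "p x \<le> 4 * pi\<^sup>2 * normsq h" if "x > 0" for x
    using single[of "x / 2"] cauchy_normsq_le[OF h, of "x / 2"] that by simp
  have mid: "2 * p (a + b) \<le> p (2 * a) + p (2 * b)" if "a > 0" "b > 0" for a b
    using diff[OF that] normsq_nonneg[of "\<lambda>x. cauchy h (Complex x a) - cauchy h (Complex x b)"] by linarith
  from midpoint_convex_bounded_near_zero[OF bd mid tol] obtain \<delta> where "\<delta> > 0"
    "\<And>a b. 0 < a \<Longrightarrow> a < \<delta> \<Longrightarrow> 0 < b \<Longrightarrow> b < \<delta> \<Longrightarrow> p (2 * a) + p (2 * b) - 2 * p (a + b) \<le> tol"
    by blast
  then show thesis using diff by (intro that[of \<delta>]) auto
qed

text \<open>The squared norms decay like \<open>4 ^ -n\<close>, so the squared differences weighted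
  with \<open>2 ^ n\<close> still have a summable series of integrals. Where the series is finite,
  with sum \<open>M\<close>, the difference is at most \<open>sqrt (M / 2 ^ n)\<close>, and the
  telescoping series converges absolutely.\<close>

lemma L2_fast_Cauchy_converges:
  assumes u: "\<And>n. u n \<in> L2"
    and fast: "\<And>n. normsq (\<lambda>x. u (Suc n) x - u n x) \<le> (1/4) ^ n"
  shows "AE x in lborel. convergent (\<lambda>n. u n x)"
proof -
  define d where "d = (\<lambda>n x. cmod (u (Suc n) x - u n x))"
  have meas[measurable]: "u n \<in> borel_measurable borel" for n using u by (rule L2_measurable)
  have "(\<integral>\<^sup>+x. (\<Sum>n. ennreal (2 ^ n * (d n x)\<^sup>2)) \<partial>lborel) = (\<Sum>n. \<integral>\<^sup>+x. ennreal (2 ^ n * (d n x)\<^sup>2) \<partial>lborel)"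
    unfolding d_def by (rule nn_integral_suminf) measurable
  also have "\<dots> \<le> (\<Sum>n. ennreal ((1/2) ^ n))"
  proof (intro suminf_le allI)
    fix n
    have "(\<integral>\<^sup>+x. ennreal (2 ^ n * (d n x)\<^sup>2) \<partial>lborel) = ennreal (2 ^ n) * ennreal (normsq (\<lambda>x. u (Suc n) x - u n x))"
      unfolding nn_integral_normsq[OF L2_diff[OF u u], symmetric] d_def
      by (subst nn_integral_cmult[symmetric]) (auto simp: ennreal_mult)
    also have "\<dots> \<le> ennreal (2 ^ n) * ennreal ((1/4) ^ n)"
      using fast[of n] by (intro mult_left_mono ennreal_leI) auto
    also have "\<dots> = ennreal ((1/2) ^ n)"
      by (subst ennreal_mult[symmetric]) (auto simp flip: power_mult_distrib)
    finally show "(\<integral>\<^sup>+x. ennreal (2 ^ n * (d n x)\<^sup>2) \<partial>lborel) \<le> ennreal ((1/2) ^ n)" .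
  qed auto
  also have "\<dots> = ennreal (\<Sum>n. (1/2) ^ n)"
    by (rule suminf_ennreal2) auto
  finally have "(\<integral>\<^sup>+x. (\<Sum>n. ennreal (2 ^ n * (d n x)\<^sup>2)) \<partial>lborel) \<noteq> \<infinity>"
    using le_less_trans[of _ _ \<infinity>] by fastforce
  then have "AE x in lborel. (\<Sum>n. ennreal (2 ^ n * (d n x)\<^sup>2)) \<noteq> \<infinity>"
    unfolding d_def by (intro nn_integral_PInf_AE) measurable
  then show ?thesis
  proof eventually_elim
    case (elim x)
    define M where "M = enn2real (\<Sum>n. ennreal (2 ^ n * (d n x)\<^sup>2))"
    have "(\<Sum>n. ennreal (2 ^ n * (d n x)\<^sup>2)) < top"
      using elim unfolding infinity_ennreal_def less_top .
    then have M2: "(\<Sum>n. ennreal (2 ^ n * (d n x)\<^sup>2)) = ennreal M"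
      unfolding M_def by (rule ennreal_enn2real[symmetric])
    have "M \<ge> 0" unfolding M_def by (rule enn2real_nonneg)
    note M = this M2
    have le: "d n x \<le> sqrt M * (sqrt (1/2)) ^ n" for n
    proof -
      have "ennreal (2 ^ n * (d n x)\<^sup>2) \<le> ennreal M"
        unfolding M(2)[symmetric] by (rule sum_le_suminf[of _ "{n}", simplified]) auto
      then have "2 ^ n * (d n x)\<^sup>2 \<le> M" using M by simp
      then have "(d n x)\<^sup>2 \<le> M * (1/2) ^ n"
        by (simp add: power_one_over field_simps)
      then have "d n x \<le> sqrt (M * (1/2) ^ n)" by (rule real_le_rsqrt)
      then show ?thesis by (simp add: real_sqrt_mult real_sqrt_power)
    qed
    have "summable (\<lambda>n. sqrt M * (sqrt (1/2)) ^ n)"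
      by (intro summable_mult summable_geometric) (simp add: real_sqrt_less_iff)
    then have "summable (\<lambda>n. u (Suc n) x - u n x)"
      by (rule summable_comparison_test'[where N = 0]) (rule le[unfolded d_def])
    then have "convergent (\<lambda>n. \<Sum>i<n. u (Suc i) x - u i x)"
      by (simp add: summable_iff_convergent)
    then have "convergent (\<lambda>n. u n x - u 0 x)"
      by (simp add: sum_lessThan_telescope[of "\<lambda>n. u n x"])
    then show "convergent (\<lambda>n. u n x)"
      by (simp add: convergent_diff_const_right_iff)
  qed
qed

text \<open>The limit function is the almost everywhere limit along a fast sequence of heights.
  Fatou's lemma then carries the Cauchy estimate from that sequence to the distance between the
  limit and the transform at an arbitrary small height, which gives convergence along the full
  filter.\<close>

theorem cauchy_boundary_value_L2:
  assumes h: "integrable lborel h" "h \<in> L2"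
  obtains F where "F \<in> L2"
    "((\<lambda>\<eta>. normsq (\<lambda>x. cauchy h (Complex x \<eta>) - F x)) \<longlongrightarrow> 0) (at_right 0)"
proof -
  define good where "good = (\<lambda>\<delta> tol. \<delta> > 0 \<and> (\<forall>a b. 0 < a \<longrightarrow> a < \<delta> \<longrightarrow> 0 < b \<longrightarrow> b < \<delta> \<longrightarrow>
       normsq (\<lambda>x. cauchy h (Complex x a) - cauchy h (Complex x b)) \<le> tol))"
  have "\<exists>\<delta>. good \<delta> tol" if "tol > 0" for tol
    using cauchy_L2_Cauchy[OF h that] unfolding good_def by metis
  then have "\<exists>\<delta>. good \<delta> ((1/4) ^ n)" for n :: nat by simp
  then obtain D where D: "\<And>n. good (D n) ((1/4) ^ n)" by metis
  \<comment> \<open>The minimum over all thresholds up to \<open>n\<close> makes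
    \<open>a n < D m\<close> for every \<open>m \<le> n\<close>, so the estimate for tolerance
    \<open>(1/4) ^ m\<close> applies to the whole tail.\<close>
  define a where "a = (\<lambda>n. Min (D ` {..n}) / 2)"
  have a: "0 < a n" "m \<le> n \<Longrightarrow> a n < D m" for n m
  proof -
    have pos: "Min (D ` {..n}) > 0" using D by (auto simp: good_def)
    then show "0 < a n" by (simp add: a_def)
    assume "m \<le> n"
    then have "Min (D ` {..n}) \<le> D m" by (intro Min_le) auto
    then show "a n < D m" using pos unfolding a_def by linarith
  qed
  define u where "u = (\<lambda>n x. cauchy h (Complex x (a n)))"
  have u: "u n \<in> L2" for n
    unfolding u_def using a(1)[of n] by (intro cauchy_L2 h) auto
  have [measurable]: "u n \<in> borel_measurable borel" for n using u by (rule L2_measurable)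
  have fast: "normsq (\<lambda>x. u (Suc n) x - u n x) \<le> (1/4) ^ n" for n
    unfolding u_def using D[of n] a(2)[of n "Suc n"] a(2)[of n n] a(1)[of n] a(1)[of "Suc n"] by (auto simp: good_def)
  define F where "F = (\<lambda>x. lim (\<lambda>n. u n x))"
  have [measurable]: "F \<in> borel_measurable borel"
    unfolding F_def by measurable
  have conv: "AE x in lborel. (\<lambda>n. u n x) \<longlonglongrightarrow> F x"
    using L2_fast_Cauchy_converges[OF u fast] by eventually_elim (simp add: F_def convergent_LIMSEQ_iff)
  have est: "normsq (\<lambda>x. cauchy h (Complex x \<eta>) - F x) \<le> (1/4) ^ m \<and> (\<lambda>x. cauchy h (Complex x \<eta>) - F x) \<in> L2"
    if \<eta>: "0 < \<eta>" "\<eta> < D m" for \<eta> m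
  proof -
    let ?v = "\<lambda>x. cauchy h (Complex x \<eta>)"
    have v: "?v \<in> L2" using \<eta> by (intro cauchy_L2 h) auto
    have [measurable]: "?v \<in> borel_measurable borel" using v by (rule L2_measurable)
    have "(\<integral>\<^sup>+x. ennreal ((cmod (?v x - F x))\<^sup>2) \<partial>lborel) = (\<integral>\<^sup>+x. liminf (\<lambda>n. ennreal ((cmod (?v x - u n x))\<^sup>2)) \<partial>lborel)"
    proof (rule nn_integral_cong_AE)
      show "AE x in lborel. ennreal ((cmod (?v x - F x))\<^sup>2) = liminf (\<lambda>n. ennreal ((cmod (?v x - u n x))\<^sup>2))"
        using conv
      proof eventually_elim
        case (elim x)
        then have "(\<lambda>n. ennreal ((cmod (?v x - u n x))\<^sup>2)) \<longlonglongrightarrow> ennreal ((cmod (?v x - F x))\<^sup>2)"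
          by (intro tendsto_ennrealI tendsto_intros)
        then show ?case by (rule lim_imp_Liminf[OF trivial_limit_sequentially, symmetric])
      qed
    qed
    also have "\<dots> \<le> liminf (\<lambda>n. \<integral>\<^sup>+x. ennreal ((cmod (?v x - u n x))\<^sup>2) \<partial>lborel)"
      by (rule nn_integral_liminf) measurable
    also have "\<dots> \<le> ennreal ((1/4) ^ m)"
    proof (rule Liminf_le)
      show "\<forall>\<^sub>F n in sequentially. (\<integral>\<^sup>+x. ennreal ((cmod (?v x - u n x))\<^sup>2) \<partial>lborel) \<le> ennreal ((1/4) ^ m)"
        using eventually_ge_at_top[of m]
      proof eventually_elim
        case (elim n)
        have "normsq (\<lambda>x. ?v x - u n x) \<le> (1/4) ^ m"
          unfolding u_def using D[of m] a(1)[of n] a(2)[of m n] elim \<eta> by (auto simp: good_def)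
        then show ?case by (simp add: nn_integral_normsq[OF L2_diff[OF v u]])
      qed
    qed simp
    finally show ?thesis using L2_normsq_leI[of "\<lambda>x. ?v x - F x" "(1/4)^m"] by simp
  qed
  have "F \<in> L2"
  proof -
    have "0 < D 0 / 2" "D 0 / 2 < D 0" using D[of 0] by (auto simp: good_def)
    with est have 1: "(\<lambda>x. cauchy h (Complex x (D 0 / 2)) - F x) \<in> L2" by blast
    have "(\<lambda>x. cauchy h (Complex x (D 0 / 2))) \<in> L2"
      using \<open>0 < D 0 / 2\<close> by (intro cauchy_L2 h) auto
    from L2_diff[OF this 1] show ?thesis by simp
  qed
  moreover have "((\<lambda>\<eta>. normsq (\<lambda>x. cauchy h (Complex x \<eta>) - F x)) \<longlongrightarrow> 0) (at_right 0)"
  proof (rule tendstoI)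
    fix e :: real assume "e > 0"
    then obtain m where m: "(1/4::real) ^ m < e"
      using real_arch_pow_inv[of e "1/4"] by auto
    have "\<forall>\<^sub>F \<eta> in at_right 0. 0 < \<eta> \<and> \<eta> < D m"
      using D[of m] by (intro eventually_between_at_right) (simp add: good_def)
    then show "\<forall>\<^sub>F \<eta> in at_right 0. dist (normsq (\<lambda>x. cauchy h (Complex x \<eta>) - F x)) 0 < e"
    proof eventually_elim
      case (elim \<eta>)
      then show ?case using est[of \<eta> m] m normsq_nonneg[of "\<lambda>x. cauchy h (Complex x \<eta>) - F x"]
        by (simp add: dist_real_def)
    qed
  qed
  ultimately show thesis by (rule that)
qed

section \<open>Boundary values almost everywhere\<close>

lemma L2_Cauchy_Schwarz:
  assumes f: "f \<in> L2" and g: "g \<in> L2"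
  shows "cmod (LINT x|lborel. f x * g x) \<le> sqrt (normsq f) * sqrt (normsq g)"
proof -
  have [measurable]: "f \<in> borel_measurable borel" "g \<in> borel_measurable borel"
    using f g by (auto intro: L2_measurable)
  have "ennreal (cmod (LINT x|lborel. f x * g x)) \<le> (\<integral>\<^sup>+x. ennreal (cmod (f x * g x)) \<partial>lborel)"
    by (rule integral_norm_bound_ennreal[OF L2_mult_integrable[OF f g]])
  also have "\<dots> = (\<integral>\<^sup>+x. ennreal (cmod (f x)) * ennreal (cmod (g x)) \<partial>lborel)"
    by (simp add: norm_mult ennreal_mult)
  finally have "(ennreal (cmod (LINT x|lborel. f x * g x)))\<^sup>2 \<le>
      (\<integral>\<^sup>+x. ennreal (cmod (f x)) * ennreal (cmod (g x)) \<partial>lborel)\<^sup>2"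
    by (intro power_mono) auto
  also have "\<dots> \<le> (\<integral>\<^sup>+x. (ennreal (cmod (f x)))\<^sup>2 \<partial>lborel) * (\<integral>\<^sup>+x. (ennreal (cmod (g x)))\<^sup>2 \<partial>lborel)"
    by (rule Cauchy_Schwarz_nn_integral) measurable
  also have "\<dots> = ennreal (normsq f * normsq g)"
    using normsq_nonneg by (simp add: ennreal_power nn_integral_normsq[OF f] nn_integral_normsq[OF g] ennreal_mult)
  finally have "(cmod (LINT x|lborel. f x * g x))\<^sup>2 \<le> normsq f * normsq g"
    using normsq_nonneg[of f] normsq_nonneg[of g] by (simp add: ennreal_power)
  then show ?thesis
    by (simp add: real_le_rsqrt flip: real_sqrt_mult)
qed

lemma L2_tendsto_pairing:
  assumes lim: "((\<lambda>\<eta>. normsq (\<lambda>x. u \<eta> x - f x)) \<longlongrightarrow> 0) A"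
    and u: "\<forall>\<^sub>F \<eta> in A. u \<eta> \<in> L2" and f: "f \<in> L2" and g: "g \<in> L2"
  shows "((\<lambda>\<eta>. LINT x|lborel. u \<eta> x * g x) \<longlongrightarrow> (LINT x|lborel. f x * g x)) A"
proof -
  have "((\<lambda>\<eta>. (LINT x|lborel. u \<eta> x * g x) - (LINT x|lborel. f x * g x)) \<longlongrightarrow> 0) A"
  proof (rule Lim_null_comparison)
    show "\<forall>\<^sub>F \<eta> in A. norm ((LINT x|lborel. u \<eta> x * g x) - (LINT x|lborel. f x * g x)) \<le>
        sqrt (normsq (\<lambda>x. u \<eta> x - f x)) * sqrt (normsq g)"
      using u
    proof eventually_elim
      case (elim \<eta>)
      have "(LINT x|lborel. u \<eta> x * g x) - (LINT x|lborel. f x * g x) = (LINT x|lborel. (u \<eta> x - f x) * g x)"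
        using elim f g by (simp add: left_diff_distrib L2_mult_integrable)
      then show ?case using L2_Cauchy_Schwarz[OF L2_diff[OF elim f] g] by simp
    qed
    have "((\<lambda>\<eta>. sqrt (normsq (\<lambda>x. u \<eta> x - f x)) * sqrt (normsq g)) \<longlongrightarrow> sqrt 0 * sqrt (normsq g)) A"
      by (intro tendsto_intros lim)
    then show "((\<lambda>\<eta>. sqrt (normsq (\<lambda>x. u \<eta> x - f x)) * sqrt (normsq g)) \<longlongrightarrow> 0) A" by simp
  qed
  then show ?thesis by (simp add: LIM_zero_iff)
qed

lemma cauchy_has_field_derivative:
  assumes h: "integrable lborel h" and z: "Im z \<noteq> 0"
  shows "(cauchy h has_field_derivative (LINT t|lborel. h t / (of_real t - z)\<^sup>2)) (at z)"
proof -
  define c where "c = \<bar>Im z\<bar>"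
  have c: "c > 0" using z by (simp add: c_def)
  \<comment> \<open>Within half the distance of \<open>z\<close> to the real line the two kernels
    are bounded by \<open>2 / c\<close> and \<open>1 / c\<close>, uniformly in \<open>t\<close>; the
    product of these bounds dominates the difference quotients.\<close>
  define S where "S = ball z (c / 2)"
  have Im: "\<bar>Im y\<bar> \<ge> c / 2" if "y \<in> S" for y
    using that abs_Im_le_cmod[of "z - y"] by (simp add: S_def dist_norm c_def abs_if split: if_splits)
  have [measurable]: "h \<in> borel_measurable borel" using h by auto
  have "((\<lambda>y. (cauchy h y - cauchy h z) / (y - z)) \<longlongrightarrow> (LINT t|lborel. h t / (of_real t - z)\<^sup>2)) (at z within S)"
    unfolding tendsto_at_iff_sequentially o_def
  proof (intro allI impI)
    fix X assume X: "\<forall>i. X i \<in> S - {z}" and lim: "X \<longlonglongrightarrow> z"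
    have eq: "(cauchy h (X i) - cauchy h z) / (X i - z) = (LINT t|lborel. h t / ((of_real t - X i) * (of_real t - z)))" for i
    proof -
      have ImX: "Im (X i) \<noteq> 0" using Im[of "X i"] X c by auto
      have "cauchy h (X i) - cauchy h z = (LINT t|lborel. h t / (of_real t - X i) - h t / (of_real t - z))"
        unfolding cauchy_def using cauchy_integrable[OF h ImX] cauchy_integrable[OF h z] by simp
      also have "\<dots> = (LINT t|lborel. (X i - z) * (h t / ((of_real t - X i) * (of_real t - z))))"
      proof (intro Bochner_Integration.integral_cong refl)
        fix t
        show "h t / (of_real t - X i) - h t / (of_real t - z) = (X i - z) * (h t / ((of_real t - X i) * (of_real t - z)))"
          using kernel_nonzero[OF ImX, of t] kernel_nonzero[OF z, of t] by (simp add: field_simps)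
      qed
      also have "\<dots> = (X i - z) * (LINT t|lborel. h t / ((of_real t - X i) * (of_real t - z)))"
        by (rule integral_mult_right_zero)
      finally show ?thesis using X by simp
    qed
    have "(\<lambda>i. LINT t|lborel. h t / ((of_real t - X i) * (of_real t - z))) \<longlonglongrightarrow> (LINT t|lborel. h t / (of_real t - z)\<^sup>2)"
    proof (rule integral_dominated_convergence[where w = "\<lambda>t. cmod (h t) * (2 / c\<^sup>2)"])
      show "AE t in lborel. (\<lambda>i. h t / ((of_real t - X i) * (of_real t - z))) \<longlonglongrightarrow> h t / (of_real t - z)\<^sup>2"
        using kernel_nonzero[OF z] unfolding power2_eq_square
        by (intro always_eventually allI tendsto_intros lim) auto
      show "AE t in lborel. norm (h t / ((of_real t - X i) * (of_real t - z))) \<le> cmod (h t) * (2 / c\<^sup>2)" for i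
      proof (intro always_eventually allI)
        fix t
        have "c / 2 * c \<le> cmod (of_real t - X i) * cmod (of_real t - z)"
          using Im[of "X i"] X cmod_kernel_ge[of "X i" t] cmod_kernel_ge[of z t] c
          by (intro mult_mono) (auto simp: c_def)
        then have "cmod (h t) / (cmod (of_real t - X i) * cmod (of_real t - z)) \<le> cmod (h t) / (c / 2 * c)"
          using c by (intro divide_left_mono mult_pos_pos order_less_le_trans[OF _ \<open>c / 2 * c \<le> _\<close>]) auto
        then show "norm (h t / ((of_real t - X i) * (of_real t - z))) \<le> cmod (h t) * (2 / c\<^sup>2)"
          by (simp add: norm_divide norm_mult power2_eq_square)
      qed
    qed (use h in simp_all)
    then show "(\<lambda>i. (cauchy h (X i) - cauchy h z) / (X i - z)) \<longlonglongrightarrow> (LINT t|lborel. h t / (of_real t - z)\<^sup>2)"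
      by (simp add: eq)
  qed
  moreover have "at z within S = at z"
    using c by (intro at_within_open) (auto simp: S_def)
  ultimately show ?thesis by (simp add: has_field_derivative_iff)
qed

lemma cauchy_holomorphic:
  assumes "integrable lborel h"
  shows "cauchy h holomorphic_on {z. Im z \<noteq> 0}"
proof -
  have "open {z. Im z \<noteq> 0}" by (intro open_Collect_neq continuous_intros)
  then show ?thesis
    using cauchy_has_field_derivative[OF assms] by (auto simp: holomorphic_on_open)
qed

lemma cauchy_isCont:
  assumes "integrable lborel h" "Im z \<noteq> 0"
  shows "isCont (cauchy h) z"
  using cauchy_has_field_derivative[OF assms] by (rule DERIV_isCont)

lemma poisson_kernel_L2:
  assumes "\<eta> > 0"
  shows "(\<lambda>t. complex_of_real (\<eta> / ((t - x)\<^sup>2 + \<eta>\<^sup>2))) \<in> L2"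
proof -
  have "(\<lambda>t. 1 / (2 * \<i>) * (1 / (of_real x - Complex t \<eta>) - 1 / (of_real x - Complex t (- \<eta>)))) \<in> L2"
    using assms by (intro L2_scale L2_diff kernel_L2) auto
  then show ?thesis
    unfolding kernel_jump[OF assms] by (simp add: power2_commute)
qed

text \<open>The semigroup property of the Poisson kernel. The kernel is a difference of two Cauchy
  kernels from opposite sides of the line; paired with the transform, only the one on the opposite
  side leaves a residue. The factor \<pi> is due to the missing normalisation.\<close>

lemma poisson_cauchy:
  assumes h: "integrable lborel h" and \<eta>: "\<eta> > 0" and \<epsilon>: "\<epsilon> > 0"
  shows "poisson (\<lambda>x. cauchy h (Complex x \<epsilon>)) \<eta> x = of_real pi * cauchy h (Complex x (\<eta> + \<epsilon>))"
proof -
  define K where "K = (\<lambda>t. complex_of_real (\<eta> / ((t - x)\<^sup>2 + \<eta>\<^sup>2)))"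
  have K: "K \<in> L2" unfolding K_def by (rule poisson_kernel_L2[OF \<eta>])
  have inner: "(LINT t|lborel. K t / (of_real s - Complex t \<epsilon>)) = of_real pi * (1 / (of_real s - Complex x (\<eta> + \<epsilon>)))" for s
  proof -
    let ?k = "\<lambda>t. 1 / ((of_real s - Complex t \<epsilon>) * (of_real x - Complex t \<eta>))"
    let ?l = "\<lambda>t. 1 / ((of_real s - Complex t \<epsilon>) * (of_real x - Complex t (- \<eta>)))"
    have int: "integrable lborel ?k" "integrable lborel ?l"
      using L2_mult_integrable[OF kernel_L2(1)[of \<epsilon> s] kernel_L2(1)[of \<eta> x]]
        L2_mult_integrable[OF kernel_L2(1)[of \<epsilon> s] kernel_L2(1)[of "-\<eta>" x]] \<eta> \<epsilon> by simp_all
    have "2 * \<i> * (LINT t|lborel. K t / (of_real s - Complex t \<epsilon>)) =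
        (LINT t|lborel. (2 * \<i> * K t) / (of_real s - Complex t \<epsilon>))"
      by (simp add: mult.assoc flip: integral_mult_right_zero)
    also have "\<dots> = (LINT t|lborel. ?k t - ?l t)"
    proof (intro Bochner_Integration.integral_cong refl)
      fix t
      have "2 * \<i> * K t = 1 / (of_real x - Complex t \<eta>) - 1 / (of_real x - Complex t (- \<eta>))"
        unfolding kernel_jump[OF \<eta>] K_def by (simp add: power2_commute)
      then show "2 * \<i> * K t / (of_real s - Complex t \<epsilon>) = ?k t - ?l t"
        by (simp add: diff_divide_distrib mult.commute)
    qed
    also have "\<dots> = (LINT t|lborel. ?k t) - (LINT t|lborel. ?l t)"
      using int by (rule Bochner_Integration.integral_diff)
    also have "(LINT t|lborel. ?k t) = 0"
      using integral_kernel_same_side[of "\<lambda>_. 1" \<epsilon> \<eta> 0 1 s x] \<eta> \<epsilon> by simp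
    also have "(LINT t|lborel. ?l t) = 2 * of_real pi * \<i> / (of_real x - of_real s + \<i> * of_real (\<epsilon> + \<eta>))"
      by (rule integral_kernel_opposite_sides[OF \<epsilon> \<eta>])
    also have "of_real x - of_real s + \<i> * of_real (\<epsilon> + \<eta>) = - (of_real s - Complex x (\<eta> + \<epsilon>))"
      by (simp add: complex_eq_iff)
    also have "0 - 2 * of_real pi * \<i> / - (of_real s - Complex x (\<eta> + \<epsilon>)) =
       2 * \<i> * (of_real pi * (1 / (of_real s - Complex x (\<eta> + \<epsilon>))))"
      unfolding divide_minus_right by (simp only: diff_0 minus_minus times_divide_eq_right mult_1_right mult_1_left mult_ac)
    finally have "2 * \<i> * (LINT t|lborel. K t / (of_real s - Complex t \<epsilon>)) =
       2 * \<i> * (of_real pi * (1 / (of_real s - Complex x (\<eta> + \<epsilon>))))" .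
    then show ?thesis by (subst (asm) mult_cancel_left) simp
  qed
  have "poisson (\<lambda>x. cauchy h (Complex x \<epsilon>)) \<eta> x = (LINT t|lborel. K t * cauchy h (Complex t \<epsilon>))"
    by (simp add: poisson_def K_def mult.commute)
  also have "\<dots> = (LINT s|lborel. of_real pi * (h s / (of_real s - Complex x (\<eta> + \<epsilon>))))"
    using \<epsilon> by (subst cauchy_pairing[OF K h]) (auto simp: inner mult_ac)
  also have "\<dots> = of_real pi * cauchy h (Complex x (\<eta> + \<epsilon>))"
    unfolding cauchy_def by (rule integral_mult_right_zero)
  finally show ?thesis .
qed

lemma Complex_tendsto_right:
  "((\<lambda>\<epsilon>. Complex x (\<eta> + \<epsilon>)) \<longlongrightarrow> Complex x \<eta>) (at_right 0)"
proof -
  have "((\<lambda>\<epsilon>. Complex x (\<eta> + \<epsilon>)) \<longlongrightarrow> Complex x (\<eta> + 0)) (at_right 0)"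
    by (intro tendsto_intros)
  then show ?thesis by simp
qed

lemma Complex_tendsto_of_real: "((\<lambda>\<eta>. Complex x \<eta>) \<longlongrightarrow> of_real x) (at_right 0)"
  using Complex_tendsto_right[of x 0] by (simp add: complex_of_real_def)

text \<open>The limit of the semigroup identity as \<epsilon> tends to 0. It expresses the transform
  by its boundary function, so that maximal estimates for Poisson integrals apply to the difference
  between \<open>F\<close> and a transform at positive height.\<close>

lemma poisson_boundary_value:
  assumes h: "integrable lborel h" and F: "F \<in> L2"
    and lim: "((\<lambda>\<eta>. normsq (\<lambda>x. cauchy h (Complex x \<eta>) - F x)) \<longlongrightarrow> 0) (at_right 0)"
    and \<eta>: "\<eta> > 0"
  shows "poisson F \<eta> x = of_real pi * cauchy h (Complex x \<eta>)"
proof (rule tendsto_unique[OF trivial_limit_at_right_real])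
  have pos: "\<forall>\<^sub>F \<epsilon>::real in at_right 0. \<epsilon> > 0" by (rule eventually_at_right_less)
  then have "\<forall>\<^sub>F \<epsilon> in at_right 0. (\<lambda>x. cauchy h (Complex x \<epsilon>)) \<in> L2"
    by eventually_elim (intro cauchy_L2 h, simp)
  from L2_tendsto_pairing[OF lim this F poisson_kernel_L2[OF \<eta>, of x]]
  show "((\<lambda>\<epsilon>. poisson (\<lambda>x. cauchy h (Complex x \<epsilon>)) \<eta> x) \<longlongrightarrow> poisson F \<eta> x) (at_right 0)"
    by (simp add: poisson_def)
  have "((\<lambda>\<epsilon>. of_real pi * cauchy h (Complex x (\<eta> + \<epsilon>))) \<longlongrightarrow> of_real pi * cauchy h (Complex x \<eta>)) (at_right 0)"
    using \<eta> by (intro tendsto_intros isCont_tendsto_compose[OF cauchy_isCont[OF h]] Complex_tendsto_right) simp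
  then show "((\<lambda>\<epsilon>. poisson (\<lambda>x. cauchy h (Complex x \<epsilon>)) \<eta> x) \<longlongrightarrow> of_real pi * cauchy h (Complex x \<eta>)) (at_right 0)"
    by (rule Lim_transform_eventually)
      (use pos in \<open>eventually_elim, simp add: poisson_cauchy[OF h \<eta>]\<close>)
qed

section \<open>A maximal inequality and its consequence for Poisson integrals\<close>

lemma L2_ball_average:
  assumes f: "f \<in> L2" and \<alpha>: "\<alpha> > 0" and r: "r > 0"
    and big: "\<not> (\<integral>\<^sup>+t. ennreal (cmod (f t)) * indicator (ball x r) t \<partial>lborel) \<le> ennreal (2 * \<alpha> * r)"
  shows "ennreal (\<alpha>\<^sup>2 * r) \<le> (\<integral>\<^sup>+t. ennreal ((cmod (f t))\<^sup>2) * indicator (ball x r) t \<partial>lborel)"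
proof -
  have [measurable]: "f \<in> borel_measurable borel" using f by (rule L2_measurable)
  have [measurable]: "ball x r \<in> sets borel" by simp
  define I where "I = (\<integral>\<^sup>+t. ennreal ((cmod (f t))\<^sup>2) * indicator (ball x r) t \<partial>lborel)"
  have "I \<le> (\<integral>\<^sup>+t. ennreal ((cmod (f t))\<^sup>2) \<partial>lborel)"
    unfolding I_def by (intro nn_integral_mono) (auto simp: indicator_def)
  then have "I < top" by (simp add: nn_integral_normsq[OF f] le_less_trans)
  then obtain i where i: "i \<ge> 0" "I = ennreal i" by (cases I) auto
  have "(\<integral>\<^sup>+t. ennreal (cmod (f t)) * indicator (ball x r) t \<partial>lborel) \<le>
     (\<integral>\<^sup>+t. ennreal (1 / \<alpha>) * (ennreal ((cmod (f t))\<^sup>2) * indicator (ball x r) t) + ennreal (\<alpha> / 4) * indicator (ball x r) t \<partial>lborel)"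
  proof (intro nn_integral_mono)
    fix t
    \<comment> \<open>Yields \<open>|f| \<le> |f|\<^sup>2 / \<alpha> + \<alpha> / 4\<close>. Over an
      interval of length \<open>2 r\<close> the constant contributes only
      \<open>\<alpha> r / 2\<close>, so a mean of \<open>|f|\<close> above \<alpha> must come from
      the integral of \<open>|f|\<^sup>2\<close>; the maximal bound can then be stated with
      \<open>normsq\<close>.\<close>
    have "0 \<le> (cmod (f t) - \<alpha> / 2)\<^sup>2 / \<alpha>" using \<alpha> by simp
    also have "(cmod (f t) - \<alpha> / 2)\<^sup>2 = (cmod (f t))\<^sup>2 + \<alpha> * \<alpha> / 4 - cmod (f t) * \<alpha>"
      by (simp add: power2_eq_square algebra_simps)
    also have "\<dots> / \<alpha> = 1 / \<alpha> * (cmod (f t))\<^sup>2 + \<alpha> / 4 - cmod (f t)"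
      using \<alpha> by (simp add: add_divide_distrib diff_divide_distrib)
    finally have "cmod (f t) \<le> 1 / \<alpha> * (cmod (f t))\<^sup>2 + \<alpha> / 4" by simp
    then have "ennreal (cmod (f t)) \<le> ennreal (1 / \<alpha> * (cmod (f t))\<^sup>2 + \<alpha> / 4)"
      by (rule ennreal_leI)
    also have "\<dots> = ennreal (1 / \<alpha>) * ennreal ((cmod (f t))\<^sup>2) + ennreal (\<alpha> / 4)"
    proof -
      have "0 \<le> 1 / \<alpha> * (cmod (f t))\<^sup>2" "0 \<le> \<alpha> / 4" using \<alpha> by simp_all
      then show ?thesis by (simp only: ennreal_plus ennreal_mult'' zero_le_power2)
    qed
    finally have "ennreal (cmod (f t)) \<le> ennreal (1 / \<alpha>) * ennreal ((cmod (f t))\<^sup>2) + ennreal (\<alpha> / 4)" .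
    then show "ennreal (cmod (f t)) * indicator (ball x r) t \<le>
      ennreal (1 / \<alpha>) * (ennreal ((cmod (f t))\<^sup>2) * indicator (ball x r) t) + ennreal (\<alpha> / 4) * indicator (ball x r) t"
      by (auto simp: indicator_def)
  qed
  also have "\<dots> = ennreal (1 / \<alpha>) * I + ennreal (\<alpha> / 4) * emeasure lborel (ball x r)"
    unfolding I_def by (subst nn_integral_add) (auto simp: nn_integral_cmult)
  also have "emeasure lborel (ball x r) = ennreal (2 * r)"
    using r by (simp add: ball_eq_greaterThanLessThan)
  also have "ennreal (1 / \<alpha>) * I + ennreal (\<alpha> / 4) * ennreal (2 * r) = ennreal (i / \<alpha> + \<alpha> / 2 * r)"
    using i \<alpha> r by (simp add: ennreal_mult[symmetric] ennreal_plus[symmetric] del: ennreal_plus)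
  finally have "\<not> i / \<alpha> + \<alpha> / 2 * r \<le> 2 * \<alpha> * r"
    using big by (meson ennreal_leI order_trans)
  then have "2 * \<alpha> * r < i / \<alpha> + \<alpha> / 2 * r" by simp
  moreover have "0 < \<alpha> * r" using \<alpha> r by simp
  ultimately have "\<alpha> * r \<le> i / \<alpha>" by simp
  then have "\<alpha>\<^sup>2 * r \<le> i" using \<alpha> by (simp add: field_simps power2_eq_square)
  then show ?thesis using i by (simp add: I_def[symmetric] ennreal_leI)
qed

text \<open>Vitali covering. Intervals with too large a mean have radius at most
  \<open>normsq f / \<alpha>\<^sup>2\<close>, so countably many disjoint ones suffice for their
  fivefold enlargements to cover the rest. An enlarged interval has length \<open>10 r\<close>, at
  most \<open>10 / \<alpha>\<^sup>2\<close> times the integral of \<open>|f|\<^sup>2\<close> over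
  the original one. This accounts for 10 of the constant 11; the remaining 1 is Chebyshev's bound
  for the set where \<open>|f| > \<alpha>\<close>.\<close>

lemma maximal_inequality:
  assumes f: "f \<in> L2" and \<alpha>: "\<alpha> > 0"
  obtains W where "W \<in> sets borel" "emeasure lborel W \<le> ennreal (11 * normsq f / \<alpha>\<^sup>2)"
    "\<And>x. x \<notin> W \<Longrightarrow> cmod (f x) \<le> \<alpha>"
    "\<And>x r. x \<notin> W \<Longrightarrow> r > 0 \<Longrightarrow>
       (\<integral>\<^sup>+t. ennreal (cmod (f t)) * indicator (ball x r) t \<partial>lborel) \<le> ennreal (2 * \<alpha> * r)"
proof -
  have [measurable]: "f \<in> borel_measurable borel" using f by (rule L2_measurable)
  define N where "N = density lborel (\<lambda>t. ennreal ((cmod (f t))\<^sup>2))"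
  have N: "emeasure N A = (\<integral>\<^sup>+t. ennreal ((cmod (f t))\<^sup>2) * indicator A t \<partial>lborel)" if "A \<in> sets borel" for A
    unfolding N_def using that by (subst emeasure_density) auto
  have N_le: "emeasure N A \<le> ennreal (normsq f)" if "A \<in> sets borel" for A
    unfolding N[OF that] nn_integral_normsq[OF f, symmetric]
    by (intro nn_integral_mono) (auto simp: indicator_def)
  define K where "K = {(x, r). r > 0 \<and>
      \<not> (\<integral>\<^sup>+t. ennreal (cmod (f t)) * indicator (ball x r) t \<partial>lborel) \<le> ennreal (2 * \<alpha> * r)}"
  have K: "0 < snd i" "ennreal (\<alpha>\<^sup>2 * snd i) \<le> emeasure N (ball (fst i) (snd i))" if "i \<in> K" for i
    using that L2_ball_average[OF f \<alpha>, of "snd i" "fst i"] by (auto simp: K_def N)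
  have K_bounded: "0 < snd i \<and> snd i \<le> normsq f / \<alpha>\<^sup>2" if "i \<in> K" for i
  proof -
    have "ennreal (\<alpha>\<^sup>2 * snd i) \<le> ennreal (normsq f)"
      using K(2)[OF that] N_le[of "ball (fst i) (snd i)"] by (auto intro: order_trans)
    then have "\<alpha>\<^sup>2 * snd i \<le> normsq f" by (simp add: normsq_nonneg)
    then show ?thesis using K(1)[OF that] \<alpha> by (simp add: pos_le_divide_eq mult.commute)
  qed
  obtain C where C: "countable C" "C \<subseteq> K"
     "pairwise (\<lambda>i j. disjnt (ball (fst i) (snd i)) (ball (fst j) (snd j))) C"
     "(\<Union>i\<in>K. ball (fst i) (snd i)) \<subseteq> (\<Union>i\<in>C. ball (fst i) (5 * snd i))"
    using Vitali_covering_lemma_balls[where a = fst and r = snd, OF order_refl K_bounded] by blast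
  define e where "e = to_nat_on C"
  have inj: "inj_on e C" unfolding e_def using C(1) by (rule inj_on_to_nat_on)
  define c where "c = (\<lambda>n. the_inv_into C e n)"
  have ce: "c (e i) = i" if "i \<in> C" for i unfolding c_def using inj that by (rule the_inv_into_f_f)
  define big where "big = (\<lambda>n. if n \<in> e ` C then ball (fst (c n)) (5 * snd (c n)) else {})"
  define small where "small = (\<lambda>n. if n \<in> e ` C then ball (fst (c n)) (snd (c n)) else {})"
  have U: "(\<Union>i\<in>C. ball (fst i) (5 * snd i)) = (\<Union>n. big n)"
    by (auto simp: big_def ce)
  have disj: "disjoint_family small"
    unfolding disjoint_family_on_def
  proof (intro ballI impI)
    fix m n :: nat assume "m \<noteq> n"
    show "small m \<inter> small n = {}"
    proof (cases "m \<in> e ` C \<and> n \<in> e ` C")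
      case True
      then obtain i j where ij: "i \<in> C" "j \<in> C" "m = e i" "n = e j" by auto
      then have "i \<noteq> j" using \<open>m \<noteq> n\<close> by auto
      then have "disjnt (ball (fst i) (snd i)) (ball (fst j) (snd j))"
        using C(3) ij by (simp add: pairwise_def)
      then show ?thesis using ij by (simp add: small_def ce disjnt_def)
    qed (auto simp: small_def)
  qed
  have [measurable]: "big n \<in> sets borel" "small n \<in> sets borel" for n
    by (auto simp: big_def small_def)
  have big_le: "emeasure lborel (big n) \<le> ennreal (10 / \<alpha>\<^sup>2) * emeasure N (small n)" for n
  proof (cases "n \<in> e ` C")
    case True
    then have cn: "c n \<in> K" using C(2) by (auto simp: ce)
    have "emeasure lborel (big n) = ennreal (10 / \<alpha>\<^sup>2) * ennreal (\<alpha>\<^sup>2 * snd (c n))"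
      using True K(1)[OF cn] \<alpha>
      by (simp add: big_def ball_eq_greaterThanLessThan ennreal_mult[symmetric])
    also have "\<dots> \<le> ennreal (10 / \<alpha>\<^sup>2) * emeasure N (small n)"
      using K(2)[OF cn] True by (intro mult_left_mono) (auto simp: small_def)
    finally show ?thesis .
  qed (simp add: big_def)
  have "emeasure lborel (\<Union>n. big n) \<le> (\<Sum>n. emeasure lborel (big n))"
    by (rule emeasure_subadditive_countably) auto
  also have "\<dots> \<le> (\<Sum>n. ennreal (10 / \<alpha>\<^sup>2) * emeasure N (small n))"
    by (intro suminf_le big_le) auto
  also have "\<dots> = ennreal (10 / \<alpha>\<^sup>2) * (\<Sum>n. emeasure N (small n))"
    by (rule ennreal_suminf_cmult)
  also have "(\<Sum>n. emeasure N (small n)) = emeasure N (\<Union>n. small n)"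
    by (rule suminf_emeasure) (auto simp: N_def disj)
  also have "ennreal (10 / \<alpha>\<^sup>2) * emeasure N (\<Union>n. small n) \<le> ennreal (10 / \<alpha>\<^sup>2) * ennreal (normsq f)"
    by (intro mult_left_mono N_le) auto
  also have "\<dots> = ennreal (10 * normsq f / \<alpha>\<^sup>2)"
    using \<alpha> normsq_nonneg by (simp add: ennreal_mult[symmetric])
  finally have m1: "emeasure lborel (\<Union>n. big n) \<le> ennreal (10 * normsq f / \<alpha>\<^sup>2)" .
  define T where "T = {x. \<alpha> < cmod (f x)}"
  have [measurable]: "T \<in> sets borel" unfolding T_def by measurable
  have "emeasure lborel T = (\<integral>\<^sup>+x. indicator T x \<partial>lborel)" by simp
  also have "\<dots> \<le> (\<integral>\<^sup>+x. ennreal (1 / \<alpha>\<^sup>2) * ennreal ((cmod (f x))\<^sup>2) \<partial>lborel)"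
  proof (intro nn_integral_mono)
    fix x
    show "indicator T x \<le> ennreal (1 / \<alpha>\<^sup>2) * ennreal ((cmod (f x))\<^sup>2)"
    proof (cases "x \<in> T")
      case True
      then have "\<alpha>\<^sup>2 \<le> (cmod (f x))\<^sup>2" using \<alpha> by (intro power_mono) (auto simp: T_def)
      then have "1 \<le> 1 / \<alpha>\<^sup>2 * (cmod (f x))\<^sup>2" using \<alpha> by simp
      then have "1 \<le> ennreal (1 / \<alpha>\<^sup>2) * ennreal ((cmod (f x))\<^sup>2)"
        by (metis ennreal_1 ennreal_leI ennreal_mult'' zero_le_power2)
      then show ?thesis using True by simp
    qed simp
  qed
  also have "\<dots> = ennreal (normsq f / \<alpha>\<^sup>2)"
    using normsq_nonneg[of f] by (subst nn_integral_cmult) (auto simp: nn_integral_normsq[OF f] ennreal_mult[symmetric])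
  finally have m2: "emeasure lborel T \<le> ennreal (normsq f / \<alpha>\<^sup>2)" .
  show thesis
  proof (rule that[of "(\<Union>n. big n) \<union> T"])
    have "emeasure lborel ((\<Union>n. big n) \<union> T) \<le> emeasure lborel (\<Union>n. big n) + emeasure lborel T"
      by (rule emeasure_subadditive) auto
    also have "\<dots> \<le> ennreal (10 * normsq f / \<alpha>\<^sup>2) + ennreal (normsq f / \<alpha>\<^sup>2)"
      by (intro add_mono m1 m2)
    also have "\<dots> = ennreal (11 * normsq f / \<alpha>\<^sup>2)"
      using normsq_nonneg[of f] by (subst ennreal_plus[symmetric]) (auto simp: add_divide_distrib[symmetric])
    finally show "emeasure lborel ((\<Union>n. big n) \<union> T) \<le> ennreal (11 * normsq f / \<alpha>\<^sup>2)" .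
  next
    fix x r assume x: "x \<notin> (\<Union>n. big n) \<union> T" and r: "(r::real) > 0"
    show "(\<integral>\<^sup>+t. ennreal (cmod (f t)) * indicator (ball x r) t \<partial>lborel) \<le> ennreal (2 * \<alpha> * r)"
    proof (rule ccontr)
      assume "\<not> ?thesis"
      then have "(x, r) \<in> K" using r by (auto simp: K_def)
      then have "x \<in> (\<Union>i\<in>K. ball (fst i) (snd i))" using r by force
      then have "x \<in> (\<Union>n. big n)" using C(4) unfolding U by (rule rev_subsetD)
      then show False using x by blast
    qed
  qed (auto simp: T_def)
qed

text \<open>Let \<open>j\<close> be least with \<open>|t - x| < 2 ^ j * \<eta>\<close>. If
  \<open>j > 0\<close>, minimality gives \<open>|t - x| \<ge> 2 ^ (j - 1) * \<eta>\<close>, and in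
  every case the kernel is at most the term of index \<open>j\<close>. The other terms of the series
  are nonnegative.\<close>

lemma poisson_kernel_dyadic:
  fixes x t :: real
  assumes \<eta>: "\<eta> > 0"
  shows "ennreal (\<eta> / ((t - x)\<^sup>2 + \<eta>\<^sup>2)) \<le> (\<Sum>j. ennreal (4 / (4 ^ j * \<eta>)) * indicator (ball x (2 ^ j * \<eta>)) t)"
proof -
  have ex: "\<exists>j::nat. \<bar>t - x\<bar> < 2 ^ j * \<eta>"
  proof -
    obtain j :: nat where "\<bar>t - x\<bar> / \<eta> < 2 ^ j"
      using real_arch_pow[of 2 "\<bar>t - x\<bar> / \<eta>"] by auto
    then show ?thesis using \<eta> by (auto simp: pos_divide_less_eq)
  qed
  define j where "j = (LEAST j::nat. \<bar>t - x\<bar> < 2 ^ j * \<eta>)"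
  have j: "\<bar>t - x\<bar> < 2 ^ j * \<eta>" unfolding j_def by (rule LeastI_ex[OF ex])
  have pos: "(t - x)\<^sup>2 + \<eta>\<^sup>2 > 0" using \<eta> by (intro add_nonneg_pos) auto
  have "4 ^ j * \<eta>\<^sup>2 \<le> 4 * ((t - x)\<^sup>2 + \<eta>\<^sup>2)"
  proof (cases j)
    case (Suc i)
    have "\<not> \<bar>t - x\<bar> < 2 ^ i * \<eta>"
      using not_less_Least[of i "\<lambda>j. \<bar>t - x\<bar> < 2 ^ j * \<eta>"] Suc by (simp add: j_def)
    then have "(2 ^ i * \<eta>)\<^sup>2 \<le> \<bar>t - x\<bar>\<^sup>2"
      using \<eta> by (intro power_mono) auto
    moreover have "(4::real) ^ i = (2 ^ i)\<^sup>2"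
      by (simp add: power2_eq_square flip: power_mult_distrib)
    ultimately have "4 ^ i * \<eta>\<^sup>2 \<le> (t - x)\<^sup>2" by (simp add: power_mult_distrib)
    then have "4 * (4 ^ i * \<eta>\<^sup>2) \<le> 4 * (t - x)\<^sup>2 + 4 * \<eta>\<^sup>2"
      using zero_le_power2[of \<eta>] by linarith
    then show ?thesis using Suc by simp
  qed simp
  then have "\<eta> / ((t - x)\<^sup>2 + \<eta>\<^sup>2) \<le> 4 / (4 ^ j * \<eta>)"
    using \<eta> pos by (simp add: field_simps power2_eq_square)
  then have "ennreal (\<eta> / ((t - x)\<^sup>2 + \<eta>\<^sup>2)) \<le> ennreal (4 / (4 ^ j * \<eta>)) * indicator (ball x (2 ^ j * \<eta>)) t"
    using j by (simp add: dist_real_def abs_minus_commute ennreal_leI)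
  also have "\<dots> \<le> (\<Sum>j. ennreal (4 / (4 ^ j * \<eta>)) * indicator (ball x (2 ^ j * \<eta>)) t)"
    by (rule sum_le_suminf[of _ "{j}", simplified]) auto
  finally show ?thesis .
qed

text \<open>The dyadic ball of index \<open>j\<close> contributes at most
  \<open>4 / (4 ^ j * \<eta>)\<close> times \<open>2 * \<alpha> * 2 ^ j * \<eta>\<close>, that is
  \<open>8 * \<alpha> / 2 ^ j\<close>, and these sum to \<open>16 * \<alpha>\<close> whatever \<eta>
  is.\<close>

lemma poisson_le_maximal:
  assumes f: "f \<in> L2" and \<eta>: "\<eta> > 0" and \<alpha>: "\<alpha> > 0"
    and max: "\<And>r. r > 0 \<Longrightarrow> (\<integral>\<^sup>+t. ennreal (cmod (f t)) * indicator (ball x r) t \<partial>lborel) \<le> ennreal (2 * \<alpha> * r)"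
  shows "cmod (poisson f \<eta> x) \<le> 16 * \<alpha>"
proof -
  have [measurable]: "f \<in> borel_measurable borel" using f by (rule L2_measurable)
  have [measurable]: "ball x r \<in> sets borel" for r by simp
  let ?k = "\<lambda>t. \<eta> / ((t - x)\<^sup>2 + \<eta>\<^sup>2)"
  have k0: "?k t \<ge> 0" for t using \<eta> by simp
  have "ennreal (cmod (poisson f \<eta> x)) \<le> (\<integral>\<^sup>+t. ennreal (cmod (f t * of_real (?k t))) \<partial>lborel)"
    unfolding poisson_def
    by (rule integral_norm_bound_ennreal[OF L2_mult_integrable[OF f poisson_kernel_L2[OF \<eta>]]])
  also have "\<dots> = (\<integral>\<^sup>+t. ennreal (cmod (f t)) * ennreal (?k t) \<partial>lborel)"
  proof (intro nn_integral_cong)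
    fix t
    have "cmod (f t * of_real (?k t)) = cmod (f t) * ?k t"
      using k0[of t] by (simp only: norm_mult norm_of_real abs_of_nonneg)
    then show "ennreal (cmod (f t * of_real (?k t))) = ennreal (cmod (f t)) * ennreal (?k t)"
      using k0[of t] by (simp only: ennreal_mult norm_ge_zero)
  qed
  also have "\<dots> \<le> (\<integral>\<^sup>+t. (\<Sum>j. ennreal (4 / (4 ^ j * \<eta>)) * (ennreal (cmod (f t)) * indicator (ball x (2 ^ j * \<eta>)) t)) \<partial>lborel)"
  proof (intro nn_integral_mono)
    fix t
    have "ennreal (cmod (f t)) * ennreal (?k t) \<le>
       ennreal (cmod (f t)) * (\<Sum>j. ennreal (4 / (4 ^ j * \<eta>)) * indicator (ball x (2 ^ j * \<eta>)) t)"
      by (intro mult_left_mono poisson_kernel_dyadic[OF \<eta>]) auto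
    also have "\<dots> = (\<Sum>j. ennreal (4 / (4 ^ j * \<eta>)) * (ennreal (cmod (f t)) * indicator (ball x (2 ^ j * \<eta>)) t))"
      unfolding ennreal_suminf_cmult[symmetric] by (simp only: mult.left_commute)
    finally show "ennreal (cmod (f t)) * ennreal (?k t) \<le> \<dots>" .
  qed
  also have "\<dots> = (\<Sum>j. \<integral>\<^sup>+t. ennreal (4 / (4 ^ j * \<eta>)) * (ennreal (cmod (f t)) * indicator (ball x (2 ^ j * \<eta>)) t) \<partial>lborel)"
    by (rule nn_integral_suminf) measurable
  also have "\<dots> \<le> (\<Sum>j. ennreal (8 * \<alpha> * (1/2) ^ j))"
  proof (intro suminf_le allI)
    fix j :: nat
    have "(\<integral>\<^sup>+t. ennreal (4 / (4 ^ j * \<eta>)) * (ennreal (cmod (f t)) * indicator (ball x (2 ^ j * \<eta>)) t) \<partial>lborel) =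
      ennreal (4 / (4 ^ j * \<eta>)) * (\<integral>\<^sup>+t. ennreal (cmod (f t)) * indicator (ball x (2 ^ j * \<eta>)) t \<partial>lborel)"
      by (rule nn_integral_cmult) measurable
    also have "\<dots> \<le> ennreal (4 / (4 ^ j * \<eta>)) * ennreal (2 * \<alpha> * (2 ^ j * \<eta>))"
      using \<eta> by (intro mult_left_mono max) auto
    also have "\<dots> = ennreal (8 * \<alpha> * (1/2) ^ j)"
    proof -
      have "(4::real) ^ j = 2 ^ j * 2 ^ j" by (simp flip: power_mult_distrib)
      then have "4 / (4 ^ j * \<eta>) * (2 * \<alpha> * (2 ^ j * \<eta>)) = 8 * \<alpha> * (1/2) ^ j"
        using \<eta> by (simp add: power_one_over field_simps)
      then show ?thesis
        using \<eta> \<alpha> by (subst ennreal_mult[symmetric]) auto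
    qed
    finally show "(\<integral>\<^sup>+t. ennreal (4 / (4 ^ j * \<eta>)) * (ennreal (cmod (f t)) * indicator (ball x (2 ^ j * \<eta>)) t) \<partial>lborel)
       \<le> ennreal (8 * \<alpha> * (1/2) ^ j)" .
  qed auto
  also have "\<dots> = ennreal (\<Sum>j. 8 * \<alpha> * (1/2) ^ j)"
    using \<alpha> by (intro suminf_ennreal2 summable_mult) auto
  also have "(\<Sum>j. 8 * \<alpha> * (1/2) ^ j) = 16 * \<alpha>"
    by (subst suminf_mult) (auto simp: suminf_geometric)
  finally show ?thesis using \<alpha> by simp
qed

text \<open>Borel-Cantelli. The difference \<open>G k\<close> of the transform at height
  \<open>\<epsilon> k\<close> and \<open>F\<close> has squared norm at most \<open>8 ^ -k\<close>;
  the maximal inequality at level \<open>2 ^ -k\<close> leaves an exceptional set of measure at most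
  \<open>11 / 2 ^ k\<close>, which is summable. Outside it, the Poisson integral of
  \<open>G k\<close> compares the transforms at heights \<eta> and
  \<open>\<epsilon> k + \<eta>\<close> uniformly in \<eta>, so convergence holds along all heights
  and not only along a sequence.\<close>

theorem cauchy_boundary_value_AE:
  assumes h: "integrable lborel h" and F: "F \<in> L2"
    and lim: "((\<lambda>\<eta>. normsq (\<lambda>x. cauchy h (Complex x \<eta>) - F x)) \<longlongrightarrow> 0) (at_right 0)"
  shows "AE x in lborel. ((\<lambda>\<eta>. cauchy h (Complex x \<eta>)) \<longlongrightarrow> F x) (at_right 0)"
proof -
  have "\<exists>\<epsilon>>0. normsq (\<lambda>x. cauchy h (Complex x \<epsilon>) - F x) \<le> (1/8) ^ k" for k :: nat
  proof -
    have "\<forall>\<^sub>F \<epsilon> in at_right 0. normsq (\<lambda>x. cauchy h (Complex x \<epsilon>) - F x) < (1/8) ^ k \<and> \<epsilon> > 0"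
      by (intro eventually_conj order_tendstoD(2)[OF lim] eventually_at_right_less) simp
    from eventually_happens'[OF trivial_limit_at_right_real this] show ?thesis
      by (auto intro: less_imp_le)
  qed
  then obtain \<epsilon> where \<epsilon>: "\<And>k. \<epsilon> k > 0" "\<And>k. normsq (\<lambda>x. cauchy h (Complex x (\<epsilon> k)) - F x) \<le> (1/8) ^ k"
    by metis
  define G where "G = (\<lambda>k x. cauchy h (Complex x (\<epsilon> k)) - F x)"
  have C_L2: "(\<lambda>x. cauchy h (Complex x (\<epsilon> k))) \<in> L2" for k
    using \<epsilon>(1)[of k] by (intro cauchy_L2 h) auto
  have G: "G k \<in> L2" for k
    unfolding G_def by (intro L2_diff F C_L2)
  have "\<exists>W. W \<in> sets borel \<and> emeasure lborel W \<le> ennreal (11 * (1/2) ^ k) \<and>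
      (\<forall>x. x \<notin> W \<longrightarrow> cmod (G k x) \<le> (1/2) ^ k \<and> (\<forall>r>0.
       (\<integral>\<^sup>+t. ennreal (cmod (G k t)) * indicator (ball x r) t \<partial>lborel) \<le> ennreal (2 * (1/2) ^ k * r)))" for k
  proof -
    have pos: "(1/2::real) ^ k > 0" by simp
    have "11 * normsq (G k) / ((1/2) ^ k)\<^sup>2 \<le> 11 * (1/8) ^ k / ((1/2) ^ k)\<^sup>2"
      using \<epsilon>(2)[of k] by (intro divide_right_mono) (auto simp: G_def)
    also have "\<dots> = 11 * (1/2) ^ k"
    proof -
      have "(8::real) ^ k = 2 ^ k * (2 ^ k * 2 ^ k)" by (simp flip: power_mult_distrib)
      then show ?thesis by (simp add: power_one_over field_simps power2_eq_square)
    qed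
    finally have le: "11 * normsq (G k) / ((1/2) ^ k)\<^sup>2 \<le> 11 * (1/2) ^ k" .
    obtain W where W: "W \<in> sets borel" "emeasure lborel W \<le> ennreal (11 * normsq (G k) / ((1/2) ^ k)\<^sup>2)"
      "\<And>x. x \<notin> W \<Longrightarrow> cmod (G k x) \<le> (1/2) ^ k"
      "\<And>x r. x \<notin> W \<Longrightarrow> r > 0 \<Longrightarrow>
        (\<integral>\<^sup>+t. ennreal (cmod (G k t)) * indicator (ball x r) t \<partial>lborel) \<le> ennreal (2 * (1/2) ^ k * r)"
      by (rule maximal_inequality[OF G[of k] pos], rule that)
    have "emeasure lborel W \<le> ennreal (11 * (1/2) ^ k)"
      by (rule order_trans[OF W(2) ennreal_leI[OF le]])
    with W(1,3,4) show ?thesis by blast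
  qed
  then have "\<exists>W. \<forall>k. W k \<in> sets borel \<and> emeasure lborel (W k) \<le> ennreal (11 * (1/2) ^ k) \<and>
      (\<forall>x. x \<notin> W k \<longrightarrow> cmod (G k x) \<le> (1/2) ^ k \<and> (\<forall>r>0.
       (\<integral>\<^sup>+t. ennreal (cmod (G k t)) * indicator (ball x r) t \<partial>lborel) \<le> ennreal (2 * (1/2) ^ k * r)))"
    by (intro choice allI)
  then obtain W where W: "\<And>k. W k \<in> sets borel" "\<And>k. emeasure lborel (W k) \<le> ennreal (11 * (1/2) ^ k)"
    "\<And>k x. x \<notin> W k \<Longrightarrow> cmod (G k x) \<le> (1/2) ^ k"
    "\<And>k x r. x \<notin> W k \<Longrightarrow> r > 0 \<Longrightarrow>
       (\<integral>\<^sup>+t. ennreal (cmod (G k t)) * indicator (ball x r) t \<partial>lborel) \<le> ennreal (2 * (1/2) ^ k * r)"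
    by blast
  have "AE x in lborel. eventually (\<lambda>k. x \<in> space lborel - W k) sequentially"
  proof (rule borel_cantelli_AE1)
    show fin: "emeasure lborel (W k) < \<infinity>" for k
      using W(2)[of k] by (auto intro: le_less_trans)
    show "summable (\<lambda>k. measure lborel (W k))"
    proof (rule summable_comparison_test[of _ "\<lambda>k. 11 * (1/2) ^ k"])
      have "measure lborel (W k) \<le> 11 * (1/2) ^ k" for k
        unfolding measure_def using W(2)[of k] by (intro enn2real_leI) auto
      then show "\<exists>N. \<forall>k\<ge>N. norm (measure lborel (W k)) \<le> 11 * (1/2) ^ k" by simp
      show "summable (\<lambda>k. 11 * (1/2::real) ^ k)" by (intro summable_mult summable_geometric) simp
    qed
  qed (use W in simp)
  then show ?thesis
  proof eventually_elim
    case (elim x)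
    show ?case
    proof (rule tendstoI)
      fix e :: real assume e: "e > 0"
      \<comment> \<open>17 is 16 from the maximal bound for the Poisson integral of
        \<open>G k\<close> plus 1 from the pointwise bound for \<open>G k x\<close>. The other half
        of \<open>e\<close> pays for continuity at the fixed height
        \<open>\<epsilon> k\<close>.\<close>
      have "(\<lambda>k. 17 * (1/2::real) ^ k) \<longlonglongrightarrow> 17 * 0"
        by (intro tendsto_intros LIMSEQ_power_zero) simp
      then have "\<forall>\<^sub>F k in sequentially. 17 * (1/2) ^ k < e / 2"
        by (rule order_tendstoD(2)) (use e in simp)
      with elim have "\<forall>\<^sub>F k in sequentially. x \<notin> W k \<and> 17 * (1/2) ^ k < e / 2"
        by eventually_elim auto
      from eventually_happens'[OF sequentially_bot this]
      obtain k where k: "x \<notin> W k" "17 * (1/2) ^ k < e / 2" by blast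
      have "((\<lambda>\<eta>. cauchy h (Complex x (\<epsilon> k + \<eta>))) \<longlongrightarrow> cauchy h (Complex x (\<epsilon> k))) (at_right 0)"
        using \<epsilon>(1)[of k] by (intro isCont_tendsto_compose[OF cauchy_isCont[OF h]] Complex_tendsto_right) simp
      then have "\<forall>\<^sub>F \<eta> in at_right 0. dist (cauchy h (Complex x (\<epsilon> k + \<eta>))) (cauchy h (Complex x (\<epsilon> k))) < e / 2"
        using e by (intro tendstoD) auto
      then show "\<forall>\<^sub>F \<eta> in at_right 0. dist (cauchy h (Complex x \<eta>)) (F x) < e"
        using eventually_at_right_less[of 0]
      proof eventually_elim
        case (elim \<eta>)
        have "poisson (G k) \<eta> x = poisson (\<lambda>x. cauchy h (Complex x (\<epsilon> k))) \<eta> x - poisson F \<eta> x"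
          using L2_mult_integrable[OF C_L2[of k] poisson_kernel_L2[OF elim(2)]]
            L2_mult_integrable[OF F poisson_kernel_L2[OF elim(2)]]
          unfolding poisson_def G_def left_diff_distrib by (rule Bochner_Integration.integral_diff)
        also have "\<dots> = of_real pi * (cauchy h (Complex x (\<epsilon> k + \<eta>)) - cauchy h (Complex x \<eta>))"
          using poisson_cauchy[OF h elim(2) \<epsilon>(1)[of k], of x] poisson_boundary_value[OF h F lim elim(2), of x]
          by (simp add: right_diff_distrib add.commute)
        finally have "pi * cmod (cauchy h (Complex x (\<epsilon> k + \<eta>)) - cauchy h (Complex x \<eta>)) = cmod (poisson (G k) \<eta> x)"
          by (simp add: norm_mult)
        also have "\<dots> \<le> 16 * (1/2) ^ k"
          using W(4)[OF k(1)] by (intro poisson_le_maximal[OF G elim(2)]) auto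
        finally have 1: "cmod (cauchy h (Complex x (\<epsilon> k + \<eta>)) - cauchy h (Complex x \<eta>)) \<le> 16 * (1/2) ^ k"
          using pi_ge_two mult_right_mono[of 1 pi "cmod (cauchy h (Complex x (\<epsilon> k + \<eta>)) - cauchy h (Complex x \<eta>))"]
          by auto
        have 2: "cmod (cauchy h (Complex x (\<epsilon> k)) - F x) \<le> (1/2) ^ k"
          using W(3)[OF k(1)] by (simp add: G_def)
        have "cauchy h (Complex x \<eta>) - F x = (cauchy h (Complex x (\<epsilon> k + \<eta>)) - cauchy h (Complex x (\<epsilon> k)))
           - (cauchy h (Complex x (\<epsilon> k + \<eta>)) - cauchy h (Complex x \<eta>)) + (cauchy h (Complex x (\<epsilon> k)) - F x)"
          by simp
        then have "cmod (cauchy h (Complex x \<eta>) - F x) \<le> cmod (cauchy h (Complex x (\<epsilon> k + \<eta>)) - cauchy h (Complex x (\<epsilon> k)))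
           + cmod (cauchy h (Complex x (\<epsilon> k + \<eta>)) - cauchy h (Complex x \<eta>)) + cmod (cauchy h (Complex x (\<epsilon> k)) - F x)"
          by (smt (verit) norm_triangle_ineq norm_triangle_ineq4)
        then show ?case using 1 2 k(2) elim(1) by (simp add: dist_norm)
      qed
    qed
  qed
qed

section \<open>The jump across the real line\<close>

lemma dominated_convergence_within:
  fixes u :: "'b::first_countable_topology \<Rightarrow> 'a \<Rightarrow> complex"
  assumes meas: "\<And>y. y \<in> S \<Longrightarrow> y \<noteq> y0 \<Longrightarrow> u y \<in> borel_measurable M"
    and G: "G \<in> borel_measurable M" and bound: "integrable M bound"
    and bd: "\<And>y. y \<in> S \<Longrightarrow> y \<noteq> y0 \<Longrightarrow> AE x in M. norm (u y x) \<le> bound x"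
    and lim: "AE x in M. ((\<lambda>y. u y x) \<longlongrightarrow> G x) (at y0 within S)"
  shows "((\<lambda>y. \<integral>x. u y x \<partial>M) \<longlongrightarrow> (\<integral>x. G x \<partial>M)) (at y0 within S)"
  unfolding tendsto_at_iff_sequentially o_def
proof (intro allI impI)
  fix X :: "nat \<Rightarrow> 'b" assume X: "\<forall>i. X i \<in> S - {y0}" and Xlim: "X \<longlonglongrightarrow> y0"
  show "(\<lambda>i. \<integral>x. u (X i) x \<partial>M) \<longlonglongrightarrow> (\<integral>x. G x \<partial>M)"
  proof (rule integral_dominated_convergence[OF G _ bound])
    show "u (X i) \<in> borel_measurable M" for i using X meas by auto
    show "AE x in M. norm (u (X i) x) \<le> bound x" for i using X bd by auto
    show "AE x in M. (\<lambda>i. u (X i) x) \<longlonglongrightarrow> G x"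
      using lim by eventually_elim (use X Xlim in \<open>auto simp: tendsto_at_iff_sequentially o_def\<close>)
  qed
qed

text \<open>Half-open intervals form an intersection-stable generator of the Borel sets, so the
  vanishing of the integrals extends to all Borel sets by Dynkin induction. Closure under
  complements requires the integral over the whole line to vanish, which follows by
  exhaustion.\<close>

lemma AE_zero_if_interval_integrals_zero:
  fixes g :: "real \<Rightarrow> complex"
  assumes g: "integrable lborel g"
    and zero: "\<And>a b. (LINT x|lborel. indicator {a<..b} x *\<^sub>R g x) = 0"
  shows "AE x in lborel. g x = 0"
proof (rule sigma_finite_measure.density_zero[OF sigma_finite_lborel g])
  fix A :: "real set" assume "A \<in> sets lborel"
  have total: "(LINT x|lborel. g x) = 0"
  proof (rule LIMSEQ_unique)
    show "(\<lambda>n. LINT x|lborel. indicator {-real n<..real n} x *\<^sub>R g x) \<longlonglongrightarrow> 0"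
      by (simp add: zero)
    show "(\<lambda>n. LINT x|lborel. indicator {-real n<..real n} x *\<^sub>R g x) \<longlonglongrightarrow> (LINT x|lborel. g x)"
    proof (rule integral_dominated_convergence[where w = "\<lambda>x. norm (g x)"])
      show "AE x in lborel. (\<lambda>n. indicator {-real n<..real n} x *\<^sub>R g x) \<longlonglongrightarrow> g x"
      proof (intro always_eventually allI)
        fix x :: real
        obtain N :: nat where N: "\<bar>x\<bar> < real N" using reals_Archimedean2 by blast
        have "\<forall>\<^sub>F n in sequentially. indicator {-real n<..real n} x *\<^sub>R g x = g x"
          using eventually_ge_at_top[of N] by eventually_elim (use N in \<open>auto simp: indicator_def\<close>)
        then show "(\<lambda>n. indicator {-real n<..real n} x *\<^sub>R g x) \<longlonglongrightarrow> g x"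
          by (rule tendsto_eventually)
      qed
    qed (use g in \<open>auto simp: indicator_def\<close>)
  qed
  have int: "set_integrable lborel B g" if "B \<in> sets borel" for B
    using that g unfolding set_integrable_def by (intro integrable_mult_indicator) auto
  have sets_eq: "sets borel = sigma_sets UNIV (range (\<lambda>(a, b). {a<..b::real}))"
    by (subst borel_sigma_sets_Ioc, rule sets_measure_of) simp
  have "Int_stable (range (\<lambda>(a, b). {a<..b::real}))"
  proof (rule Int_stableI)
    fix A B assume "A \<in> range (\<lambda>(a, b). {a<..b::real})" "B \<in> range (\<lambda>(a, b). {a<..b::real})"
    then obtain a b c d where "A = {a<..b}" "B = {c<..d}" by auto
    then have "A \<inter> B = (\<lambda>(a, b). {a<..b::real}) (max a c, min b d)" by auto
    then show "A \<inter> B \<in> range (\<lambda>(a, b). {a<..b::real})" by blast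
  qed
  moreover have "range (\<lambda>(a, b). {a<..b::real}) \<subseteq> Pow UNIV" by simp
  moreover have "A \<in> sigma_sets UNIV (range (\<lambda>(a, b). {a<..b::real}))"
    using \<open>A \<in> sets lborel\<close> sets_eq by simp
  ultimately show "set_lebesgue_integral lborel A g = 0"
  proof (induction rule: sigma_sets_induct_disjoint)
    case (basic A)
    then show ?case using zero by (auto simp: set_lebesgue_integral_def)
  next
    case (compl A)
    then have A: "A \<in> sets borel" using sets_eq by simp
    have "set_lebesgue_integral lborel (UNIV - A) g = (LINT x|lborel. g x - indicator A x *\<^sub>R g x)"
      unfolding set_lebesgue_integral_def
      by (intro Bochner_Integration.integral_cong) (auto simp: indicator_def)
    also have "\<dots> = (LINT x|lborel. g x) - set_lebesgue_integral lborel A g"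
      unfolding set_lebesgue_integral_def using int[OF A] g
      by (intro Bochner_Integration.integral_diff) (auto simp: set_integrable_def)
    finally show ?case using compl total by simp
  next
    case (union A)
    then have A: "A i \<in> sets borel" for i using sets_eq by auto
    have "set_lebesgue_integral lborel (\<Union>i. A i) g = (\<Sum>i. set_lebesgue_integral lborel (A i) g)"
      using A union(1) by (intro lebesgue_integral_countable_add int) (auto simp: disjoint_family_on_def)
    then show ?case using union by simp
  qed (simp add: set_lebesgue_integral_def)
qed

lemma L2_indicator:
  "(\<lambda>x. complex_of_real (indicator {a..b} x)) \<in> L2"
proof -
  have "(\<lambda>x. (cmod (complex_of_real (indicator {a..b::real} x)))\<^sup>2) = indicator {a..b}"
    by (auto simp: indicator_def fun_eq_iff)
  moreover have "integrable lborel (indicator {a..b::real} :: real \<Rightarrow> real)"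
    by (rule integrable_real_indicator) (auto simp: emeasure_lborel_Icc_eq)
  ultimately show ?thesis by (simp add: L2_def)
qed

text \<open>A function in \<open>L2\<close> need not be integrable, hence the truncation to
  \<open>{-n..n}\<close>. Closed and half-open intervals differ by one point, which is a null
  set.\<close>

lemma L2_AE_zero:
  assumes d: "d \<in> L2" and zero: "\<And>a b. (LINT x|lborel. d x * of_real (indicator {a..b} x)) = 0"
  shows "AE x in lborel. d x = 0"
proof -
  have [measurable]: "d \<in> borel_measurable borel" using d by (rule L2_measurable)
  have "AE x in lborel. indicator {-real n..real n} x *\<^sub>R d x = 0" for n
  proof (rule AE_zero_if_interval_integrals_zero)
    show "integrable lborel (\<lambda>x. indicator {-real n..real n} x *\<^sub>R d x)"
      using L2_mult_integrable[OF L2_indicator[of "-real n" "real n"] d] by (simp add: scaleR_conv_of_real)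
    fix a b :: real
    have "(LINT x|lborel. indicator {a<..b} x *\<^sub>R (indicator {-real n..real n} x *\<^sub>R d x)) =
       (LINT x|lborel. d x * of_real (indicator {max a (- real n)..min b (real n)} x))"
    proof (rule integral_cong_AE)
      show "AE x in lborel. indicator {a<..b} x *\<^sub>R (indicator {-real n..real n} x *\<^sub>R d x) =
         d x * of_real (indicator {max a (- real n)..min b (real n)} x)"
        using AE_lborel_singleton[of a] by eventually_elim (auto simp: indicator_def)
    qed measurable
    also have "\<dots> = 0" by (rule zero)
    finally show "(LINT x|lborel. indicator {a<..b} x *\<^sub>R (indicator {-real n..real n} x *\<^sub>R d x)) = 0" .
  qed
  then have "AE x in lborel. \<forall>n. indicator {-real n..real n} x *\<^sub>R d x = 0"
    unfolding AE_all_countable by blast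
  then show ?thesis
  proof eventually_elim
    case (elim x)
    obtain n :: nat where "\<bar>x\<bar> < real n" using reals_Archimedean2 by blast
    then show ?case using elim[rule_format, of n] by (auto simp: indicator_def split: if_splits)
  qed
qed

lemma integral_poisson_kernel_interval:
  assumes \<eta>: "\<eta> > 0" and ab: "a \<le> b"
  shows "(LINT x|lborel. (\<eta> / ((s - x)\<^sup>2 + \<eta>\<^sup>2)) * indicator {a..b} x) = arctan ((b - s) / \<eta>) - arctan ((a - s) / \<eta>)"
proof (rule integral_FTC_Icc_real[OF ab])
  fix x
  have pos: "(s - x)\<^sup>2 + \<eta>\<^sup>2 > 0" for x using \<eta> by (intro add_nonneg_pos) auto
  have "((\<lambda>x. arctan ((x - s) / \<eta>)) has_real_derivative (inverse (1 + ((x - s) / \<eta>)\<^sup>2) * (1 / \<eta>))) (at x)"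
    using \<eta> by (auto intro!: derivative_eq_intros)
  moreover have "inverse (1 + ((x - s) / \<eta>)\<^sup>2) * (1 / \<eta>) = \<eta> / ((s - x)\<^sup>2 + \<eta>\<^sup>2)"
  proof -
    have "1 + ((x - s) / \<eta>)\<^sup>2 = ((s - x)\<^sup>2 + \<eta>\<^sup>2) / \<eta>\<^sup>2"
      using \<eta> by (simp add: power_divide add_divide_distrib power2_commute)
    then show ?thesis using \<eta> pos[of x] by (simp add: power2_eq_square)
  qed
  ultimately show "((\<lambda>x. arctan ((x - s) / \<eta>)) has_real_derivative \<eta> / ((s - x)\<^sup>2 + \<eta>\<^sup>2)) (at x)" by simp
  show "isCont (\<lambda>x. \<eta> / ((s - x)\<^sup>2 + \<eta>\<^sup>2)) x"
    using pos[of x] by (intro continuous_intros) auto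
qed

lemma arctan_scaled_tendsto:
  assumes "c \<noteq> 0"
  shows "((\<lambda>\<eta>. arctan (c / \<eta>)) \<longlongrightarrow> sgn c * (pi / 2)) (at_right 0)"
proof (cases "c > 0")
  case True
  then have "filterlim (\<lambda>\<eta>. c / \<eta>) at_top (at_right 0)" by real_asymp
  from filterlim_compose[OF tendsto_arctan_at_top this] show ?thesis using True by simp
next
  case False
  then have c: "c < 0" using assms by simp
  then have "filterlim (\<lambda>\<eta>. c / \<eta>) at_bot (at_right 0)" by real_asymp
  from filterlim_compose[OF tendsto_arctan_at_bot this] show ?thesis using c by simp
qed

text \<open>Integrating the Poisson kernel over \<open>{a..b}\<close> first leaves a difference of
  arctangents. It is bounded by \<pi>, tends to \<pi> inside the interval and to 0 outside, and the
  two end points are null.\<close>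

lemma poisson_kernel_interval_tendsto:
  fixes h :: "real \<Rightarrow> complex"
  assumes h: "integrable lborel h" and ab: "a \<le> b"
  shows "((\<lambda>\<eta>. LINT s|lborel. h s * of_real (arctan ((b - s) / \<eta>) - arctan ((a - s) / \<eta>)))
      \<longlongrightarrow> of_real pi * (LINT s|lborel. h s * of_real (indicator {a..b} s))) (at_right 0)"
proof -
  have [measurable]: "h \<in> borel_measurable borel" using h by auto
  have [measurable]: "arctan \<in> borel_measurable borel"
    by (intro borel_measurable_continuous_onI continuous_intros)
  have "((\<lambda>\<eta>. LINT s|lborel. h s * of_real (arctan ((b - s) / \<eta>) - arctan ((a - s) / \<eta>)))
      \<longlongrightarrow> (LINT s|lborel. of_real pi * (h s * of_real (indicator {a..b} s)))) (at_right 0)"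
  proof (rule dominated_convergence_within[where bound = "\<lambda>s. cmod (h s) * pi"])
    show "AE s in lborel. cmod (h s * of_real (arctan ((b - s) / \<eta>) - arctan ((a - s) / \<eta>))) \<le> cmod (h s) * pi" for \<eta>
    proof (intro always_eventually allI)
      fix s
      have "\<bar>arctan ((b - s) / \<eta>) - arctan ((a - s) / \<eta>)\<bar> \<le> pi"
        using arctan_ubound[of "(b - s) / \<eta>"] arctan_lbound[of "(b - s) / \<eta>"]
          arctan_ubound[of "(a - s) / \<eta>"] arctan_lbound[of "(a - s) / \<eta>"] by linarith
      then show "cmod (h s * of_real (arctan ((b - s) / \<eta>) - arctan ((a - s) / \<eta>))) \<le> cmod (h s) * pi"
        unfolding norm_mult norm_of_real by (intro mult_left_mono) auto
    qed
    show "AE s in lborel. ((\<lambda>\<eta>. h s * of_real (arctan ((b - s) / \<eta>) - arctan ((a - s) / \<eta>))) \<longlongrightarrow>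
        of_real pi * (h s * of_real (indicator {a..b} s))) (at_right 0)"
      using AE_lborel_singleton[of a] AE_lborel_singleton[of b]
    proof eventually_elim
      case (elim s)
      then have "((\<lambda>\<eta>. h s * of_real (arctan ((b - s) / \<eta>) - arctan ((a - s) / \<eta>))) \<longlongrightarrow>
         h s * of_real (sgn (b - s) * (pi / 2) - sgn (a - s) * (pi / 2))) (at_right 0)"
        by (intro tendsto_intros arctan_scaled_tendsto) auto
      moreover have "sgn (b - s) * (pi / 2) - sgn (a - s) * (pi / 2) = pi * indicator {a..b} s"
        using elim ab by (auto simp: sgn_if indicator_def)
      ultimately show ?case by (simp only: of_real_mult mult.left_commute)
    qed
    show "integrable lborel (\<lambda>s. cmod (h s) * pi)" using h by simp
  qed measurable
  then show ?thesis by simp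
qed

text \<open>The Sokhotski-Plemelj formula. It is tested against indicators of intervals, where the
  Poisson integral can be evaluated on the kernel, so that no pointwise convergence of Poisson
  integrals has to be known.\<close>

theorem cauchy_boundary_jump:
  assumes h: "integrable lborel h" "h \<in> L2" and F: "F \<in> L2" and G: "G \<in> L2"
    and limF: "((\<lambda>\<eta>. normsq (\<lambda>x. cauchy h (Complex x \<eta>) - F x)) \<longlongrightarrow> 0) (at_right 0)"
    and limG: "((\<lambda>\<eta>. normsq (\<lambda>x. cauchy h (Complex x (- \<eta>)) - G x)) \<longlongrightarrow> 0) (at_right 0)"
  shows "AE x in lborel. F x - G x = 2 * of_real pi * \<i> * h x"
proof -
  define d where "d = (\<lambda>x. F x - G x - 2 * of_real pi * \<i> * h x)"
  have d: "d \<in> L2" unfolding d_def by (intro L2_diff L2_scale F G h)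
  have "AE x in lborel. d x = 0"
  proof (rule L2_AE_zero[OF d])
    fix a b :: real
    show "(LINT x|lborel. d x * of_real (indicator {a..b} x)) = 0"
    proof (cases "a \<le> b")
      case True
      define g where "g = (\<lambda>x. complex_of_real (indicator {a..b} x))"
      have g: "g \<in> L2" unfolding g_def by (rule L2_indicator)
      have pos: "\<forall>\<^sub>F \<eta>::real in at_right 0. \<eta> > 0" by (rule eventually_at_right_less)
      have evF: "\<forall>\<^sub>F \<eta> in at_right 0. (\<lambda>x. cauchy h (Complex x \<eta>)) \<in> L2"
        and evG: "\<forall>\<^sub>F \<eta> in at_right 0. (\<lambda>x. cauchy h (Complex x (- \<eta>))) \<in> L2"
        using pos by (eventually_elim, intro cauchy_L2 h, simp)+
      have "((\<lambda>\<eta>. (LINT x|lborel. cauchy h (Complex x \<eta>) * g x) - (LINT x|lborel. cauchy h (Complex x (- \<eta>)) * g x))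
         \<longlongrightarrow> (LINT x|lborel. F x * g x) - (LINT x|lborel. G x * g x)) (at_right 0)"
        by (intro tendsto_diff L2_tendsto_pairing[OF limF evF F g] L2_tendsto_pairing[OF limG evG G g])
      moreover have "((\<lambda>\<eta>. (LINT x|lborel. cauchy h (Complex x \<eta>) * g x) - (LINT x|lborel. cauchy h (Complex x (- \<eta>)) * g x))
         \<longlongrightarrow> 2 * \<i> * (of_real pi * (LINT s|lborel. h s * g s))) (at_right 0)"
      proof (rule Lim_transform_eventually)
        show "((\<lambda>\<eta>. 2 * \<i> * (LINT s|lborel. h s * of_real (arctan ((b - s) / \<eta>) - arctan ((a - s) / \<eta>)))) \<longlongrightarrow>
           2 * \<i> * (of_real pi * (LINT s|lborel. h s * g s))) (at_right 0)"
          unfolding g_def by (intro tendsto_intros poisson_kernel_interval_tendsto h True)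
        show "\<forall>\<^sub>F \<eta> in at_right 0. 2 * \<i> * (LINT s|lborel. h s * of_real (arctan ((b - s) / \<eta>) - arctan ((a - s) / \<eta>))) =
            (LINT x|lborel. cauchy h (Complex x \<eta>) * g x) - (LINT x|lborel. cauchy h (Complex x (- \<eta>)) * g x)"
          using pos
        proof eventually_elim
          case (elim \<eta>)
          have L: "(\<lambda>x. cauchy h (Complex x \<eta>)) \<in> L2" "(\<lambda>x. cauchy h (Complex x (- \<eta>))) \<in> L2"
            using elim by (auto intro!: cauchy_L2 h)
          have inner: "2 * \<i> * of_real (arctan ((b - s) / \<eta>) - arctan ((a - s) / \<eta>)) =
             (LINT x|lborel. g x / (of_real s - Complex x \<eta>)) - (LINT x|lborel. g x / (of_real s - Complex x (- \<eta>)))" for s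
          proof -
            have "(LINT x|lborel. g x / (of_real s - Complex x \<eta>)) - (LINT x|lborel. g x / (of_real s - Complex x (- \<eta>))) =
              (LINT x|lborel. g x * (1 / (of_real s - Complex x \<eta>)) - g x * (1 / (of_real s - Complex x (- \<eta>))))"
              using L2_mult_integrable[OF g kernel_L2(1)[of \<eta> s]] L2_mult_integrable[OF g kernel_L2(1)[of "-\<eta>" s]] elim
              by simp
            also have "\<dots> = (LINT x|lborel. 2 * \<i> * of_real ((\<eta> / ((s - x)\<^sup>2 + \<eta>\<^sup>2)) * indicator {a..b} x))"
              unfolding right_diff_distrib[symmetric] kernel_jump[OF elim] g_def
              by (intro Bochner_Integration.integral_cong refl) (simp add: mult_ac)
            also have "\<dots> = 2 * \<i> * of_real (LINT x|lborel. (\<eta> / ((s - x)\<^sup>2 + \<eta>\<^sup>2)) * indicator {a..b} x)"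
              unfolding integral_mult_right_zero integral_complex_of_real ..
            finally show ?thesis unfolding integral_poisson_kernel_interval[OF elim True] by simp
          qed
          have meas: "complex_of_real (arctan ((b - s) / \<eta>) - arctan ((a - s) / \<eta>)) = 1 / (2 * \<i>) *
             ((LINT x|lborel. g x / (of_real s - Complex x \<eta>)) - (LINT x|lborel. g x / (of_real s - Complex x (- \<eta>))))" for s
            unfolding inner[symmetric] by simp
          have gbd: "cmod (LINT x|lborel. g x / (of_real s - Complex x \<sigma>)) \<le> sqrt (normsq g) * sqrt (pi / \<bar>\<sigma>\<bar>)"
            if "\<sigma> \<noteq> 0" for s \<sigma>
            using L2_Cauchy_Schwarz[OF g kernel_L2(1)[OF that, of s]] kernel_L2(2)[OF that, of s]
            by (simp add: normsq_def)
          have [measurable]: "g \<in> borel_measurable borel" using g by (rule L2_measurable)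
          have gmeas: "(\<lambda>s. LINT x|lborel. g x / (of_real s - Complex x \<sigma>)) \<in> borel_measurable borel" for \<sigma>
            unfolding Complex_eq by measurable
          have int: "integrable lborel (\<lambda>s. h s * (LINT x|lborel. g x / (of_real s - Complex x \<sigma>)))" if "\<sigma> \<noteq> 0" for \<sigma>
            by (rule integrable_mult_bounded[OF h(1) gmeas gbd[OF that]])
          have "(LINT x|lborel. cauchy h (Complex x \<eta>) * g x) - (LINT x|lborel. cauchy h (Complex x (- \<eta>)) * g x) =
             (LINT s|lborel. h s * (LINT x|lborel. g x / (of_real s - Complex x \<eta>)))
             - (LINT s|lborel. h s * (LINT x|lborel. g x / (of_real s - Complex x (- \<eta>))))"
            using cauchy_pairing[OF g h(1), of \<eta>] cauchy_pairing[OF g h(1), of "-\<eta>"] elim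
            by (simp add: mult.commute)
          also have "\<dots> = (LINT s|lborel. h s * (LINT x|lborel. g x / (of_real s - Complex x \<eta>))
             - h s * (LINT x|lborel. g x / (of_real s - Complex x (- \<eta>))))"
            using int[of \<eta>] int[of "-\<eta>"] elim by (intro Bochner_Integration.integral_diff[symmetric]) auto
          also have "\<dots> = (LINT s|lborel. 2 * \<i> * (h s * of_real (arctan ((b - s) / \<eta>) - arctan ((a - s) / \<eta>))))"
            unfolding right_diff_distrib[symmetric] inner[symmetric] by (simp only: mult.left_commute)
          finally show ?case by simp
        qed
      qed
      ultimately have eq: "(LINT x|lborel. F x * g x) - (LINT x|lborel. G x * g x) = 2 * \<i> * (of_real pi * (LINT s|lborel. h s * g s))"
        by (rule tendsto_unique[OF trivial_limit_at_right_real])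
      have "(LINT x|lborel. d x * g x) = (LINT x|lborel. F x * g x - G x * g x - 2 * of_real pi * \<i> * (h x * g x))"
        by (simp add: d_def algebra_simps)
      also have "\<dots> = (LINT x|lborel. F x * g x) - (LINT x|lborel. G x * g x) - 2 * of_real pi * \<i> * (LINT x|lborel. h x * g x)"
        using L2_mult_integrable[OF F g] L2_mult_integrable[OF G g] L2_mult_integrable[OF h(2) g] by simp
      finally show ?thesis using eq by (simp add: g_def mult_ac)
    qed simp
  qed
  then show ?thesis by eventually_elim (simp add: d_def)
qed

text \<open>Where the limit does not exist, \<open>Lim\<close> has the fixed value \<open>THE l. False\<close>.\<close>

lemma Lim_at_right_measurable:
  fixes \<phi> :: "real \<Rightarrow> real \<Rightarrow> complex"
  assumes meas: "\<And>\<eta>. \<eta> > 0 \<Longrightarrow> \<phi> \<eta> \<in> borel_measurable borel"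
    and cont: "\<And>x \<eta>. \<eta> > 0 \<Longrightarrow> isCont (\<lambda>\<eta>. \<phi> \<eta> x) \<eta>"
  shows "(\<lambda>x. Lim (at_right 0) (\<lambda>\<eta>. \<phi> \<eta> x)) \<in> borel_measurable borel"
proof -
  \<comment> \<open>Extended by 0 to be measurable for every real \<eta>, because the rationals in
    the definition of \<open>A\<close> are not restricted by their type to be positive.\<close>
  define \<psi> where "\<psi> = (\<lambda>\<eta> x. if \<eta> > 0 then \<phi> \<eta> x else 0)"
  have [measurable]: "\<psi> \<eta> \<in> borel_measurable borel" for \<eta>
    using meas[of \<eta>] by (cases "\<eta> > 0") (simp_all add: \<psi>_def)
  define r where "r = (\<lambda>n. 1 / real (Suc n))"
  have r: "r n > 0" "r \<longlonglongrightarrow> 0" for n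
    unfolding r_def using LIMSEQ_inverse_real_of_nat by (simp_all add: inverse_eq_divide)
  then have r_right: "filterlim r (at_right 0) sequentially"
    by (intro tendsto_imp_filterlim_at_right) auto
  define l where "l = (\<lambda>x. lim (\<lambda>n. \<psi> (r n) x))"
  have [measurable]: "l \<in> borel_measurable borel" unfolding l_def by measurable
  \<comment> \<open>The set of points of convergence. Continuity in \<eta> makes rational heights
    sufficient, which turns the Cauchy-type condition into countably many measurable ones.\<close>
  define A where "A = {x. \<forall>k. \<exists>m. \<forall>p::rat. real_of_rat p > 0 \<longrightarrow> real_of_rat p < r m \<longrightarrow> dist (\<psi> (real_of_rat p) x) (l x) \<le> r k}"
  have [measurable]: "A \<in> sets borel" unfolding A_def by measurable
  have A_iff: "x \<in> A \<longleftrightarrow> ((\<lambda>\<eta>. \<phi> \<eta> x) \<longlongrightarrow> l x) (at_right 0)" for x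
  proof
    assume x: "x \<in> A"
    show "((\<lambda>\<eta>. \<phi> \<eta> x) \<longlongrightarrow> l x) (at_right 0)"
    proof (rule tendstoI)
      fix e :: real assume "e > 0"
      then obtain k where k: "r k < e"
        using reals_Archimedean[of e] by (auto simp: r_def inverse_eq_divide)
      obtain m where m: "\<And>p::rat. real_of_rat p > 0 \<Longrightarrow> real_of_rat p < r m \<Longrightarrow> dist (\<psi> (real_of_rat p) x) (l x) \<le> r k"
        using x[unfolded A_def mem_Collect_eq, THEN spec, of k] by blast
      have "dist (\<phi> \<eta> x) (l x) \<le> r k" if \<eta>: "0 < \<eta>" "\<eta> < r m" for \<eta>
      proof (rule ccontr)
        assume "\<not> ?thesis"
        moreover have "((\<lambda>y. dist (\<phi> y x) (l x)) \<longlongrightarrow> dist (\<phi> \<eta> x) (l x)) (at \<eta>)"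
          using cont[OF \<eta>(1), of x] by (intro tendsto_intros) (simp add: isCont_def)
        ultimately have "\<forall>\<^sub>F y in at \<eta>. r k < dist (\<phi> y x) (l x)"
          by (intro order_tendstoD(1)[where y = "dist (\<phi> \<eta> x) (l x)"]) auto
        then obtain d where d: "d > 0" "\<And>y. y \<noteq> \<eta> \<Longrightarrow> dist y \<eta> < d \<Longrightarrow> r k < dist (\<phi> y x) (l x)"
          unfolding eventually_at by auto
        have "\<eta> < min (\<eta> + d) (r m)" using d \<eta> by simp
        then obtain q where q: "\<eta> < real_of_rat q" "real_of_rat q < min (\<eta> + d) (r m)"
          using of_rat_dense by blast
        then have "r k < dist (\<phi> (real_of_rat q) x) (l x)"
          by (intro d(2)) (auto simp: dist_real_def)
        moreover have pos: "real_of_rat q > 0" using q \<eta> by linarith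
        moreover have "dist (\<psi> (real_of_rat q) x) (l x) \<le> r k"
          by (rule m[OF pos]) (use q in linarith)
        ultimately show False by (simp add: \<psi>_def)
      qed
      moreover have "\<forall>\<^sub>F \<eta> in at_right 0. 0 < \<eta> \<and> \<eta> < r m"
        by (rule eventually_between_at_right[OF r(1)])
      ultimately show "\<forall>\<^sub>F \<eta> in at_right 0. dist (\<phi> \<eta> x) (l x) < e"
        using k by (auto elim!: eventually_mono intro: le_less_trans)
    qed
  next
    assume lim: "((\<lambda>\<eta>. \<phi> \<eta> x) \<longlongrightarrow> l x) (at_right 0)"
    show "x \<in> A"
      unfolding A_def
    proof (intro CollectI allI)
      fix k
      have "\<forall>\<^sub>F \<eta> in at_right 0. dist (\<phi> \<eta> x) (l x) < r k"
        by (rule tendstoD[OF lim r(1)])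
      then obtain b where b: "b > 0" "\<And>\<eta>. 0 < \<eta> \<Longrightarrow> \<eta> < b \<Longrightarrow> dist (\<phi> \<eta> x) (l x) < r k"
        unfolding eventually_at_right_field by blast
      obtain m where "r m < b"
        using reals_Archimedean[OF b(1)] by (auto simp: r_def inverse_eq_divide)
      then show "\<exists>m. \<forall>p::rat. real_of_rat p > 0 \<longrightarrow> real_of_rat p < r m \<longrightarrow> dist (\<psi> (real_of_rat p) x) (l x) \<le> r k"
        using b(2) by (intro exI[of _ m]) (auto simp: \<psi>_def intro!: less_imp_le)
    qed
  qed
  have lim_l: "L = l x" if "((\<lambda>\<eta>. \<phi> \<eta> x) \<longlongrightarrow> L) (at_right 0)" for x L
  proof -
    have "(\<lambda>n. \<phi> (r n) x) \<longlonglongrightarrow> L" by (rule filterlim_compose[OF that r_right])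
    then have "(\<lambda>n. \<psi> (r n) x) \<longlonglongrightarrow> L" using r(1) by (simp add: \<psi>_def)
    then show ?thesis by (simp add: l_def limI)
  qed
  have "(\<lambda>x. Lim (at_right 0) (\<lambda>\<eta>. \<phi> \<eta> x)) = (\<lambda>x. if x \<in> A then l x else (THE L. False))"
  proof
    fix x
    show "Lim (at_right 0) (\<lambda>\<eta>. \<phi> \<eta> x) = (if x \<in> A then l x else (THE L. False))"
    proof (cases "x \<in> A")
      case True
      then show ?thesis using A_iff by (simp add: tendsto_Lim)
    next
      case False
      then have "\<not> ((\<lambda>\<eta>. \<phi> \<eta> x) \<longlongrightarrow> L) (at_right 0)" for L using lim_l A_iff by metis
      then show ?thesis using False by (simp add: t2_space_class.Lim_def)
    qed
  qed
  also have "\<dots> \<in> borel_measurable borel" by measurable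
  finally show ?thesis .
qed

text \<open>Unlike \<open>sgn\<close> it is never 0: at 0 it picks the lower side, in accordance
  with \<open>side\<close>.\<close>

definition side_sign :: "real \<Rightarrow> real" where
  "side_sign s = (if s > 0 then 1 else -1)"

lemma tendsto_side_iff:
  "(f \<longlongrightarrow> l) (side s) \<longleftrightarrow> ((\<lambda>\<eta>. f (side_sign s * \<eta>)) \<longlongrightarrow> l) (at_right 0)"
  by (simp add: side_def side_sign_def filterlim_at_left_to_right)

text \<open>Valid without any convergence, since \<open>Lim\<close> is a definite description and
  both sides describe the same limits.\<close>

lemma Lim_side:
  fixes f :: "real \<Rightarrow> complex"
  shows "Lim (side s) f = Lim (at_right 0) (\<lambda>\<eta>. f (side_sign s * \<eta>))"
  unfolding t2_space_class.Lim_def by (intro arg_cong[where f = The] ext tendsto_side_iff)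

lemma S_hat_eq: "S_hat s h l = Lim (at_right 0) (\<lambda>\<eta>. cauchy h (Complex l (side_sign s * \<eta>)))"
  unfolding S_hat_def Lim_side by (simp add: cauchy_def Complex_eq)

text \<open>\<open>S_hat\<close> is one specific function, including its default value on the null
  set without a limit, so its measurability has to be established before it can enter an
  integral.\<close>

lemma S_hat_measurable:
  assumes h: "integrable lborel h"
  shows "S_hat s h \<in> borel_measurable borel"
proof -
  have [measurable]: "h \<in> borel_measurable borel" using h by auto
  have "(\<lambda>x. Lim (at_right 0) (\<lambda>\<eta>. cauchy h (Complex x (side_sign s * \<eta>)))) \<in> borel_measurable borel"
  proof (rule Lim_at_right_measurable)
    show "(\<lambda>x. cauchy h (Complex x (side_sign s * \<eta>))) \<in> borel_measurable borel" for \<eta>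
      by measurable
    fix x \<eta> :: real assume \<eta>: "\<eta> > 0"
    have "isCont (\<lambda>\<eta>. Complex x (side_sign s * \<eta>)) \<eta>"
      unfolding Complex_eq by (intro continuous_intros)
    moreover have "isCont (cauchy h) (Complex x (side_sign s * \<eta>))"
      using \<eta> by (intro cauchy_isCont h) (simp add: side_sign_def)
    ultimately show "isCont (\<lambda>\<eta>. cauchy h (Complex x (side_sign s * \<eta>))) \<eta>"
      by (rule isCont_o2)
  qed
  then show ?thesis by (simp add: S_hat_eq[abs_def])
qed

lemma normsq_cong_AE:
  assumes "f \<in> borel_measurable borel" "g \<in> borel_measurable borel" "AE x in lborel. f x = g x"
  shows "normsq f = normsq g"
  unfolding normsq_def using assms by (intro integral_cong_AE) auto

lemma L2_cong_AE:
  assumes f: "f \<in> L2" and g: "g \<in> borel_measurable borel" and eq: "AE x in lborel. f x = g x"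
  shows "g \<in> L2"
proof -
  have "integrable lborel (\<lambda>x. (cmod (f x))\<^sup>2) \<longleftrightarrow> integrable lborel (\<lambda>x. (cmod (g x))\<^sup>2)"
    using L2_measurable[OF f] g eq by (intro integrable_cong_AE) auto
  then show ?thesis using L2_integrable[OF f] g by (simp add: L2_def)
qed

lemma cauchy_boundary_value_side:
  assumes h: "integrable lborel h" "h \<in> L2"
  obtains F where "F \<in> L2"
    "((\<lambda>\<eta>. normsq (\<lambda>x. cauchy h (Complex x (side_sign s * \<eta>)) - F x)) \<longlongrightarrow> 0) (at_right 0)"
    "AE x in lborel. ((\<lambda>\<eta>. cauchy h (Complex x (side_sign s * \<eta>))) \<longlongrightarrow> F x) (at_right 0)"
proof (cases "s > 0")
  case True
  obtain F where F: "F \<in> L2" "((\<lambda>\<eta>. normsq (\<lambda>x. cauchy h (Complex x \<eta>) - F x)) \<longlongrightarrow> 0) (at_right 0)"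
    by (rule cauchy_boundary_value_L2[OF h])
  show thesis
    using True F cauchy_boundary_value_AE[OF h(1) F] by (intro that[of F]) (simp_all add: side_sign_def)
next
  case False
  have h': "integrable lborel (\<lambda>t. cnj (h t))" "(\<lambda>t. cnj (h t)) \<in> L2"
    using h L2_cnj by auto
  obtain F where F: "F \<in> L2" "((\<lambda>\<eta>. normsq (\<lambda>x. cauchy (\<lambda>t. cnj (h t)) (Complex x \<eta>) - F x)) \<longlongrightarrow> 0) (at_right 0)"
    by (rule cauchy_boundary_value_L2[OF h'])
  have conj: "cauchy h (Complex x (- \<eta>)) = cnj (cauchy (\<lambda>t. cnj (h t)) (Complex x \<eta>))" for x \<eta>
    using cnj_cauchy[of "\<lambda>t. cnj (h t)"] by simp
  have "normsq (\<lambda>x. cauchy h (Complex x (- \<eta>)) - cnj (F x)) = normsq (\<lambda>x. cauchy (\<lambda>t. cnj (h t)) (Complex x \<eta>) - F x)" for \<eta>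
    unfolding normsq_def conj complex_cnj_diff[symmetric] complex_mod_cnj ..
  moreover have "AE x in lborel. ((\<lambda>\<eta>. cauchy h (Complex x (- \<eta>))) \<longlongrightarrow> cnj (F x)) (at_right 0)"
    using cauchy_boundary_value_AE[OF h'(1) F] unfolding conj
    by eventually_elim (rule tendsto_cnj)
  ultimately show thesis
    using False F L2_cnj[OF F(1)] by (intro that[of "\<lambda>x. cnj (F x)"]) (simp_all add: side_sign_def)
qed

text \<open>The abstract limit in \<open>L2\<close> and the pointwise limit agree almost everywhere,
  so both kinds of convergence become available for the single function
  \<open>S_hat s h\<close>.\<close>

theorem S_hat_boundary_value:
  assumes h: "integrable lborel h" "h \<in> L2"
  shows "S_hat s h \<in> L2"
    "((\<lambda>\<eta>. normsq (\<lambda>x. cauchy h (Complex x (side_sign s * \<eta>)) - S_hat s h x)) \<longlongrightarrow> 0) (at_right 0)"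
    "AE x in lborel. ((\<lambda>\<eta>. cauchy h (Complex x (side_sign s * \<eta>))) \<longlongrightarrow> S_hat s h x) (at_right 0)"
proof -
  obtain F where F: "F \<in> L2"
    "((\<lambda>\<eta>. normsq (\<lambda>x. cauchy h (Complex x (side_sign s * \<eta>)) - F x)) \<longlongrightarrow> 0) (at_right 0)"
    "AE x in lborel. ((\<lambda>\<eta>. cauchy h (Complex x (side_sign s * \<eta>))) \<longlongrightarrow> F x) (at_right 0)"
    by (rule cauchy_boundary_value_side[OF h])
  have eq: "AE x in lborel. F x = S_hat s h x"
    using F(3) by eventually_elim (simp add: S_hat_eq tendsto_Lim)
  have m: "S_hat s h \<in> borel_measurable borel" by (rule S_hat_measurable[OF h(1)])
  show "S_hat s h \<in> L2" by (rule L2_cong_AE[OF F(1) m eq])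
  have [measurable]: "F \<in> borel_measurable borel" "h \<in> borel_measurable borel" "S_hat s h \<in> borel_measurable borel"
    using F(1) h(2) m by (auto intro: L2_measurable)
  have "normsq (\<lambda>x. cauchy h (Complex x (side_sign s * \<eta>)) - F x) =
      normsq (\<lambda>x. cauchy h (Complex x (side_sign s * \<eta>)) - S_hat s h x)" for \<eta>
    by (rule normsq_cong_AE) (measurable, use eq in \<open>eventually_elim, simp\<close>)
  then show "((\<lambda>\<eta>. normsq (\<lambda>x. cauchy h (Complex x (side_sign s * \<eta>)) - S_hat s h x)) \<longlongrightarrow> 0) (at_right 0)"
    using F(2) by simp
  show "AE x in lborel. ((\<lambda>\<eta>. cauchy h (Complex x (side_sign s * \<eta>))) \<longlongrightarrow> S_hat s h x) (at_right 0)"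
    using F(3) eq by eventually_elim simp
qed

theorem S_hat_jump:
  assumes h: "integrable lborel h" "h \<in> L2"
  shows "AE x in lborel. S_hat 1 h x - S_hat (-1) h x = 2 * of_real pi * \<i> * h x"
  using S_hat_boundary_value[OF h, of 1] S_hat_boundary_value[OF h, of "-1"]
  by (intro cauchy_boundary_jump h) (simp_all add: side_sign_def)

lemma S_hat_cnj:
  assumes h: "integrable lborel h" "h \<in> L2" and s: "s \<noteq> 0"
  shows "AE x in lborel. cnj (S_hat s h x) = S_hat (- s) (\<lambda>t. cnj (h t)) x"
  using S_hat_boundary_value(3)[OF h, of s]
proof eventually_elim
  case (elim x)
  then have "((\<lambda>\<eta>. cnj (cauchy h (Complex x (side_sign s * \<eta>)))) \<longlongrightarrow> cnj (S_hat s h x)) (at_right 0)"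
    by (rule tendsto_cnj)
  moreover have "cnj (cauchy h (Complex x (side_sign s * \<eta>))) =
      cauchy (\<lambda>t. cnj (h t)) (Complex x (side_sign (- s) * \<eta>))" for \<eta>
    unfolding cnj_cauchy using s by (simp add: side_sign_def)
  ultimately show ?case by (simp add: S_hat_eq tendsto_Lim)
qed

text \<open>The factors \<open>u\<close> and \<open>v\<close> converge in norm, while
  \<open>r\<close> is merely bounded and converges pointwise. The product is therefore expanded
  around \<open>f\<close> and \<open>g\<close>: the three terms with a difference vanish by
  Cauchy-Schwarz and the bound \<open>B\<close>, and dominated convergence is applied only to
  \<open>r * f * g\<close>, whose last two factors are fixed.\<close>

lemma L2_triple_product_tendsto:
  fixes u v r :: "real \<Rightarrow> real \<Rightarrow> complex"
  assumes U: "((\<lambda>\<eta>. normsq (\<lambda>x. u \<eta> x - f x)) \<longlongrightarrow> 0) (at_right 0)" and u: "\<And>\<eta>. \<eta> > 0 \<Longrightarrow> u \<eta> \<in> L2" and f: "f \<in> L2"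
    and V: "((\<lambda>\<eta>. normsq (\<lambda>x. v \<eta> x - g x)) \<longlongrightarrow> 0) (at_right 0)" and v: "\<And>\<eta>. \<eta> > 0 \<Longrightarrow> v \<eta> \<in> L2" and g: "g \<in> L2"
    and r: "\<And>\<eta>. \<eta> > 0 \<Longrightarrow> r \<eta> \<in> borel_measurable borel" and \<eta>0: "\<eta>0 > 0"
    and B: "\<And>\<eta> x. 0 < \<eta> \<Longrightarrow> \<eta> < \<eta>0 \<Longrightarrow> cmod (r \<eta> x) \<le> B"
    and q: "q \<in> borel_measurable borel"
    and lim: "AE x in lborel. ((\<lambda>\<eta>. r \<eta> x) \<longlongrightarrow> q x) (at_right 0)"
  shows "((\<lambda>\<eta>. LINT x|lborel. r \<eta> x * u \<eta> x * v \<eta> x) \<longlongrightarrow> (LINT x|lborel. q x * f x * g x)) (at_right 0)"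
proof -
  have [measurable]: "f \<in> borel_measurable borel" "g \<in> borel_measurable borel" using f g by (auto intro: L2_measurable)
  have near: "\<forall>\<^sub>F \<eta> in at_right 0. 0 < \<eta> \<and> \<eta> < \<eta>0"
    by (rule eventually_between_at_right[OF \<eta>0])
  have int: "integrable lborel (\<lambda>x. r \<eta> x * a x * b x)" if "0 < \<eta>" "\<eta> < \<eta>0" "a \<in> L2" "b \<in> L2" for \<eta> a b
    using that by (intro L2_mult_integrable L2_mult_bounded[OF _ r B]) auto
  have bound: "cmod (LINT x|lborel. r \<eta> x * a x * b x) \<le> B * sqrt (normsq a) * sqrt (normsq b)"
    if "0 < \<eta>" "\<eta> < \<eta>0" "a \<in> L2" "b \<in> L2" for \<eta> a b
  proof -
    have B0: "B \<ge> 0" using B[of \<eta> 0] that norm_ge_zero order_trans by blast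
    have ra: "(\<lambda>x. r \<eta> x * a x) \<in> L2" using that by (intro L2_mult_bounded[OF _ r B]) auto
    have "normsq (\<lambda>x. r \<eta> x * a x) \<le> (LINT x|lborel. B\<^sup>2 * (cmod (a x))\<^sup>2)"
      unfolding normsq_def using L2_integrable[OF ra] L2_integrable[OF that(3)] B that
      by (intro integral_mono) (auto simp: norm_mult power_mult_distrib intro!: mult_right_mono power_mono)
    then have "normsq (\<lambda>x. r \<eta> x * a x) \<le> B\<^sup>2 * normsq a" by (simp add: normsq_def)
    then have "sqrt (normsq (\<lambda>x. r \<eta> x * a x)) \<le> sqrt (B\<^sup>2 * normsq a)" by (rule real_sqrt_le_mono)
    then have le: "sqrt (normsq (\<lambda>x. r \<eta> x * a x)) \<le> B * sqrt (normsq a)" using B0 by (simp add: real_sqrt_mult)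
    show ?thesis
      using L2_Cauchy_Schwarz[OF ra that(4)] mult_right_mono[OF le, of "sqrt (normsq b)"] normsq_nonneg[of b] by simp
  qed
  have "((\<lambda>\<eta>. LINT x|lborel. r \<eta> x * (u \<eta> x - f x) * (v \<eta> x - g x)) \<longlongrightarrow> 0) (at_right 0)"
  proof (rule Lim_null_comparison)
    show "\<forall>\<^sub>F \<eta> in at_right 0. norm (LINT x|lborel. r \<eta> x * (u \<eta> x - f x) * (v \<eta> x - g x)) \<le>
        B * sqrt (normsq (\<lambda>x. u \<eta> x - f x)) * sqrt (normsq (\<lambda>x. v \<eta> x - g x))"
      using near by eventually_elim (intro bound L2_diff u v f g, auto)
    have "((\<lambda>\<eta>. B * sqrt (normsq (\<lambda>x. u \<eta> x - f x)) * sqrt (normsq (\<lambda>x. v \<eta> x - g x))) \<longlongrightarrow> B * sqrt 0 * sqrt 0) (at_right 0)"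
      by (intro tendsto_intros U V)
    then show "((\<lambda>\<eta>. B * sqrt (normsq (\<lambda>x. u \<eta> x - f x)) * sqrt (normsq (\<lambda>x. v \<eta> x - g x))) \<longlongrightarrow> 0) (at_right 0)" by simp
  qed
  moreover have "((\<lambda>\<eta>. LINT x|lborel. r \<eta> x * (u \<eta> x - f x) * g x) \<longlongrightarrow> 0) (at_right 0)"
  proof (rule Lim_null_comparison)
    show "\<forall>\<^sub>F \<eta> in at_right 0. norm (LINT x|lborel. r \<eta> x * (u \<eta> x - f x) * g x) \<le>
        B * sqrt (normsq (\<lambda>x. u \<eta> x - f x)) * sqrt (normsq g)"
      using near by eventually_elim (intro bound L2_diff u f g, auto)
    have "((\<lambda>\<eta>. B * sqrt (normsq (\<lambda>x. u \<eta> x - f x)) * sqrt (normsq g)) \<longlongrightarrow> B * sqrt 0 * sqrt (normsq g)) (at_right 0)"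
      by (intro tendsto_intros U)
    then show "((\<lambda>\<eta>. B * sqrt (normsq (\<lambda>x. u \<eta> x - f x)) * sqrt (normsq g)) \<longlongrightarrow> 0) (at_right 0)" by simp
  qed
  moreover have "((\<lambda>\<eta>. LINT x|lborel. r \<eta> x * f x * (v \<eta> x - g x)) \<longlongrightarrow> 0) (at_right 0)"
  proof (rule Lim_null_comparison)
    show "\<forall>\<^sub>F \<eta> in at_right 0. norm (LINT x|lborel. r \<eta> x * f x * (v \<eta> x - g x)) \<le>
        B * sqrt (normsq f) * sqrt (normsq (\<lambda>x. v \<eta> x - g x))"
      using near by eventually_elim (intro bound L2_diff v f g, auto)
    have "((\<lambda>\<eta>. B * sqrt (normsq f) * sqrt (normsq (\<lambda>x. v \<eta> x - g x))) \<longlongrightarrow> B * sqrt (normsq f) * sqrt 0) (at_right 0)"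
      by (intro tendsto_intros V)
    then show "((\<lambda>\<eta>. B * sqrt (normsq f) * sqrt (normsq (\<lambda>x. v \<eta> x - g x))) \<longlongrightarrow> 0) (at_right 0)" by simp
  qed
  moreover have "((\<lambda>\<eta>. LINT x|lborel. r \<eta> x * f x * g x) \<longlongrightarrow> (LINT x|lborel. q x * f x * g x)) (at_right 0)"
  proof -
    have "((\<lambda>\<eta>. LINT x|lborel. r \<eta> x * f x * g x) \<longlongrightarrow> (LINT x|lborel. q x * f x * g x)) (at 0 within {0<..<\<eta>0})"
    proof (rule dominated_convergence_within[where bound = "\<lambda>x. B * cmod (f x * g x)"])
      show "(\<lambda>x. r \<eta> x * f x * g x) \<in> borel_measurable lborel" if "\<eta> \<in> {0<..<\<eta>0}" for \<eta>
        using r[of \<eta>] that by simp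
      show "AE x in lborel. cmod (r \<eta> x * f x * g x) \<le> B * cmod (f x * g x)" if "\<eta> \<in> {0<..<\<eta>0}" for \<eta>
        using B[of \<eta>] that by (auto simp: norm_mult mult.assoc intro!: mult_right_mono)
      show "AE x in lborel. ((\<lambda>\<eta>. r \<eta> x * f x * g x) \<longlongrightarrow> q x * f x * g x) (at 0 within {0<..<\<eta>0})"
        using lim
      proof eventually_elim
        case (elim x)
        have "((\<lambda>\<eta>. r \<eta> x) \<longlongrightarrow> q x) (at 0 within {0<..<\<eta>0})"
          by (rule tendsto_within_subset[OF elim]) auto
        then show ?case by (intro tendsto_intros)
      qed
    qed (use q L2_mult_integrable[OF f g] in \<open>auto intro!: integrable_mult_right integrable_norm\<close>)
    moreover have "at 0 within {0<..<\<eta>0} = at_right 0"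
      using \<eta>0 by (intro at_within_nhd[of _ "{..<\<eta>0}"]) auto
    ultimately show ?thesis by simp
  qed
  ultimately have "((\<lambda>\<eta>. (LINT x|lborel. r \<eta> x * (u \<eta> x - f x) * (v \<eta> x - g x)) + (LINT x|lborel. r \<eta> x * (u \<eta> x - f x) * g x)
     + (LINT x|lborel. r \<eta> x * f x * (v \<eta> x - g x)) + (LINT x|lborel. r \<eta> x * f x * g x))
      \<longlongrightarrow> 0 + 0 + 0 + (LINT x|lborel. q x * f x * g x)) (at_right 0)"
    by (intro tendsto_add)
  then have "((\<lambda>\<eta>. (LINT x|lborel. r \<eta> x * (u \<eta> x - f x) * (v \<eta> x - g x)) + (LINT x|lborel. r \<eta> x * (u \<eta> x - f x) * g x)
     + (LINT x|lborel. r \<eta> x * f x * (v \<eta> x - g x)) + (LINT x|lborel. r \<eta> x * f x * g x))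
      \<longlongrightarrow> (LINT x|lborel. q x * f x * g x)) (at_right 0)"
    by simp
  then show ?thesis
  proof (rule Lim_transform_eventually)
    show "\<forall>\<^sub>F \<eta> in at_right 0. (LINT x|lborel. r \<eta> x * (u \<eta> x - f x) * (v \<eta> x - g x)) + (LINT x|lborel. r \<eta> x * (u \<eta> x - f x) * g x)
     + (LINT x|lborel. r \<eta> x * f x * (v \<eta> x - g x)) + (LINT x|lborel. r \<eta> x * f x * g x) = (LINT x|lborel. r \<eta> x * u \<eta> x * v \<eta> x)"
      using near
    proof eventually_elim
      case (elim \<eta>)
      have "(LINT x|lborel. r \<eta> x * u \<eta> x * v \<eta> x) = (LINT x|lborel. r \<eta> x * (u \<eta> x - f x) * (v \<eta> x - g x)
         + r \<eta> x * (u \<eta> x - f x) * g x + r \<eta> x * f x * (v \<eta> x - g x) + r \<eta> x * f x * g x)"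
        by (intro Bochner_Integration.integral_cong refl) (simp add: algebra_simps)
      then show ?case
        using int[of \<eta>, OF _ _ L2_diff[OF u f] L2_diff[OF v g]] int[of \<eta>, OF _ _ L2_diff[OF u f] g]
          int[of \<eta>, OF _ _ f L2_diff[OF v g]] int[of \<eta>, OF _ _ f g] elim
        by simp
    qed
  qed
qed

section \<open>The Cauchy transform of the Gaussian\<close>

lemma w_eq_normal_density: "w v = normal_density 0 (1 / sqrt 2) v"
  by (simp add: w_def normal_density_def power_divide)

lemma w_integrable: "integrable lborel w" and w_integral: "(LINT v|lborel. w v) = 1"
  unfolding w_eq_normal_density[abs_def] by simp_all

lemma w_moment_integrable: "integrable lborel (\<lambda>v. w v * v ^ k)"
  unfolding w_eq_normal_density using integrable_normal_moment[of "1 / sqrt 2" 0 k] by simp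

lemma w_pos: "w v > 0"
  by (simp add: w_def)

lemma sqrt_pi_ge_1: "sqrt pi \<ge> 1"
  using pi_ge_two by simp

lemma w_le_1: "w v \<le> 1"
proof -
  have "exp (- v\<^sup>2) \<le> 1" by simp
  then have "exp (- v\<^sup>2) \<le> sqrt pi" using sqrt_pi_ge_1 by linarith
  then show ?thesis by (simp add: w_def divide_le_eq_1)
qed

lemma w_even: "w (- v) = w v"
  by (simp add: w_def)

lemma w_has_derivative: "(w has_real_derivative (- 2 * v * w v)) (at v)"
proof -
  have "((\<lambda>v. exp (- v\<^sup>2)) has_real_derivative (exp (- v\<^sup>2) * (- 2 * v))) (at v)"
    by (auto intro!: derivative_eq_intros)
  from DERIV_cdivide[OF this, of "sqrt pi"] show ?thesis
    by (simp add: w_def[abs_def] mult_ac)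
qed

lemma w_continuous: "continuous_on A w"
  unfolding w_def[abs_def] by (intro continuous_intros) simp

lemma w_measurable [measurable]: "w \<in> borel_measurable borel"
  by (intro borel_measurable_continuous_onI w_continuous)

abbreviation wc :: "real \<Rightarrow> complex" where
  "wc v \<equiv> complex_of_real (w v)"

lemma wc_integrable: "integrable lborel wc"
  using w_integrable by simp

lemma wc_L2: "wc \<in> L2"
proof -
  have "integrable lborel (\<lambda>x. (cmod (wc x))\<^sup>2)"
  proof (rule Bochner_Integration.integrable_bound[OF w_integrable])
    have "w x * w x \<le> 1 * w x" for x
      using w_pos[of x] w_le_1[of x] by (intro mult_right_mono) auto
    then show "AE x in lborel. norm ((cmod (wc x))\<^sup>2) \<le> norm (w x)"
      using w_pos by (simp add: power2_eq_square abs_of_pos)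
  qed measurable
  then show ?thesis by (simp add: L2_def)
qed

lemma integral_derivative_eq_0:
  fixes F f :: "real \<Rightarrow> complex"
  assumes deriv: "\<And>x. (F has_vector_derivative f x) (at x)" and cont: "continuous_on UNIV f"
    and int: "integrable lborel f"
    and lims: "(\<lambda>n. F (real n)) \<longlonglongrightarrow> 0" "(\<lambda>n. F (- real n)) \<longlonglongrightarrow> 0"
  shows "(LINT x|lborel. f x) = 0"
proof (rule LIMSEQ_unique[OF tendsto_integral_symmetric_interval[OF int]])
  have "(LINT x|lborel. indicator {-real n..real n} x *\<^sub>R f x) = F (real n) - F (- real n)" for n
    by (rule integral_FTC_Icc)
      (auto intro: has_vector_derivative_at_within deriv continuous_on_subset[OF cont])
  moreover have "(\<lambda>n. F (real n) - F (- real n)) \<longlonglongrightarrow> 0 - 0"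
    by (intro tendsto_diff lims)
  ultimately show "(\<lambda>n. LINT x|lborel. indicator {-real n..real n} x *\<^sub>R f x) \<longlonglongrightarrow> 0" by simp
qed

text \<open>From \<open>v / (v - z) = 1 + z / (v - z)\<close> and the total mass 1 of
  \<open>w\<close>. It closes the differential equation of the transform and later converts a bound
  for the first moment into decay.\<close>

lemma moment_cauchy:
  assumes z: "Im z \<noteq> 0"
  shows "cauchy (\<lambda>v. of_real (v * w v)) z = 1 + z * cauchy wc z"
proof -
  have "cauchy (\<lambda>v. of_real (v * w v)) z = (LINT v|lborel. wc v + z * (wc v / (of_real v - z)))"
    unfolding cauchy_def
  proof (intro Bochner_Integration.integral_cong refl)
    fix v show "of_real (v * w v) / (of_real v - z) = wc v + z * (wc v / (of_real v - z))"
      using kernel_nonzero[OF z, of v] by (simp add: field_simps)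
  qed
  also have "\<dots> = (LINT v|lborel. wc v) + (LINT v|lborel. z * (wc v / (of_real v - z)))"
    by (intro Bochner_Integration.integral_add wc_integrable integrable_mult_right cauchy_integrable z)
  also have "(LINT v|lborel. z * (wc v / (of_real v - z))) = z * cauchy wc z"
    unfolding cauchy_def by (rule integral_mult_right_zero)
  finally show ?thesis by (simp add: w_integral)
qed

lemma moment_integrable: "integrable lborel (\<lambda>v. complex_of_real (v * w v))"
  using w_moment_integrable[of 1] by (simp add: mult.commute del: of_real_mult)

lemma square_kernel_bound:
  assumes z: "Im z \<noteq> 0"
  shows "cmod (1 / (of_real v - z)\<^sup>2) \<le> 1 / (Im z)\<^sup>2"
proof -
  have "\<bar>Im z\<bar>\<^sup>2 \<le> (cmod (of_real v - z))\<^sup>2" by (intro power_mono cmod_kernel_ge) auto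
  then show ?thesis using z by (simp add: norm_divide norm_power frac_le)
qed

text \<open>Integration by parts: \<open>w' = - 2 v w\<close> turns the integral of
  \<open>w / (v - z)\<^sup>2\<close> into -2 times the transform of \<open>v w\<close>, which the
  previous identity expresses by the transform of \<open>w\<close> itself.\<close>

lemma cauchy_w_derivative:
  assumes z: "Im z \<noteq> 0"
  shows "(cauchy wc has_field_derivative (- 2 - 2 * z * cauchy wc z)) (at z)"
proof -
  define F where "F = (\<lambda>v. wc v / (of_real v - z))"
  define f where "f = (\<lambda>v. - 2 * (of_real (v * w v) / (of_real v - z)) - wc v / (of_real v - z)\<^sup>2)"
  have nz: "of_real v - z \<noteq> 0" for v using kernel_nonzero[OF z] by simp
  have int2: "integrable lborel (\<lambda>v. wc v / (of_real v - z)\<^sup>2)"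
    using integrable_mult_bounded[OF wc_integrable _ square_kernel_bound[OF z]] by simp
  have int1: "integrable lborel (\<lambda>v. of_real (v * w v) / (of_real v - z))"
    by (rule cauchy_integrable[OF moment_integrable z])
  have "(LINT v|lborel. f v) = 0"
  proof (rule integral_derivative_eq_0)
    fix v
    have 1: "((\<lambda>v. wc v) has_vector_derivative of_real (- 2 * v * w v)) (at v)"
      by (intro has_vector_derivative_of_real has_real_derivative_iff_has_vector_derivative[THEN iffD1] w_has_derivative)
    have 2: "((\<lambda>v. 1 / (of_real v - z)) has_vector_derivative (- 1 / (of_real v - z)\<^sup>2)) (at v)"
    proof -
      have "((\<lambda>u. 1 / (u - z)) has_field_derivative (- 1 / (of_real v - z)\<^sup>2)) (at (of_real v))"
        using nz[of v] by (auto intro!: derivative_eq_intros simp: power2_eq_square)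
      then show ?thesis by (rule has_vector_derivative_real_field)
    qed
    have "((\<lambda>v. wc v * (1 / (of_real v - z))) has_vector_derivative
       (wc v * (- 1 / (of_real v - z)\<^sup>2) + of_real (- 2 * v * w v) * (1 / (of_real v - z)))) (at v)"
      by (rule has_vector_derivative_mult[OF 1 2])
    moreover have "wc v * (- 1 / (of_real v - z)\<^sup>2) + of_real (- 2 * v * w v) * (1 / (of_real v - z)) = f v"
      by (simp add: f_def algebra_simps)
    ultimately show "(F has_vector_derivative f v) (at v)"
      by (simp add: F_def)
  next
    show "continuous_on UNIV f"
      unfolding f_def using nz
      by (intro continuous_intros w_continuous) auto
    show "integrable lborel f"
      unfolding f_def using int1 int2 by (intro Bochner_Integration.integrable_diff integrable_mult_right)
    have bd: "norm (F v) \<le> w v / \<bar>Im z\<bar>" for v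
      using cmod_kernel_ge[of z v] nz[of v] z w_pos[of v]
      by (simp add: F_def norm_divide divide_left_mono)
    have "(\<lambda>n. w (real n) / \<bar>Im z\<bar>) \<longlonglongrightarrow> 0 / \<bar>Im z\<bar>"
    proof (intro tendsto_divide tendsto_const)
      show "(\<lambda>n. w (real n)) \<longlonglongrightarrow> 0" unfolding w_def by real_asymp
    qed (use z in simp)
    then have *: "(\<lambda>n. w (real n) / \<bar>Im z\<bar>) \<longlonglongrightarrow> 0" by simp
    show "(\<lambda>n. F (real n)) \<longlonglongrightarrow> 0"
      by (rule Lim_null_comparison[OF _ *]) (use bd in simp)
    show "(\<lambda>n. F (- real n)) \<longlonglongrightarrow> 0"
      by (rule Lim_null_comparison[OF _ *]) (use bd w_even in \<open>metis (mono_tags, lifting) always_eventually\<close>)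
  qed
  moreover have "(LINT v|lborel. f v) = - 2 * cauchy (\<lambda>v. of_real (v * w v)) z - (LINT v|lborel. wc v / (of_real v - z)\<^sup>2)"
    by (simp only: f_def cauchy_def Bochner_Integration.integral_diff[OF integrable_mult_right[OF int1] int2]
        integral_mult_right_zero)
  ultimately have "(LINT v|lborel. wc v / (of_real v - z)\<^sup>2) = - 2 - 2 * z * cauchy wc z"
    using moment_cauchy[OF z] by (simp add: algebra_simps)
  then show ?thesis
    using cauchy_has_field_derivative[OF wc_integrable z] by simp
qed

text \<open>The primitive of \<open>exp (z\<^sup>2)\<close> that vanishes at 0, or
  \<open>sqrt pi / 2\<close> times the imaginary error function. It arises by solving the
  differential equation of the transform with integrating factor
  \<open>exp (z\<^sup>2)\<close>.\<close>

definition expsq_int :: "complex \<Rightarrow> complex" where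
  "expsq_int = (SOME E. (\<forall>z. (E has_field_derivative exp (z\<^sup>2)) (at z)) \<and> E 0 = 0)"

lemma expsq_int:
  "(expsq_int has_field_derivative exp (z\<^sup>2)) (at z)" "expsq_int 0 = 0"
proof -
  have "(\<lambda>z::complex. exp (z\<^sup>2)) holomorphic_on UNIV" by (intro holomorphic_intros)
  then obtain g where g: "\<And>z::complex. (g has_field_derivative exp (z\<^sup>2)) (at z)"
    using holomorphic_convex_primitive'[of UNIV "\<lambda>z. exp (z\<^sup>2)"] by auto
  have "((\<lambda>z. g z - g 0) has_field_derivative exp (z\<^sup>2)) (at z)" for z :: complex
    using g[of z] by (auto intro!: derivative_eq_intros)
  then have "\<exists>E::complex \<Rightarrow> complex. (\<forall>z. (E has_field_derivative exp (z\<^sup>2)) (at z)) \<and> E 0 = 0"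
    by (intro exI[of _ "\<lambda>z. g z - g 0"]) auto
  from someI_ex[OF this] show "(expsq_int has_field_derivative exp (z\<^sup>2)) (at z)" "expsq_int 0 = 0"
    unfolding expsq_int_def by blast+
qed

text \<open>The entire continuation across the real line of the Cauchy transform of the Gaussian from the
  upper half-plane; up to a constant factor this is the Faddeeva function.\<close>

definition faddeeva :: "complex \<Rightarrow> complex" where
  "faddeeva z = exp (- z\<^sup>2) * (\<i> * of_real (sqrt pi) - 2 * expsq_int z)"

lemma faddeeva_has_derivative:
  "(faddeeva has_field_derivative (- 2 - 2 * z * faddeeva z)) (at z)"
proof -
  have "((\<lambda>z. exp (- z\<^sup>2) * (\<i> * of_real (sqrt pi) - 2 * expsq_int z)) has_field_derivative
     (exp (- z\<^sup>2) * (- (2 * z)) * (\<i> * of_real (sqrt pi) - 2 * expsq_int z) + exp (- z\<^sup>2) * (- (2 * exp (z\<^sup>2))))) (at z)"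
    by (auto intro!: derivative_eq_intros expsq_int(1) simp: algebra_simps)
  moreover have "exp (- z\<^sup>2) * (- (2 * exp (z\<^sup>2))) = - 2"
    by (simp add: exp_minus)
  ultimately show ?thesis by (simp add: faddeeva_def[abs_def] algebra_simps)
qed

lemma faddeeva_holomorphic: "faddeeva holomorphic_on A"
  using faddeeva_has_derivative by (auto simp: holomorphic_on_def field_differentiable_def intro: has_field_derivative_at_within)

lemma faddeeva_isCont: "isCont faddeeva z"
  using faddeeva_has_derivative by (rule DERIV_isCont)

lemma cauchy_w_odd: "cauchy wc (- z) = - cauchy wc z"
proof -
  have "cauchy wc (- z) = (LINT v|lborel. wc v / (of_real v + z))" by (simp add: cauchy_def)
  also have "\<dots> = (LINT v|lborel. wc (- v) / (of_real (- v) + z))"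
    using lborel_integral_real_affine[of "-1" "\<lambda>v. wc v / (of_real v + z)" 0] by simp
  also have "\<dots> = (LINT v|lborel. - (wc v / (of_real v - z)))"
  proof (intro Bochner_Integration.integral_cong refl)
    fix v
    have "of_real (- v) + z = - (of_real v - z)" by simp
    then show "wc (- v) / (of_real (- v) + z) = - (wc v / (of_real v - z))"
      by (simp only: w_even divide_minus_right)
  qed
  also have "\<dots> = - cauchy wc z" by (simp add: cauchy_def)
  finally show ?thesis .
qed

text \<open>Since the transform is odd, its value on the axis is half of its jump between
  \<open>\<i> y\<close> and \<open>- \<i> y\<close>, and the jump is an explicit Poisson
  integral.\<close>

lemma cauchy_w_imaginary_axis:
  assumes y: "y > 0"
  shows "cauchy wc (Complex 0 y) = \<i> * of_real (LINT v|lborel. w v * (y / (v\<^sup>2 + y\<^sup>2)))"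
proof -
  have "Complex 0 (- y) = - Complex 0 y" by (simp add: complex_eq_iff)
  then have "cauchy wc (Complex 0 y) - cauchy wc (Complex 0 (- y)) = 2 * cauchy wc (Complex 0 y)"
    by (simp add: cauchy_w_odd)
  then have "2 * cauchy wc (Complex 0 y) = 2 * (\<i> * poisson wc y 0)"
    using cauchy_jump[OF wc_integrable y, of 0] by simp
  then have "cauchy wc (Complex 0 y) = \<i> * poisson wc y 0" by simp
  moreover have "poisson wc y 0 = of_real (LINT v|lborel. w v * (y / (v\<^sup>2 + y\<^sup>2)))"
    unfolding poisson_def by (simp only: diff_zero flip: integral_complex_of_real of_real_mult)
  ultimately show ?thesis by simp
qed

text \<open>The substitution \<open>v = y t\<close> yields an integrand dominated by
  \<open>1 / (1 + t\<^sup>2)\<close> with limit \<open>w 0 / (1 + t\<^sup>2)\<close>, so the limit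
  is \<open>w 0 * pi\<close>. This value is the constant of integration in
  \<open>faddeeva\<close>.\<close>

lemma poisson_w_tendsto:
  "((\<lambda>y. LINT v|lborel. w v * (y / (v\<^sup>2 + y\<^sup>2))) \<longlongrightarrow> sqrt pi) (at_right 0)"
proof -
  have scaled: "(LINT v|lborel. w v * (y / (v\<^sup>2 + y\<^sup>2))) = (LINT t|lborel. w (y * t) * (1 / (1 + t\<^sup>2)))" if y: "y > 0" for y
  proof -
    have "(LINT v|lborel. w v * (y / (v\<^sup>2 + y\<^sup>2))) = y * (LINT t|lborel. w (y * t) * (y / ((y * t)\<^sup>2 + y\<^sup>2)))"
      using lborel_integral_real_affine[of y "\<lambda>v. w v * (y / (v\<^sup>2 + y\<^sup>2))" 0] y by simp
    also have "\<dots> = (LINT t|lborel. y * (w (y * t) * (y / ((y * t)\<^sup>2 + y\<^sup>2))))"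
      by (rule integral_mult_right_zero[symmetric])
    also have "\<dots> = (LINT t|lborel. w (y * t) * (1 / (1 + t\<^sup>2)))"
    proof (intro Bochner_Integration.integral_cong refl)
      fix t :: real
      have "(y * t)\<^sup>2 + y\<^sup>2 = y * y * (1 + t\<^sup>2)" by (simp add: power2_eq_square algebra_simps)
      moreover have "1 + t\<^sup>2 \<noteq> 0" using zero_le_power2[of t] by linarith
      ultimately show "y * (w (y * t) * (y / ((y * t)\<^sup>2 + y\<^sup>2))) = w (y * t) * (1 / (1 + t\<^sup>2))"
        using y by simp
    qed
    finally show ?thesis .
  qed
  have "((\<lambda>y. LINT t|lborel. complex_of_real (w (y * t) * (1 / (1 + t\<^sup>2)))) \<longlongrightarrow>
      (LINT t|lborel. complex_of_real (w (0 * t) * (1 / (1 + t\<^sup>2))))) (at_right 0)"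
  proof (rule dominated_convergence_within[where bound = "\<lambda>t. 1 / (1 + t\<^sup>2)"])
    show "AE t in lborel. norm (complex_of_real (w (y * t) * (1 / (1 + t\<^sup>2)))) \<le> 1 / (1 + t\<^sup>2)" for y
    proof (intro always_eventually allI)
      fix t :: real
      have "w (y * t) * (1 / (1 + t\<^sup>2)) \<le> 1 * (1 / (1 + t\<^sup>2))" using w_le_1 by (intro mult_right_mono) auto
      moreover have "0 \<le> w (y * t) * (1 / (1 + t\<^sup>2))" using w_pos[of "y * t"] by simp
      ultimately show "norm (complex_of_real (w (y * t) * (1 / (1 + t\<^sup>2)))) \<le> 1 / (1 + t\<^sup>2)"
        by (simp only: norm_of_real abs_of_nonneg mult_1)
    qed
    have cont: "isCont w u" for u using w_has_derivative by (rule DERIV_isCont)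
    show "AE t in lborel. ((\<lambda>y. complex_of_real (w (y * t) * (1 / (1 + t\<^sup>2)))) \<longlongrightarrow>
        complex_of_real (w (0 * t) * (1 / (1 + t\<^sup>2)))) (at_right 0)"
      by (intro always_eventually allI tendsto_of_real tendsto_mult tendsto_const
          isCont_tendsto_compose[OF cont] tendsto_ident_at)
  qed (use integrable_inverse_square_plus_one in \<open>measurable\<close>)
  then have "((\<lambda>y. LINT t|lborel. w (y * t) * (1 / (1 + t\<^sup>2))) \<longlongrightarrow> (LINT t|lborel. w 0 * (1 / (1 + t\<^sup>2)))) (at_right 0)"
    unfolding integral_complex_of_real tendsto_of_real_iff by simp
  also have "(LINT t|lborel. w 0 * (1 / (1 + t\<^sup>2))) = w 0 * pi"
    by (simp only: integral_mult_right_zero integral_inverse_square_plus_one)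
  also have "w 0 * pi = sqrt pi"
    by (simp add: w_def real_div_sqrt)
  finally show ?thesis
    by (rule Lim_transform_eventually)
      (use eventually_at_right_less[of 0] in \<open>eventually_elim, simp only: scaled\<close>)
qed

text \<open>The differential equation makes
  \<open>cauchy wc z * exp (z\<^sup>2) + 2 * expsq_int z\<close> constant on the upper half-plane.
  The constant is read off by approaching 0 along the imaginary axis.\<close>

theorem cauchy_w_eq_faddeeva:
  assumes z: "Im z > 0"
  shows "cauchy wc z = faddeeva z"
proof -
  define H where "H = {z. Im z > 0}"
  have "((\<lambda>z. cauchy wc z * exp (z\<^sup>2) + 2 * expsq_int z) has_field_derivative 0) (at z)" if "z \<in> H" for z
  proof -
    have "Im z \<noteq> 0" using that by (simp add: H_def)
    then have "((\<lambda>z. cauchy wc z * exp (z\<^sup>2) + 2 * expsq_int z) has_field_derivative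
       ((- 2 - 2 * z * cauchy wc z) * exp (z\<^sup>2) + cauchy wc z * (exp (z\<^sup>2) * (2 * z)) + 2 * exp (z\<^sup>2))) (at z)"
      by (auto intro!: derivative_eq_intros expsq_int(1) cauchy_w_derivative simp: algebra_simps)
    then show ?thesis by (simp add: algebra_simps)
  qed
  moreover have "convex H" unfolding H_def by (rule convex_halfspace_Im_gt)
  ultimately obtain c where c: "\<And>z. z \<in> H \<Longrightarrow> cauchy wc z * exp (z\<^sup>2) + 2 * expsq_int z = c"
    using has_field_derivative_zero_constant[of H "\<lambda>z. cauchy wc z * exp (z\<^sup>2) + 2 * expsq_int z"]
    by (auto intro: has_field_derivative_at_within)
  have "c = \<i> * of_real (sqrt pi)"
  proof (rule tendsto_unique[OF trivial_limit_at_right_real])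
    show "((\<lambda>y. cauchy wc (Complex 0 y) * exp ((Complex 0 y)\<^sup>2) + 2 * expsq_int (Complex 0 y)) \<longlongrightarrow> c) (at_right 0)"
      by (rule tendsto_eventually) (use eventually_at_right_less[of 0] in \<open>eventually_elim, auto intro!: c simp: H_def\<close>)
    have yl: "((\<lambda>y. Complex 0 y) \<longlongrightarrow> 0) (at_right 0)"
      using Complex_tendsto_of_real[of 0] by simp
    have "((\<lambda>y. \<i> * complex_of_real (LINT v|lborel. w v * (y / (v\<^sup>2 + y\<^sup>2)))) \<longlongrightarrow> \<i> * of_real (sqrt pi)) (at_right 0)"
      by (intro tendsto_intros poisson_w_tendsto)
    then have "((\<lambda>y. cauchy wc (Complex 0 y)) \<longlongrightarrow> \<i> * of_real (sqrt pi)) (at_right 0)"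
      by (rule Lim_transform_eventually)
        (use eventually_at_right_less[of 0] in \<open>eventually_elim, simp add: cauchy_w_imaginary_axis\<close>)
    moreover have "((\<lambda>y. expsq_int (Complex 0 y)) \<longlongrightarrow> expsq_int 0) (at_right 0)"
      by (rule isCont_tendsto_compose[OF DERIV_isCont[OF expsq_int(1)] yl])
    ultimately have "((\<lambda>y. cauchy wc (Complex 0 y) * exp ((Complex 0 y)\<^sup>2) + 2 * expsq_int (Complex 0 y)) \<longlongrightarrow>
       \<i> * of_real (sqrt pi) * exp (0\<^sup>2) + 2 * expsq_int 0) (at_right 0)"
      by (intro tendsto_intros yl)
    then show "((\<lambda>y. cauchy wc (Complex 0 y) * exp ((Complex 0 y)\<^sup>2) + 2 * expsq_int (Complex 0 y)) \<longlongrightarrow> \<i> * of_real (sqrt pi)) (at_right 0)"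
      by (simp add: expsq_int(2))
  qed
  then have "cauchy wc z * exp (z\<^sup>2) = \<i> * of_real (sqrt pi) - 2 * expsq_int z"
    using c[of z] z by (simp add: H_def algebra_simps)
  then show ?thesis by (simp add: faddeeva_def exp_minus field_simps)
qed

text \<open>On the real line the real part is -2 times Dawson's function,
  \<open>exp (- x\<^sup>2)\<close> times a strictly increasing integral that vanishes at 0. Hence 0
  is the only real point at which the purely imaginary value \<open>\<i> \<xi>\<close> can be
  attained.\<close>

lemma faddeeva_real_nonzero_Re:
  assumes x: "x \<noteq> 0"
  shows "Re (faddeeva (of_real x)) \<noteq> 0"
proof -
  define r where "r = (\<lambda>x::real. Re (expsq_int (of_real x)))"
  have "(r has_real_derivative exp (x\<^sup>2)) (at x)" for x :: real
  proof -
    have "((\<lambda>x. expsq_int (of_real x)) has_vector_derivative exp ((of_real x)\<^sup>2)) (at x)"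
      by (rule has_vector_derivative_real_field[OF expsq_int(1)])
    from bounded_linear.has_vector_derivative[OF bounded_linear_Re this]
    show ?thesis
      unfolding r_def has_real_derivative_iff_has_vector_derivative
      by (simp add: exp_of_real flip: of_real_power)
  qed
  then have mono: "r a < r b" if "a < b" for a b
    by (intro DERIV_pos_imp_increasing[OF that]) (meson exp_gt_zero)
  have "r 0 = 0" by (simp add: r_def expsq_int(2))
  then have "r x \<noteq> 0" using mono[of 0 x] mono[of x 0] x by (cases "x > 0") auto
  moreover have "exp (- (complex_of_real x)\<^sup>2) = of_real (exp (- x\<^sup>2))"
    by (simp add: exp_of_real flip: of_real_power of_real_minus)
  ultimately show ?thesis
    unfolding faddeeva_def by (simp add: r_def)
qed

lemma faddeeva_0: "faddeeva 0 = \<i> * of_real (sqrt pi)"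
  by (simp add: faddeeva_def expsq_int(2))

text \<open>Reflecting the integration variable about \<open>x\<close> leaves an integrand of constant sign.\<close>

lemma cauchy_w_nonzero_Re:
  assumes y: "y > 0" and x: "x \<noteq> 0"
  shows "Re (cauchy wc (Complex x y)) \<noteq> 0"
proof
  assume zero: "Re (cauchy wc (Complex x y)) = 0"
  define g where "g = (\<lambda>t. w (x + t) * (t / (t\<^sup>2 + y\<^sup>2)))"
  have kernel: "of_real (w (x + t)) / (of_real (x + t) - Complex x y) = wc (x + t) / (of_real t - \<i> * of_real y)" for t
    by (simp add: Complex_eq)
  have Re_k: "Re (wc (x + t) / (of_real (x + t) - Complex x y)) = g t" for t
    by (simp add: g_def Complex_eq Re_divide power2_eq_square)
  have int0: "integrable lborel (\<lambda>t. wc (x + t) / (of_real (x + t) - Complex x y))"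
    using lborel_integrable_real_affine[OF cauchy_integrable[OF wc_integrable, of "Complex x y"], of 1 x] y by simp
  have g: "integrable lborel g"
    using integrable_Re[OF int0] unfolding Re_k .
  have "cauchy wc (Complex x y) = (LINT t|lborel. wc (x + t) / (of_real (x + t) - Complex x y))"
    using lborel_integral_real_affine[of 1 "\<lambda>v. wc v / (of_real v - Complex x y)" x] by (simp add: cauchy_def)
  then have "(LINT t|lborel. g t) = 0"
    using zero integral_Re[OF int0] unfolding Re_k by simp
  moreover have "(LINT t|lborel. g (- t)) = (LINT t|lborel. g t)"
    using lborel_integral_real_affine[of "-1" g 0] by simp
  moreover have g': "integrable lborel (\<lambda>t. g (- t))"
    using lborel_integrable_real_affine[OF g, of "-1" 0] by simp
  ultimately have "(LINT t|lborel. - x * (g t + g (- t))) = 0"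
    using g by simp
  define p where "p = (\<lambda>t. - x * (g t + g (- t)))"
  have pp: "p t > 0" if t: "t \<noteq> 0" for t
  proof -
    have "p t = (x * t) * (w (x - t) - w (x + t)) / (t\<^sup>2 + y\<^sup>2)"
      by (simp add: p_def g_def divide_inverse) (simp add: algebra_simps)
    moreover have "t\<^sup>2 + y\<^sup>2 > 0" using y by (intro add_nonneg_pos) auto
    moreover have "(x * t) * (w (x - t) - w (x + t)) > 0"
    proof -
      have sq: "(x + t)\<^sup>2 - (x - t)\<^sup>2 = 4 * (x * t)" by (simp add: power2_eq_square algebra_simps)
      have "x * t \<noteq> 0" using x t by simp
      then consider "x * t > 0" | "x * t < 0" by linarith
      then show ?thesis
      proof cases
        case 1
        then have "(x - t)\<^sup>2 < (x + t)\<^sup>2" using sq by linarith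
        then have "w (x + t) < w (x - t)" by (simp add: w_def divide_strict_right_mono)
        then show ?thesis using 1 by simp
      next
        case 2
        then have "(x + t)\<^sup>2 < (x - t)\<^sup>2" using sq by linarith
        then have "w (x - t) < w (x + t)" by (simp add: w_def divide_strict_right_mono)
        then show ?thesis using 2 by (simp add: mult_neg_neg)
      qed
    qed
    ultimately show ?thesis by simp
  qed
  have p: "integrable lborel p" unfolding p_def using g g' by simp
  have "AE t in lborel. 0 \<le> p t"
    using AE_lborel_singleton[of 0] by eventually_elim (use pp in \<open>auto intro: less_imp_le\<close>)
  then have "AE t in lborel. p t = 0"
    using integral_nonneg_eq_0_iff_AE[OF p] \<open>(LINT t|lborel. - x * (g t + g (- t))) = 0\<close> by (simp add: p_def)
  then have "AE t::real in lborel. False"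
    using AE_lborel_singleton[of 0] by eventually_elim (use pp in force)
  then show False using not_AE_lborel_False by simp
qed

text \<open>For \<open>y \<ge> 0\<close> this is \<open>sqrt pi\<close> times the scaled
  complementary error function, \<open>sqrt pi * exp (y\<^sup>2) * erfc y\<close>. The continuation
  is used rather than the transform so that \<open>y = 0\<close> is an interior point for
  differentiation.\<close>

definition axis_value :: "real \<Rightarrow> real" where
  "axis_value y = Im (faddeeva (Complex 0 y))"

lemma axis_eq:
  assumes y: "y > 0"
  shows "axis_value y = (LINT v|lborel. w v * (y / (v\<^sup>2 + y\<^sup>2)))"
proof -
  have "faddeeva (Complex 0 y) = \<i> * of_real (LINT v|lborel. w v * (y / (v\<^sup>2 + y\<^sup>2)))"
    using cauchy_w_eq_faddeeva[of "Complex 0 y"] cauchy_w_imaginary_axis[OF y] y by simp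
  then show ?thesis by (simp only: axis_value_def Im_i_times Re_complex_of_real)
qed

lemma faddeeva_axis:
  assumes y: "y \<ge> 0"
  shows "faddeeva (Complex 0 y) = \<i> * of_real (axis_value y)"
proof (cases "y = 0")
  case True
  then show ?thesis by (simp add: axis_value_def faddeeva_0 flip: zero_complex.code)
next
  case False
  then show ?thesis
    using cauchy_w_eq_faddeeva[of "Complex 0 y"] cauchy_w_imaginary_axis[of y] axis_eq[of y] y by simp
qed

lemma axis_0: "axis_value 0 = sqrt pi"
  by (simp add: axis_value_def faddeeva_0 flip: zero_complex.code)

lemma poisson_w_integrable:
  assumes y: "y > 0"
  shows "integrable lborel (\<lambda>v. w v * (y / (v\<^sup>2 + y\<^sup>2)))"
proof (rule Bochner_Integration.integrable_bound)
  show "integrable lborel (\<lambda>v. y / (v\<^sup>2 + y\<^sup>2))"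
    using has_bochner_integral_poisson_kernel[OF y, of 0] by (auto simp: has_bochner_integral_iff)
  have "w v * (y / (v\<^sup>2 + y\<^sup>2)) \<le> 1 * (y / (v\<^sup>2 + y\<^sup>2))" "0 \<le> w v * (y / (v\<^sup>2 + y\<^sup>2))" for v
    using y w_le_1[of v] w_pos[of v] by (intro mult_right_mono, auto)
  then show "AE v in lborel. norm (w v * (y / (v\<^sup>2 + y\<^sup>2))) \<le> norm (y / (v\<^sup>2 + y\<^sup>2))"
    using y by (intro always_eventually allI) (simp only: real_norm_def abs_of_nonneg mult_1 order_trans[OF _ abs_ge_self])
qed measurable

lemma axis_pos:
  assumes y: "y \<ge> 0"
  shows "axis_value y > 0"
proof (cases "y = 0")
  case True
  then show ?thesis by (simp add: axis_0)
next
  case False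
  then have y: "y > 0" using y by simp
  have pos: "w v * (y / (v\<^sup>2 + y\<^sup>2)) > 0" for v
    using y w_pos[of v] by (intro mult_pos_pos divide_pos_pos add_nonneg_pos) auto
  have "axis_value y \<ge> 0"
    unfolding axis_eq[OF y] using pos by (intro Bochner_Integration.integral_nonneg) (auto intro: less_imp_le)
  moreover have "axis_value y \<noteq> 0"
  proof
    assume "axis_value y = 0"
    then have "AE v in lborel. w v * (y / (v\<^sup>2 + y\<^sup>2)) = 0"
      using integral_nonneg_eq_0_iff_AE[OF poisson_w_integrable[OF y]] pos axis_eq[OF y] by (simp add: less_imp_le)
    then have "AE v::real in lborel. False" by eventually_elim (metis pos less_irrefl)
    then show False using not_AE_lborel_False by simp
  qed
  ultimately show ?thesis by simp
qed

text \<open>The difference of the two sides is the integral of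
  \<open>w v * v\<^sup>2 / (v\<^sup>2 + y\<^sup>2)\<close>, which is positive. The inequality is
  used three times: it makes \<open>axis_value\<close> strictly decreasing, makes the derivative of
  the dispersion function nonzero at its zero, and places the eigenvalue below 0.\<close>

lemma axis_mult_less_1:
  assumes y: "y \<ge> 0"
  shows "y * axis_value y < 1"
proof (cases "y = 0")
  case False
  then have y: "y > 0" using y by simp
  define p where "p = (\<lambda>v. w v - y * (w v * (y / (v\<^sup>2 + y\<^sup>2))))"
  have p: "integrable lborel p"
    unfolding p_def by (intro Bochner_Integration.integrable_diff integrable_mult_right poisson_w_integrable y w_integrable)
  have pp: "p v > 0" if "v \<noteq> 0" for v
  proof -
    have "v\<^sup>2 > 0" "y\<^sup>2 > 0" using that y by simp_all
    then have s: "v\<^sup>2 + y\<^sup>2 > 0" by (rule add_pos_pos)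
    have "p v = w v * (1 - y\<^sup>2 / (v\<^sup>2 + y\<^sup>2))" by (simp add: p_def power2_eq_square algebra_simps)
    moreover have "1 - y\<^sup>2 / (v\<^sup>2 + y\<^sup>2) > 0" using s \<open>v\<^sup>2 > 0\<close> by simp
    ultimately show ?thesis using w_pos[of v] by simp
  qed
  have nn: "AE v in lborel. 0 \<le> p v"
    using AE_lborel_singleton[of 0] by eventually_elim (use pp in \<open>auto intro: less_imp_le\<close>)
  have "(LINT v|lborel. p v) = 1 - y * axis_value y"
    by (simp only: p_def axis_eq[OF y] Bochner_Integration.integral_diff[OF w_integrable
          integrable_mult_right[OF poisson_w_integrable[OF y]]] integral_mult_right_zero w_integral)
  moreover have "(LINT v|lborel. p v) \<ge> 0" using nn by (rule integral_nonneg_AE)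
  moreover have "(LINT v|lborel. p v) \<noteq> 0"
  proof
    assume "(LINT v|lborel. p v) = 0"
    then have "AE v in lborel. p v = 0" using integral_nonneg_eq_0_iff_AE[OF p nn] by simp
    then have "AE v::real in lborel. False"
      using AE_lborel_singleton[of 0] by eventually_elim (use pp in force)
    then show False using not_AE_lborel_False by simp
  qed
  ultimately show ?thesis by simp
qed simp

lemma axis_has_derivative:
  assumes y: "y \<ge> 0"
  shows "(axis_value has_real_derivative 2 * (y * axis_value y - 1)) (at y)"
proof -
  have "((\<lambda>y. faddeeva (\<i> * y)) has_field_derivative ((- 2 - 2 * (\<i> * of_real y) * faddeeva (\<i> * of_real y)) * \<i>)) (at (of_real y))"
    by (rule DERIV_chain2[OF faddeeva_has_derivative]) (auto intro!: derivative_eq_intros)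
  then have "((\<lambda>y. faddeeva (\<i> * of_real y)) has_vector_derivative ((- 2 - 2 * (\<i> * of_real y) * faddeeva (\<i> * of_real y)) * \<i>)) (at y)"
    by (rule has_vector_derivative_real_field)
  from bounded_linear.has_vector_derivative[OF bounded_linear_Im this]
  have "((\<lambda>y. Im (faddeeva (\<i> * of_real y))) has_real_derivative Im ((- 2 - 2 * (\<i> * of_real y) * faddeeva (\<i> * of_real y)) * \<i>)) (at y)"
    unfolding has_real_derivative_iff_has_vector_derivative .
  moreover have C: "\<i> * of_real y = Complex 0 y" for y by (simp add: complex_eq_iff)
  ultimately show ?thesis
    unfolding C faddeeva_axis[OF y] by (simp add: axis_value_def[abs_def] algebra_simps)
qed

lemma axis_strict_antimono:
  assumes "0 \<le> a" "a < b"
  shows "axis_value b < axis_value a"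
proof (rule DERIV_neg_imp_decreasing[OF assms(2)])
  fix x assume "a \<le> x" "x \<le> b"
  then have "x \<ge> 0" using assms by simp
  then show "\<exists>d. (axis_value has_real_derivative d) (at x) \<and> d < 0"
    using axis_has_derivative[of x] axis_mult_less_1[of x] by (intro exI[of _ "2 * (x * axis_value x - 1)"]) auto
qed

lemma faddeeva_zero:
  assumes z: "Im z \<ge> 0" and zero: "faddeeva z = \<i> * of_real \<xi>"
  shows "z = Complex 0 (Im z)" "axis_value (Im z) = \<xi>"
proof -
  have "Re z = 0"
  proof (rule ccontr)
    assume "Re z \<noteq> 0"
    show False
    proof (cases "Im z = 0")
      case True
      then have "z = of_real (Re z)" by (simp add: complex_eq_iff)
      then show False using faddeeva_real_nonzero_Re[OF \<open>Re z \<noteq> 0\<close>] zero by simp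
    next
      case False
      then show False
        using cauchy_w_nonzero_Re[of "Im z" "Re z"] cauchy_w_eq_faddeeva[of z] \<open>Re z \<noteq> 0\<close> z zero by simp
    qed
  qed
  then show eq: "z = Complex 0 (Im z)" by (simp add: complex_eq_iff)
  show "axis_value (Im z) = \<xi>"
    unfolding axis_value_def eq[symmetric] zero by simp
qed

section \<open>Decay of the continued transform, uniform up to the real line\<close>

lemma moment_lipschitz: "\<bar>a * w a - b * w b\<bar> \<le> \<bar>a - b\<bar>" for a b :: real
proof -
  have "norm (a * w a - b * w b) \<le> 1 * norm (a - b)"
  proof (rule field_differentiable_bound[OF convex_UNIV])
    fix v :: real
    show "((\<lambda>v. v * w v) has_field_derivative ((1 - 2 * v\<^sup>2) * w v)) (at v within UNIV)"
      by (auto intro!: derivative_eq_intros w_has_derivative simp: power2_eq_square algebra_simps)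
    have "1 + v\<^sup>2 + (v\<^sup>2)\<^sup>2 / 2 \<le> exp (v\<^sup>2)"
      using exp_lower_Taylor_quadratic[of "v\<^sup>2"] by simp
    moreover have "2 * v\<^sup>2 - 1 \<le> 1 + v\<^sup>2 + (v\<^sup>2)\<^sup>2 / 2"
      using zero_le_power2[of "v\<^sup>2 - 1"] by (simp add: power2_diff)
    moreover have "1 - 2 * v\<^sup>2 \<le> exp (v\<^sup>2)" using one_le_exp_iff[of "v\<^sup>2"] zero_le_power2[of v] by linarith
    ultimately have le: "\<bar>1 - 2 * v\<^sup>2\<bar> \<le> exp (v\<^sup>2)" by linarith
    have "\<bar>1 - 2 * v\<^sup>2\<bar> * exp (- v\<^sup>2) \<le> exp (v\<^sup>2) * exp (- v\<^sup>2)"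
      by (intro mult_right_mono le) simp
    then have "\<bar>1 - 2 * v\<^sup>2\<bar> * exp (- v\<^sup>2) \<le> 1" by (simp flip: exp_add)
    then have "\<bar>1 - 2 * v\<^sup>2\<bar> * exp (- v\<^sup>2) \<le> sqrt pi" using sqrt_pi_ge_1 by linarith
    then show "norm ((1 - 2 * v\<^sup>2) * w v) \<le> 1"
      by (simp add: w_def abs_mult divide_le_eq_1)
  qed auto
  then show ?thesis by simp
qed

text \<open>Averaging the integrand over the reflection about \<open>x\<close> turns the singular part of the kernel
  into a difference quotient.\<close>

lemma moment_cauchy_bounded:
  obtains C where "\<And>z. Im z > 0 \<Longrightarrow> cmod (cauchy (\<lambda>v. of_real (v * w v)) z) \<le> C"
proof -
  define u where "u = (\<lambda>v. v * w v)"
  have u: "integrable lborel u" using w_moment_integrable[of 1] by (simp add: u_def[abs_def] mult.commute)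
  have lip: "\<bar>u a - u b\<bar> \<le> \<bar>a - b\<bar>" for a b unfolding u_def by (rule moment_lipschitz)
  have u1: "\<bar>u v\<bar> \<le> 1" for v
  proof -
    have "\<bar>v\<bar> \<le> 1 + v\<^sup>2" using zero_le_power2[of "\<bar>v\<bar> - 1"] zero_le_power2[of v] by (simp add: power2_diff)
    also have "\<dots> \<le> exp (v\<^sup>2)" by (rule exp_ge_add_one_self)
    finally have "\<bar>v\<bar> * exp (- v\<^sup>2) \<le> exp (v\<^sup>2) * exp (- v\<^sup>2)" by (intro mult_right_mono) auto
    then have "\<bar>v\<bar> * exp (- v\<^sup>2) \<le> 1" by (simp flip: exp_add)
    then have "\<bar>v\<bar> * exp (- v\<^sup>2) \<le> sqrt pi" using sqrt_pi_ge_1 by linarith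
    then show ?thesis by (simp add: u_def w_def abs_mult divide_le_eq_1)
  qed
  define N where "N = (LINT v|lborel. \<bar>u v\<bar>)"
  have main: "cmod (cauchy (\<lambda>v. of_real (u v)) (Complex x y)) \<le> (4 + 2 * N + 2 * pi) / 2" if y: "y > 0" for x y
  proof -
    define k where "k = (\<lambda>t. of_real (u (x + t)) / (of_real t - \<i> * of_real y) :: complex)"
    have k_eq: "of_real (u (x + t)) / (of_real (x + t) - Complex x y) = k t" for t
      by (simp add: k_def Complex_eq)
    have uc: "integrable lborel (\<lambda>v. complex_of_real (u v))" using u by simp
    have ic: "integrable lborel (\<lambda>v. complex_of_real (u v) / (of_real v - Complex x y))"
      by (rule cauchy_integrable[OF uc]) (use y in simp)
    have k: "integrable lborel k"
      using lborel_integrable_real_affine[OF ic one_neq_zero, where t = x] unfolding mult_1 k_eq .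
    have ck: "cauchy (\<lambda>v. of_real (u v)) (Complex x y) = (LINT t|lborel. k t)"
      using lborel_integral_real_affine[of 1 "\<lambda>v. of_real (u v) / (of_real v - Complex x y)" x]
      unfolding cauchy_def k_eq[symmetric] by simp
    have refl: "(LINT t|lborel. k (- t)) = (LINT t|lborel. k t)"
      using lborel_integral_real_affine[of "-1" k 0] by simp
    have k': "integrable lborel (\<lambda>t. k (- t))"
      using lborel_integrable_real_affine[OF k, of "-1" 0] by simp
    have two: "2 * cauchy (\<lambda>v. of_real (u v)) (Complex x y) = (LINT t|lborel. k t + k (- t))"
      using k k' refl ck by simp
    \<comment> \<open>The three summands belong to three regimes of the symmetrised kernel. For
      \<open>|t| \<le> 1\<close> the Lipschitz bound \<open>2 * |t|\<close> meets
      \<open>|t| / (t\<^sup>2 + y\<^sup>2)\<close>; for larger \<open>|t|\<close> that quotient is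
      at most 1; the Poisson part is controlled by \<open>|u| \<le> 1\<close>. The integral of
      \<open>b\<close> does not depend on \<open>x\<close> or \<open>y\<close>.\<close>
    define b where "b = (\<lambda>t. 2 * indicator {-1..1} t + (\<bar>u (x + t)\<bar> + \<bar>u (x - t)\<bar>) + 2 * (y / (t\<^sup>2 + y\<^sup>2)))"
    have bound: "cmod (k t + k (- t)) \<le> b t" for t
    proof -
      have s: "t\<^sup>2 + y\<^sup>2 > 0" using y by (intro add_nonneg_pos) auto
      have inv: "1 / a = b / c" if "a * b = c" "c \<noteq> 0" for a b c :: complex
        using that by (auto simp: field_simps)
      have nz: "complex_of_real (t\<^sup>2 + y\<^sup>2) \<noteq> 0" using s by (metis less_irrefl of_real_eq_0_iff)
      have inv1: "1 / (of_real t - \<i> * of_real y) = (of_real t + \<i> * of_real y) / of_real (t\<^sup>2 + y\<^sup>2)"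
        by (rule inv[OF _ nz]) (simp add: complex_eq_iff power2_eq_square)
      have inv2: "1 / (- of_real t - \<i> * of_real y) = (- of_real t + \<i> * of_real y) / of_real (t\<^sup>2 + y\<^sup>2)"
        by (rule inv[OF _ nz]) (simp add: complex_eq_iff power2_eq_square)
      have "k t + k (- t) = of_real (u (x + t)) * (1 / (of_real t - \<i> * of_real y)) + of_real (u (x - t)) * (1 / (- of_real t - \<i> * of_real y))"
        by (simp add: k_def)
      also have "\<dots> = of_real ((u (x + t) - u (x - t)) * (t / (t\<^sup>2 + y\<^sup>2))) + \<i> * of_real ((u (x + t) + u (x - t)) * (y / (t\<^sup>2 + y\<^sup>2)))"
        unfolding inv1 inv2 unfolding of_real_mult of_real_divide divide_inverse by (simp add: algebra_simps)
      finally have "cmod (k t + k (- t)) \<le> \<bar>(u (x + t) - u (x - t)) * (t / (t\<^sup>2 + y\<^sup>2))\<bar> + \<bar>(u (x + t) + u (x - t)) * (y / (t\<^sup>2 + y\<^sup>2))\<bar>"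
        by (metis (no_types, lifting) norm_triangle_ineq norm_of_real norm_mult norm_ii mult_1)
      moreover have "\<bar>(u (x + t) + u (x - t)) * (y / (t\<^sup>2 + y\<^sup>2))\<bar> \<le> 2 * (y / (t\<^sup>2 + y\<^sup>2))"
      proof -
        have "\<bar>u (x + t) + u (x - t)\<bar> \<le> 2" using u1[of "x + t"] u1[of "x - t"] by linarith
        moreover have "y / (t\<^sup>2 + y\<^sup>2) \<ge> 0" using y by simp
        ultimately show ?thesis by (simp only: abs_mult abs_of_nonneg mult_right_mono)
      qed
      moreover have "\<bar>(u (x + t) - u (x - t)) * (t / (t\<^sup>2 + y\<^sup>2))\<bar> \<le> 2 * indicator {-1..1} t + (\<bar>u (x + t)\<bar> + \<bar>u (x - t)\<bar>)"
      proof (cases "\<bar>t\<bar> \<le> 1")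
        case True
        have "\<bar>u (x + t) - u (x - t)\<bar> * \<bar>t\<bar> \<le> (2 * \<bar>t\<bar>) * \<bar>t\<bar>"
          using lip[of "x + t" "x - t"] by (intro mult_right_mono) auto
        also have "\<dots> \<le> 2 * (t\<^sup>2 + y\<^sup>2)" by (simp add: power2_eq_square mult.assoc)
        finally have "\<bar>u (x + t) - u (x - t)\<bar> * \<bar>t\<bar> / (t\<^sup>2 + y\<^sup>2) \<le> 2" using s by (simp add: pos_divide_le_eq)
        then have "\<bar>(u (x + t) - u (x - t)) * (t / (t\<^sup>2 + y\<^sup>2))\<bar> \<le> 2"
          using s by (simp add: abs_mult)
        moreover have "indicator {-1..1} t = (1::real)" using True by (auto simp: indicator_def)
        ultimately show ?thesis by simp
      next
        case False
        then have "\<bar>t\<bar> \<le> \<bar>t\<bar> * \<bar>t\<bar>" using mult_right_mono[of 1 "\<bar>t\<bar>" "\<bar>t\<bar>"] by simp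
        also have "\<dots> \<le> t\<^sup>2 + y\<^sup>2" by (simp add: power2_eq_square)
        finally have "\<bar>t\<bar> / (t\<^sup>2 + y\<^sup>2) \<le> 1" using s by simp
        then have "\<bar>u (x + t) - u (x - t)\<bar> * (\<bar>t\<bar> / (t\<^sup>2 + y\<^sup>2)) \<le> \<bar>u (x + t) - u (x - t)\<bar> * 1"
          by (intro mult_left_mono) auto
        then have "\<bar>(u (x + t) - u (x - t)) * (t / (t\<^sup>2 + y\<^sup>2))\<bar> \<le> \<bar>u (x + t) - u (x - t)\<bar>"
          using s by (simp add: abs_mult)
        then show ?thesis by (simp add: indicator_def) linarith
      qed
      ultimately show ?thesis unfolding b_def by linarith
    qed
    have ui: "integrable lborel (\<lambda>t. \<bar>u (x + t)\<bar>)" "integrable lborel (\<lambda>t. \<bar>u (x - t)\<bar>)"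
      using lborel_integrable_real_affine[OF integrable_abs[OF u], of 1 x]
        lborel_integrable_real_affine[OF integrable_abs[OF u], of "-1" x] by simp_all
    have ii: "integrable lborel (indicator {-1..1::real} :: real \<Rightarrow> real)"
      by (rule integrable_real_indicator) auto
    have pk: "has_bochner_integral lborel (\<lambda>t. y / (t\<^sup>2 + y\<^sup>2)) pi"
      using has_bochner_integral_poisson_kernel[OF y, of 0] by simp
    have un: "has_bochner_integral lborel (\<lambda>t. \<bar>u (x + t)\<bar>) N" "has_bochner_integral lborel (\<lambda>t. \<bar>u (x - t)\<bar>) N"
      using ui lborel_integral_real_affine[of 1 "\<lambda>t. \<bar>u t\<bar>" x] lborel_integral_real_affine[of "-1" "\<lambda>t. \<bar>u t\<bar>" x]
      by (simp_all add: N_def has_bochner_integral_iff)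
    have in2: "has_bochner_integral lborel (indicator {-1..1::real} :: real \<Rightarrow> real) 2"
      using ii by (simp add: has_bochner_integral_iff)
    have "has_bochner_integral lborel b (2 * 2 + (N + N) + 2 * pi)"
      unfolding b_def by (intro has_bochner_integral_add has_bochner_integral_mult_right un in2 pk)
    then have b: "integrable lborel b" and b_val: "(LINT t|lborel. b t) = 2 * 2 + (N + N) + 2 * pi"
      by (simp_all add: has_bochner_integral_iff)
    have "2 * cmod (cauchy (\<lambda>v. of_real (u v)) (Complex x y)) = cmod (LINT t|lborel. k t + k (- t))"
      unfolding two[symmetric] by (simp add: norm_mult)
    also have "\<dots> \<le> (LINT t|lborel. b t)"
    proof (rule order_trans[OF Bochner_Integration.integral_norm_bound integral_mono[OF _ b bound]])
      show "integrable lborel (\<lambda>t. cmod (k t + k (- t)))" using k k' by simp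
    qed
    finally show ?thesis using b_val by simp
  qed
  show thesis
  proof (rule that[of "(4 + 2 * N + 2 * pi) / 2"])
    fix z :: complex assume "Im z > 0"
    then show "cmod (cauchy (\<lambda>v. of_real (v * w v)) z) \<le> (4 + 2 * N + 2 * pi) / 2"
      using main[of "Im z" "Re z"] by (simp add: u_def)
  qed
qed

text \<open>\<open>z * faddeeva z\<close> is the transform of \<open>v * w v\<close> minus 1, and
  that transform is bounded on the whole half-plane. An estimate through the distance to the line
  would not give a constant valid for all \<open>Im z > 0\<close>.\<close>

lemma faddeeva_decay:
  obtains C where "C \<ge> 0" "\<And>z. Im z > 0 \<Longrightarrow> cmod z * cmod (faddeeva z) \<le> C"
proof -
  obtain B where B: "\<And>z. Im z > 0 \<Longrightarrow> cmod (cauchy (\<lambda>v. of_real (v * w v)) z) \<le> B"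
    by (rule moment_cauchy_bounded) blast
  have le: "cmod z * cmod (faddeeva z) \<le> \<bar>B\<bar> + 1" if z: "Im z > 0" for z
  proof -
    have "z * faddeeva z = cauchy (\<lambda>v. of_real (v * w v)) z - 1"
      using moment_cauchy[of z] cauchy_w_eq_faddeeva[OF z] z by simp
    then have "cmod z * cmod (faddeeva z) = cmod (cauchy (\<lambda>v. of_real (v * w v)) z - 1)"
      by (simp flip: norm_mult)
    also have "\<dots> \<le> cmod (cauchy (\<lambda>v. of_real (v * w v)) z) + 1"
      using norm_triangle_ineq4[of "cauchy (\<lambda>v. of_real (v * w v)) z" 1] by simp
    also have "\<dots> \<le> \<bar>B\<bar> + 1" using B[OF z] by simp
    finally show ?thesis .
  qed
  show thesis by (rule that[of "\<bar>B\<bar> + 1"]) (use le in auto)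
qed

text \<open>In the variable \<open>z = \<i> * (1 + \<mu>) / \<xi>\<close> this is \<open>\<i> * \<xi> * omega \<mu> \<xi>\<close>, for \<open>z\<close> in the upper half-plane.\<close>

definition disp :: "real \<Rightarrow> complex \<Rightarrow> complex" where
  "disp \<xi> z = \<i> * of_real \<xi> - faddeeva z"

lemma disp_holomorphic: "disp \<xi> holomorphic_on A"
  unfolding disp_def[abs_def] by (intro holomorphic_intros faddeeva_holomorphic)

lemma disp_isCont: "isCont (disp \<xi>) z"
  unfolding disp_def[abs_def] by (intro continuous_intros faddeeva_isCont)

lemma disp_far:
  assumes \<xi>: "\<xi> \<noteq> 0"
  obtains R where "\<And>z. Im z > 0 \<Longrightarrow> cmod z \<ge> R \<Longrightarrow> cmod (disp \<xi> z) \<ge> \<bar>\<xi>\<bar> / 2"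
proof -
  obtain C where C: "C \<ge> 0" "\<And>z. Im z > 0 \<Longrightarrow> cmod z * cmod (faddeeva z) \<le> C"
    by (rule faddeeva_decay) blast
  define R where "R = 2 * C / \<bar>\<xi>\<bar> + 1"
  have R: "R > 0" using C(1) \<xi> by (simp add: R_def add_nonneg_pos)
  have "cmod (disp \<xi> z) \<ge> \<bar>\<xi>\<bar> / 2" if z: "Im z > 0" "cmod z \<ge> R" for z
  proof -
    have "R * cmod (faddeeva z) \<le> cmod z * cmod (faddeeva z)"
      using z by (intro mult_right_mono) auto
    also have "\<dots> \<le> C" using C(2)[OF z(1)] .
    also have "C \<le> \<bar>\<xi>\<bar> / 2 * R" using \<xi> by (simp add: R_def field_simps)
    finally have "R * cmod (faddeeva z) \<le> R * (\<bar>\<xi>\<bar> / 2)" by (simp add: mult.commute)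
    then have "cmod (faddeeva z) \<le> \<bar>\<xi>\<bar> / 2" using R by simp
    moreover have "cmod (\<i> * of_real \<xi>) = \<bar>\<xi>\<bar>" by (simp add: norm_mult)
    ultimately show ?thesis
      using norm_triangle_ineq2[of "\<i> * of_real \<xi>" "faddeeva z"] by (simp add: disp_def)
  qed
  then show thesis by (rule that)
qed

text \<open>The decay of \<open>faddeeva\<close> takes care of large \<open>|z|\<close> and
  compactness of the rest. The hypothesis concerns the imaginary axis alone, because zeros in the
  closed half-plane can lie nowhere else.\<close>

lemma disp_near_real_line:
  assumes \<xi>: "\<xi> \<noteq> 0" and no_zero: "\<And>y. 0 \<le> y \<Longrightarrow> y \<le> \<eta>0 \<Longrightarrow> axis_value y \<noteq> \<xi>"
  obtains c where "c > 0" "\<And>z. 0 < Im z \<Longrightarrow> Im z \<le> \<eta>0 \<Longrightarrow> cmod (disp \<xi> z) \<ge> c"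
proof -
  obtain R where R: "\<And>z. Im z > 0 \<Longrightarrow> cmod z \<ge> R \<Longrightarrow> cmod (disp \<xi> z) \<ge> \<bar>\<xi>\<bar> / 2"
    by (rule disp_far[OF \<xi>]) blast
  define K where "K = cball 0 R \<inter> {z. 0 \<le> Im z} \<inter> {z. Im z \<le> \<eta>0}"
  have "compact K"
    unfolding K_def by (intro compact_Int_closed compact_cball closed_Collect_le continuous_intros)
  have nz: "disp \<xi> z \<noteq> 0" if "z \<in> K" for z
    using faddeeva_zero[of z \<xi>] no_zero[of "Im z"] that by (auto simp: K_def disp_def)
  obtain m where m: "m > 0" "\<And>z. z \<in> K \<Longrightarrow> m \<le> cmod (disp \<xi> z)"
  proof (cases "K = {}")
    case True
    then show thesis by (intro that[of 1]) auto
  next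
    case False
    have "continuous_on K (\<lambda>z. cmod (disp \<xi> z))"
      by (intro continuous_intros holomorphic_on_imp_continuous_on disp_holomorphic)
    from continuous_attains_inf[OF \<open>compact K\<close> False this]
    obtain z where "z \<in> K" "\<forall>y\<in>K. cmod (disp \<xi> z) \<le> cmod (disp \<xi> y)" by blast
    then show thesis using nz by (intro that[of "cmod (disp \<xi> z)"]) auto
  qed
  show thesis
  proof (rule that[of "min m (\<bar>\<xi>\<bar> / 2)"])
    fix z assume z: "0 < Im z" "Im z \<le> \<eta>0"
    show "min m (\<bar>\<xi>\<bar> / 2) \<le> cmod (disp \<xi> z)"
    proof (cases "cmod z \<ge> R")
      case True
      then show ?thesis using R[OF z(1)] by simp
    next
      case False
      then show ?thesis using m(2)[of z] z by (simp add: K_def)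
    qed
  qed (use m \<xi> in simp)
qed

section \<open>The dispersion function\<close>

lemma disp_zero_iff:
  assumes "Im z \<ge> 0"
  shows "disp \<xi> z = 0 \<longleftrightarrow> z = Complex 0 (Im z) \<and> axis_value (Im z) = \<xi>"
proof
  assume "disp \<xi> z = 0"
  then show "z = Complex 0 (Im z) \<and> axis_value (Im z) = \<xi>"
    using faddeeva_zero[OF assms, of \<xi>] by (simp add: disp_def)
next
  assume "z = Complex 0 (Im z) \<and> axis_value (Im z) = \<xi>"
  then show "disp \<xi> z = 0" using faddeeva_axis[OF assms] by (simp add: disp_def)
qed

lemma axis_inj:
  assumes "0 \<le> a" "0 \<le> b" "axis_value a = axis_value b"
  shows "a = b"
  using axis_strict_antimono[of a b] axis_strict_antimono[of b a] assms by (cases a b rule: linorder_cases) auto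

lemma axis_root:
  assumes \<xi>: "0 < \<xi>" "\<xi> < sqrt pi"
  obtains y where "y > 0" "axis_value y = \<xi>" "y * \<xi> < 1"
proof -
  \<comment> \<open>\<open>1 / \<xi>\<close> serves as the right end point for the intermediate
    value theorem because \<open>y * axis_value y < 1\<close>; at the left end point 0 the value is
    \<open>sqrt pi\<close>.\<close>
  have "axis_value (1 / \<xi>) \<le> \<xi>"
    using axis_mult_less_1[of "1 / \<xi>"] \<xi> by (simp add: field_simps)
  moreover have "isCont axis_value x" if "0 \<le> x" for x
    using axis_has_derivative[OF that] by (rule DERIV_isCont)
  ultimately obtain y where y: "0 \<le> y" "axis_value y = \<xi>"
    using IVT2[of axis_value "1 / \<xi>" \<xi> 0] \<xi> by (auto simp: axis_0)
  have "y \<noteq> 0" using y \<xi> axis_0 by auto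
  then show thesis using that[of y] axis_mult_less_1[of y] y by simp
qed

lemma axis_no_root:
  assumes "\<not> (0 < \<xi> \<and> \<xi> \<le> sqrt pi)" "y \<ge> 0"
  shows "axis_value y \<noteq> \<xi>"
  using axis_pos[OF assms(2)] axis_strict_antimono[of 0 y] assms axis_0 by (cases "y = 0") auto

lemma inverse_disp_kernel_no_root:
  assumes \<xi>: "\<xi> \<noteq> 0" and no: "\<And>y. y \<ge> 0 \<Longrightarrow> axis_value y \<noteq> \<xi>" and \<eta>: "\<eta> > 0"
  shows "(LINT x|lborel. (1 / disp \<xi> (Complex x \<eta>)) / ((of_real s - Complex x \<eta>) * (of_real t - Complex x \<eta>))) = 0"
proof -
  obtain R where R: "\<And>z. Im z > 0 \<Longrightarrow> cmod z \<ge> R \<Longrightarrow> cmod (disp \<xi> z) \<ge> \<bar>\<xi>\<bar> / 2"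
    by (rule disp_far[OF \<xi>]) blast
  show ?thesis
  proof (rule integral_kernel_same_side[where R = R and C = "2 / \<bar>\<xi>\<bar>", OF _ \<eta> \<eta>])
    have "disp \<xi> z \<noteq> 0" if "Im z > 0" for z
      using disp_zero_iff[of z \<xi>] no[of "Im z"] that by auto
    then show "(\<lambda>z. 1 / disp \<xi> z) holomorphic_on {z. Im z > 0}"
      by (intro holomorphic_on_divide holomorphic_on_const disp_holomorphic) auto
    fix z assume z: "Im z \<ge> \<eta>" "cmod z \<ge> R"
    then have "cmod (disp \<xi> z) \<ge> \<bar>\<xi>\<bar> / 2" using \<eta> by (intro R) auto
    then show "cmod (1 / disp \<xi> z) \<le> 2 / \<bar>\<xi>\<bar>"
      using \<xi> frac_le[of 1 1 "\<bar>\<xi>\<bar> / 2" "cmod (disp \<xi> z)"] by (simp add: norm_divide)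
  qed
qed

lemma disp_has_derivative: "(disp \<xi> has_field_derivative (2 + 2 * z * faddeeva z)) (at z)"
  unfolding disp_def[abs_def] by (auto intro!: derivative_eq_intros faddeeva_has_derivative)

text \<open>Dividing the simple zero out of \<open>disp\<close> leaves \<open>q\<close>, which has
  no zeros in the half-plane, so \<open>1 / disp\<close> is a holomorphic function over
  \<open>z - p\<close>. By the differential equation the derivative at \<open>p\<close> is
  \<open>2 + 2 p * faddeeva p\<close>; with \<open>p = \<i> y\<close> and
  \<open>faddeeva p = \<i> \<xi>\<close> this is \<open>2 (1 - y \<xi>)\<close>.\<close>

lemma inverse_disp_kernel_root:
  assumes y: "y > 0" "axis_value y = \<xi>" and \<eta>: "0 < \<eta>" "\<eta> < y"
  shows "(LINT x|lborel. (1 / disp \<xi> (Complex x \<eta>)) / ((of_real s - Complex x \<eta>) * (of_real t - Complex x \<eta>))) =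
    2 * of_real pi * \<i> / (2 * of_real (1 - y * \<xi>)) / ((of_real s - Complex 0 y) * (of_real t - Complex 0 y))"
proof -
  define p where "p = Complex 0 y"
  define q where "q = (\<lambda>z. if z = p then deriv (disp \<xi>) p else (disp \<xi> z - disp \<xi> p) / (z - p))"
  have \<xi>: "\<xi> > 0" using axis_pos[of y] y by simp
  have zero: "disp \<xi> p = 0" using disp_zero_iff[of p \<xi>] y by (simp add: p_def)
  have "faddeeva p = \<i> * of_real \<xi>" using zero by (simp add: disp_def)
  moreover have "p = \<i> * of_real y" by (simp add: p_def complex_eq_iff)
  ultimately have "2 + 2 * p * faddeeva p = 2 * of_real (1 - y * \<xi>)" by (simp add: algebra_simps)
  then have deriv: "deriv (disp \<xi>) p = 2 * of_real (1 - y * \<xi>)"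
    using DERIV_imp_deriv[OF disp_has_derivative[of \<xi> p]] by simp
  have "y * \<xi> < 1" using axis_mult_less_1[of y] y by simp
  then have "1 - y * \<xi> \<noteq> 0" by simp
  then have deriv_nz: "deriv (disp \<xi>) p \<noteq> 0" unfolding deriv by (metis mult_eq_0_iff of_real_eq_0_iff zero_neq_numeral)
  have qp: "q p = 2 * of_real (1 - y * \<xi>)" using deriv by (simp add: q_def)
  have disp_nz: "disp \<xi> z \<noteq> 0" if "Im z > 0" "z \<noteq> p" for z
  proof
    assume "disp \<xi> z = 0"
    then have z: "z = Complex 0 (Im z)" "axis_value (Im z) = \<xi>" using disp_zero_iff[of z \<xi>] that by auto
    then have "Im z = y" using axis_inj[of "Im z" y] y that by simp
    then show False using z that by (simp add: p_def)
  qed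
  have qz: "q z = disp \<xi> z / (z - p)" if "z \<noteq> p" for z using that by (simp add: q_def zero)
  have "q holomorphic_on UNIV" unfolding q_def by (rule pole_lemma_open[OF disp_holomorphic open_UNIV])
  then have "q holomorphic_on {z. Im z > 0}" by (rule holomorphic_on_subset) simp
  moreover have "q z \<noteq> 0" if "Im z > 0" for z
    using disp_nz[OF that] deriv_nz by (simp add: q_def zero)
  ultimately have hol: "(\<lambda>z. 1 / q z) holomorphic_on {z. Im z > 0}"
    by (intro holomorphic_on_divide holomorphic_on_const) auto
  obtain R where R: "\<And>z. Im z > 0 \<Longrightarrow> cmod z \<ge> R \<Longrightarrow> cmod (disp \<xi> z) \<ge> \<bar>\<xi>\<bar> / 2"
    by (rule disp_far[of \<xi>]) (use \<xi> in auto)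
  have "(LINT x|lborel. (1 / q (Complex x \<eta>)) / (Complex x \<eta> - p) / ((of_real s - Complex x \<eta>) * (of_real t - Complex x \<eta>))) =
    2 * of_real pi * \<i> * ((1 / q p) / ((of_real s - p) * (of_real t - (p - \<i> * of_real (\<eta> - \<eta>)))))"
  proof (rule integral_kernel_same_side_pole[OF hol \<eta>(1) \<eta>(1)])
    show "Im p > \<eta>" using \<eta> by (simp add: p_def)
    fix z assume z: "Im z \<ge> \<eta>" "cmod z \<ge> max R (cmod p + 1)"
    then have "z \<noteq> p" by auto
    then have "1 / q z / (z - p) = 1 / disp \<xi> z" using qz[of z] by simp
    moreover have "cmod (disp \<xi> z) \<ge> \<bar>\<xi>\<bar> / 2" using \<eta> z by (intro R) auto
    ultimately show "cmod (1 / q z / (z - p)) \<le> 2 / \<bar>\<xi>\<bar>"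
      using \<xi> frac_le[of 1 1 "\<bar>\<xi>\<bar> / 2" "cmod (disp \<xi> z)"] by (simp add: norm_divide)
  qed
  moreover have "(1 / q (Complex x \<eta>)) / (Complex x \<eta> - p) = 1 / disp \<xi> (Complex x \<eta>)" for x
  proof -
    have "Complex x \<eta> \<noteq> p" using \<eta> by (auto simp: p_def)
    then show ?thesis using qz[of "Complex x \<eta>"] by simp
  qed
  ultimately show ?thesis unfolding p_def[symmetric] by (simp add: qp)
qed

lemma disp_bounded_below_strip:
  assumes \<xi>: "\<xi> \<noteq> 0" and no_zero: "\<And>y. 0 \<le> y \<Longrightarrow> y \<le> \<eta>0 \<Longrightarrow> axis_value y \<noteq> \<xi>" and \<eta>0: "\<eta>0 > 0"
  obtains c where "c > 0" "\<And>z. 0 \<le> Im z \<Longrightarrow> Im z \<le> \<eta>0 \<Longrightarrow> cmod (disp \<xi> z) \<ge> c"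
proof -
  obtain c where c: "c > 0" "\<And>z. 0 < Im z \<Longrightarrow> Im z \<le> \<eta>0 \<Longrightarrow> cmod (disp \<xi> z) \<ge> c"
    by (rule disp_near_real_line[OF \<xi> no_zero]) auto
  have "cmod (disp \<xi> z) \<ge> c" if z: "Im z = 0" for z
  proof (rule tendsto_lowerbound)
    have "z = Complex (Re z) 0" using z by (simp add: complex_eq_iff)
    then show "((\<lambda>\<eta>. cmod (disp \<xi> (Complex (Re z) \<eta>))) \<longlongrightarrow> cmod (disp \<xi> z)) (at_right 0)"
      using Complex_tendsto_right[of "Re z" 0]
      by (intro tendsto_norm isCont_tendsto_compose[OF disp_isCont]) simp
    have "\<forall>\<^sub>F \<eta> in at_right 0. 0 < \<eta> \<and> \<eta> < \<eta>0"
      by (rule eventually_between_at_right[OF \<eta>0])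
    then show "\<forall>\<^sub>F \<eta> in at_right 0. c \<le> cmod (disp \<xi> (Complex (Re z) \<eta>))"
      by eventually_elim (use c in auto)
  qed simp
  then show thesis using c by (intro that[of c]) (auto simp: le_less)
qed

text \<open>A common form for the cases with and without a zero: \<kappa> carries the residue and is
  0 if there is none. Below height \<open>\<eta>0\<close> the kernel integrals are already equal to
  their final value, so the passage to the boundary only concerns the left-hand side.\<close>

lemma boundary_integral:
  assumes \<xi>: "\<xi> \<noteq> 0" and no_zero: "\<And>y. 0 \<le> y \<Longrightarrow> y \<le> \<eta>0 \<Longrightarrow> axis_value y \<noteq> \<xi>" and \<eta>0: "\<eta>0 > 0"
    and h: "integrable lborel h" "h \<in> L2" and k: "integrable lborel k" "k \<in> L2"
    and ker: "\<And>\<eta> s t. 0 < \<eta> \<Longrightarrow> \<eta> < \<eta>0 \<Longrightarrow>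
      (LINT x|lborel. (1 / disp \<xi> (Complex x \<eta>)) / ((of_real s - Complex x \<eta>) * (of_real t - Complex x \<eta>))) =
        \<kappa> / ((of_real s - p) * (of_real t - p))"
  shows "integrable lborel (\<lambda>x. 1 / disp \<xi> (of_real x) * S_hat 1 h x * S_hat 1 k x)"
    "(LINT x|lborel. 1 / disp \<xi> (of_real x) * S_hat 1 h x * S_hat 1 k x) = \<kappa> * cauchy h p * cauchy k p"
proof -
  obtain c where c: "c > 0" "\<And>z. 0 \<le> Im z \<Longrightarrow> Im z \<le> \<eta>0 \<Longrightarrow> cmod (disp \<xi> z) \<ge> c"
    by (rule disp_bounded_below_strip[OF \<xi> no_zero \<eta>0]) auto
  have inv: "cmod (1 / disp \<xi> z) \<le> 1 / c" if "0 \<le> Im z" "Im z \<le> \<eta>0" for z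
    using c(2)[OF that] c(1) by (simp add: norm_divide frac_le)
  have [measurable]: "disp \<xi> \<in> borel_measurable borel"
    by (intro borel_measurable_continuous_onI holomorphic_on_imp_continuous_on disp_holomorphic)
  have r_meas: "(\<lambda>x. 1 / disp \<xi> (Complex x \<eta>)) \<in> borel_measurable borel" for \<eta>
    unfolding Complex_eq by measurable
  have q_meas: "(\<lambda>x. 1 / disp \<xi> (of_real x)) \<in> borel_measurable borel"
    by measurable
  show "integrable lborel (\<lambda>x. 1 / disp \<xi> (of_real x) * S_hat 1 h x * S_hat 1 k x)"
    using \<eta>0 by (intro L2_mult_integrable L2_mult_bounded[OF _ q_meas inv] S_hat_boundary_value h k) auto
  have "((\<lambda>\<eta>. LINT x|lborel. 1 / disp \<xi> (Complex x \<eta>) * cauchy h (Complex x \<eta>) * cauchy k (Complex x \<eta>))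
    \<longlongrightarrow> (LINT x|lborel. 1 / disp \<xi> (of_real x) * S_hat 1 h x * S_hat 1 k x)) (at_right 0)"
  proof (rule L2_triple_product_tendsto[where B = "1 / c", OF _ _ _ _ _ _ r_meas \<eta>0 _ q_meas])
    show "((\<lambda>\<eta>. normsq (\<lambda>x. cauchy h (Complex x \<eta>) - S_hat 1 h x)) \<longlongrightarrow> 0) (at_right 0)"
      "((\<lambda>\<eta>. normsq (\<lambda>x. cauchy k (Complex x \<eta>) - S_hat 1 k x)) \<longlongrightarrow> 0) (at_right 0)"
      using S_hat_boundary_value(2)[OF h, of 1] S_hat_boundary_value(2)[OF k, of 1] by (simp_all add: side_sign_def)
    show "S_hat 1 h \<in> L2" "S_hat 1 k \<in> L2" by (intro S_hat_boundary_value h k)+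
    show "(\<lambda>x. cauchy h (Complex x \<eta>)) \<in> L2" "(\<lambda>x. cauchy k (Complex x \<eta>)) \<in> L2" if "\<eta> > 0" for \<eta>
      using that by (auto intro!: cauchy_L2 h k)
    show "cmod (1 / disp \<xi> (Complex x \<eta>)) \<le> 1 / c" if "0 < \<eta>" "\<eta> < \<eta>0" for \<eta> x
      using that by (intro inv) auto
    show "AE x in lborel. ((\<lambda>\<eta>. 1 / disp \<xi> (Complex x \<eta>)) \<longlongrightarrow> 1 / disp \<xi> (of_real x)) (at_right 0)"
    proof (intro always_eventually allI)
      fix x
      have "disp \<xi> (of_real x) \<noteq> 0" using c(2)[of "of_real x"] c(1) \<eta>0 by auto
      then show "((\<lambda>\<eta>. 1 / disp \<xi> (Complex x \<eta>)) \<longlongrightarrow> 1 / disp \<xi> (of_real x)) (at_right 0)"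
        by (intro tendsto_divide tendsto_const isCont_tendsto_compose[OF disp_isCont] Complex_tendsto_of_real)
    qed
  qed
  moreover have "((\<lambda>\<eta>. LINT x|lborel. 1 / disp \<xi> (Complex x \<eta>) * cauchy h (Complex x \<eta>) * cauchy k (Complex x \<eta>))
    \<longlongrightarrow> \<kappa> * cauchy h p * cauchy k p) (at_right 0)"
  proof (rule tendsto_eventually)
    have "\<forall>\<^sub>F \<eta> in at_right 0. 0 < \<eta> \<and> \<eta> < \<eta>0"
      by (rule eventually_between_at_right[OF \<eta>0])
    then show "\<forall>\<^sub>F \<eta> in at_right 0. (LINT x|lborel. 1 / disp \<xi> (Complex x \<eta>) * cauchy h (Complex x \<eta>) * cauchy k (Complex x \<eta>)) = \<kappa> * cauchy h p * cauchy k p"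
    proof eventually_elim
      case (elim \<eta>)
      have "(LINT x|lborel. 1 / disp \<xi> (Complex x \<eta>) * cauchy h (Complex x \<eta>) * cauchy k (Complex x \<eta>)) =
        (LINT s|lborel. h s * (LINT t|lborel. k t * (\<kappa> / ((of_real s - p) * (of_real t - p)))))"
        using cauchy_double_pairing[OF h(1) k(1) _ _ r_meas[of \<eta>] inv, of \<eta> \<eta>] ker[of \<eta>] elim by simp
      also have "\<dots> = (LINT s|lborel. (\<kappa> * cauchy k p) * (h s / (of_real s - p)))"
      proof (intro Bochner_Integration.integral_cong refl)
        fix s
        have "(LINT t|lborel. k t * (\<kappa> / ((of_real s - p) * (of_real t - p)))) =
          (LINT t|lborel. (\<kappa> / (of_real s - p)) * (k t / (of_real t - p)))"
          by (simp add: mult_ac)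
        also have "\<dots> = (\<kappa> / (of_real s - p)) * cauchy k p"
          unfolding cauchy_def by (rule integral_mult_right_zero)
        finally show "h s * (LINT t|lborel. k t * (\<kappa> / ((of_real s - p) * (of_real t - p)))) = (\<kappa> * cauchy k p) * (h s / (of_real s - p))"
          by simp
      qed
      also have "\<dots> = (\<kappa> * cauchy k p) * cauchy h p"
        unfolding cauchy_def by (rule integral_mult_right_zero)
      finally show ?case by (simp add: mult_ac)
    qed
  qed
  ultimately show "(LINT x|lborel. 1 / disp \<xi> (of_real x) * S_hat 1 h x * S_hat 1 k x) = \<kappa> * cauchy h p * cauchy k p"
    by (rule tendsto_unique[OF trivial_limit_at_right_real])
qed

text \<open>The residue of \<open>cauchy h * cauchy k / disp \<xi>\<close> at its pole in the upper half-plane, if there is one.\<close>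

definition upper_residue :: "real \<Rightarrow> (real \<Rightarrow> complex) \<Rightarrow> (real \<Rightarrow> complex) \<Rightarrow> complex" where
  "upper_residue \<xi> h k = (if 0 < \<xi> \<and> \<xi> < sqrt pi
     then let y = (THE y. y > 0 \<and> axis_value y = \<xi>) in
       cauchy h (Complex 0 y) * cauchy k (Complex 0 y) / (2 * of_real (1 - y * \<xi>))
     else 0)"

lemma upper_residue_eq:
  assumes "y > 0" "axis_value y = \<xi>"
  shows "upper_residue \<xi> h k = cauchy h (Complex 0 y) * cauchy k (Complex 0 y) / (2 * of_real (1 - y * \<xi>))"
proof -
  have "(THE y. y > 0 \<and> axis_value y = \<xi>) = y"
    by (rule the_equality) (use assms axis_inj[of _ y] in auto)
  moreover have "0 < \<xi>" "\<xi> < sqrt pi"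
    using axis_pos[of y] axis_strict_antimono[of 0 y] axis_0 assms by auto
  ultimately show ?thesis by (simp add: upper_residue_def)
qed

theorem boundary_integral_upper:
  assumes \<xi>: "\<xi> \<noteq> 0" "\<xi> \<noteq> sqrt pi"
    and h: "integrable lborel h" "h \<in> L2" and k: "integrable lborel k" "k \<in> L2"
  shows "integrable lborel (\<lambda>x. 1 / disp \<xi> (of_real x) * S_hat 1 h x * S_hat 1 k x)"
    "(LINT x|lborel. 1 / disp \<xi> (of_real x) * S_hat 1 h x * S_hat 1 k x) = 2 * of_real pi * \<i> * upper_residue \<xi> h k"
proof -
  have "integrable lborel (\<lambda>x. 1 / disp \<xi> (of_real x) * S_hat 1 h x * S_hat 1 k x) \<and>
    (LINT x|lborel. 1 / disp \<xi> (of_real x) * S_hat 1 h x * S_hat 1 k x) = 2 * of_real pi * \<i> * upper_residue \<xi> h k"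
  proof (cases "0 < \<xi> \<and> \<xi> < sqrt pi")
    case True
    then obtain y where y: "y > 0" "axis_value y = \<xi>" "y * \<xi> < 1" using axis_root by blast
    \<comment> \<open>Half the height of the zero keeps the closed strip away from it, so
      \<open>1 / disp\<close> is bounded there and all lines of integration pass below the
      pole.\<close>
    have no: "axis_value y' \<noteq> \<xi>" if "0 \<le> y'" "y' \<le> y / 2" for y'
      using axis_inj[of y' y] y that by auto
    have ker: "(LINT x|lborel. (1 / disp \<xi> (Complex x \<eta>)) / ((of_real s - Complex x \<eta>) * (of_real t - Complex x \<eta>))) =
        2 * of_real pi * \<i> / (2 * of_real (1 - y * \<xi>)) / ((of_real s - Complex 0 y) * (of_real t - Complex 0 y))"
      if "0 < \<eta>" "\<eta> < y / 2" for \<eta> s t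
      using that y(1) by (intro inverse_disp_kernel_root y) auto
    have "y / 2 > 0" using y by simp
    note boundary_integral[OF \<xi>(1) no this h k ker]
    then show ?thesis by (simp add: upper_residue_eq[OF y(1,2)])
  next
    case False
    then have no: "axis_value y \<noteq> \<xi>" if "y \<ge> 0" for y
      using axis_no_root[of \<xi> y] \<xi> that by auto
    have "upper_residue \<xi> h k = 0" unfolding upper_residue_def using False by (rule if_not_P)
    \<comment> \<open>Without a zero \<kappa> is 0, and the strip height 1 and the point 0 are
      arbitrary choices.\<close>
    then show ?thesis
      using boundary_integral[OF \<xi>(1), of 1 h k 0 0] no h k inverse_disp_kernel_no_root[OF \<xi>(1) no]
      by simp
  qed
  then show "integrable lborel (\<lambda>x. 1 / disp \<xi> (of_real x) * S_hat 1 h x * S_hat 1 k x)"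
    "(LINT x|lborel. 1 / disp \<xi> (of_real x) * S_hat 1 h x * S_hat 1 k x) = 2 * of_real pi * \<i> * upper_residue \<xi> h k"
    by auto
qed

section \<open>Reflection between the upper and the lower half-plane\<close>

lemma cauchy_reflect: "cauchy (\<lambda>t. h (- t)) (- z) = - cauchy h z"
proof -
  have "cauchy (\<lambda>t. h (- t)) (- z) = (LINT t|lborel. h (- t) / (of_real t + z))" by (simp add: cauchy_def)
  also have "\<dots> = (LINT t|lborel. h t / (of_real (- t) + z))"
    using lborel_integral_real_affine[of "-1" "\<lambda>t. h (- t) / (of_real t + z)" 0] by simp
  also have "\<dots> = (LINT t|lborel. - (h t / (of_real t - z)))"
  proof (intro Bochner_Integration.integral_cong refl)
    fix t
    have "of_real (- t) + z = - (of_real t - z)" by simp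
    then show "h t / (of_real (- t) + z) = - (h t / (of_real t - z))" by (simp only: divide_minus_right)
  qed
  finally show ?thesis by (simp add: cauchy_def)
qed

lemma integrable_reflect:
  fixes h :: "real \<Rightarrow> 'a::{banach, second_countable_topology}"
  shows "integrable lborel h \<Longrightarrow> integrable lborel (\<lambda>t. h (- t))"
  using lborel_integrable_real_affine[of h "-1" 0] by simp

lemma L2_reflect:
  assumes "h \<in> L2"
  shows "(\<lambda>t. h (- t)) \<in> L2"
proof -
  have [measurable]: "h \<in> borel_measurable borel" using assms by (rule L2_measurable)
  show ?thesis
    using integrable_reflect[OF L2_integrable[OF assms]] by (simp add: L2_def)
qed

lemma S_hat_reflect:
  assumes h: "integrable lborel h" "h \<in> L2"
  shows "AE x in lborel. S_hat (-1) h x = - S_hat 1 (\<lambda>t. h (- t)) (- x)"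
  using S_hat_boundary_value(3)[OF h, of "-1"]
proof eventually_elim
  case (elim x)
  have "- cauchy h (Complex x (side_sign (-1) * \<eta>)) = cauchy (\<lambda>t. h (- t)) (Complex (- x) (side_sign 1 * \<eta>))" for \<eta>
  proof -
    have "Complex (- x) (side_sign 1 * \<eta>) = - Complex x (side_sign (-1) * \<eta>)"
      by (simp add: complex_eq_iff side_sign_def)
    then show ?thesis by (simp add: cauchy_reflect)
  qed
  then have "((\<lambda>\<eta>. cauchy (\<lambda>t. h (- t)) (Complex (- x) (side_sign 1 * \<eta>))) \<longlongrightarrow> - S_hat (-1) h x) (at_right 0)"
    using tendsto_minus[OF elim] by simp
  then show ?case by (simp add: S_hat_eq[of 1] tendsto_Lim)
qed

text \<open>In the open half-plane this is the oddness of the transform combined with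
  \<open>w\<close> being real; it passes to the real line by continuity of
  \<open>faddeeva\<close>.\<close>

lemma faddeeva_reflect: "faddeeva (- of_real x) = - cnj (faddeeva (of_real x))"
proof (rule tendsto_unique[OF trivial_limit_at_right_real])
  have "((\<lambda>\<eta>. faddeeva (Complex (- x) \<eta>)) \<longlongrightarrow> faddeeva (of_real (- x))) (at_right 0)"
    by (intro isCont_tendsto_compose[OF faddeeva_isCont] Complex_tendsto_of_real)
  then show "((\<lambda>\<eta>. faddeeva (Complex (- x) \<eta>)) \<longlongrightarrow> faddeeva (- of_real x)) (at_right 0)" by simp
  have minus: "((\<lambda>\<eta>. - cnj (faddeeva (Complex x \<eta>))) \<longlongrightarrow> - cnj (faddeeva (of_real x))) (at_right 0)"
    by (intro tendsto_intros isCont_tendsto_compose[OF faddeeva_isCont] Complex_tendsto_of_real)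
  have reflect: "- cnj (faddeeva (Complex x \<eta>)) = faddeeva (Complex (- x) \<eta>)" if "\<eta> > 0" for \<eta>
  proof -
    have "- cnj (cauchy wc (Complex x \<eta>)) = - cauchy wc (Complex x (- \<eta>))"
      by (simp add: cnj_cauchy)
    also have "\<dots> = cauchy wc (- Complex x (- \<eta>))" by (simp add: cauchy_w_odd)
    also have "- Complex x (- \<eta>) = Complex (- x) \<eta>" by (simp add: complex_eq_iff)
    finally show ?thesis using that by (simp add: cauchy_w_eq_faddeeva)
  qed
  from minus show "((\<lambda>\<eta>. faddeeva (Complex (- x) \<eta>)) \<longlongrightarrow> - cnj (faddeeva (of_real x))) (at_right 0)"
    by (rule Lim_transform_eventually) (rule eventually_mono[OF eventually_at_right_less[of 0] reflect])
qed

text \<open>The boundary values of the transform of \<open>w\<close> exist at every point and are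
  continuous. The lower one is the conjugate of the upper one because \<open>w\<close> is
  real.\<close>

definition w_boundary :: "real \<Rightarrow> real \<Rightarrow> complex" where
  "w_boundary s l = (if s > 0 then faddeeva (of_real l) else cnj (faddeeva (of_real l)))"

lemma cauchy_w_boundary:
  "((\<lambda>\<eta>. cauchy wc (Complex l (side_sign s * \<eta>))) \<longlongrightarrow> w_boundary s l) (at_right 0)"
proof -
  have "((\<lambda>\<eta>. faddeeva (Complex l \<eta>)) \<longlongrightarrow> faddeeva (of_real l)) (at_right 0)"
    by (rule isCont_tendsto_compose[OF faddeeva_isCont Complex_tendsto_of_real])
  then have up: "((\<lambda>\<eta>. cauchy wc (Complex l \<eta>)) \<longlongrightarrow> faddeeva (of_real l)) (at_right 0)"
    by (rule Lim_transform_eventually)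
      (use eventually_at_right_less[of 0] in \<open>eventually_elim, simp add: cauchy_w_eq_faddeeva\<close>)
  show ?thesis
  proof (cases "s > 0")
    case True
    then show ?thesis using up by (simp add: w_boundary_def side_sign_def)
  next
    case False
    have "cauchy wc (Complex l (- \<eta>)) = cnj (cauchy wc (Complex l \<eta>))" for \<eta>
      by (simp add: cnj_cauchy)
    then show ?thesis using False tendsto_cnj[OF up] by (simp add: w_boundary_def side_sign_def)
  qed
qed

lemma w_boundary_jump: "AE l in lborel. w_boundary 1 l - w_boundary (-1) l = 2 * of_real pi * \<i> * wc l"
proof -
  have "S_hat s wc l = w_boundary s l" for s l
    using cauchy_w_boundary by (simp add: S_hat_eq tendsto_Lim)
  then show ?thesis using S_hat_jump[OF wc_integrable wc_L2] by simp
qed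

lemma w_boundary_measurable [measurable]: "w_boundary s \<in> borel_measurable borel"
proof -
  have "continuous_on UNIV (w_boundary s)"
    unfolding w_boundary_def[abs_def]
    by (cases "s > 0") (auto intro!: continuous_intros
        continuous_on_compose2[OF holomorphic_on_imp_continuous_on[OF faddeeva_holomorphic[of UNIV]]])
  then show ?thesis by (rule borel_measurable_continuous_onI)
qed

lemma w_boundary_cnj: "s \<noteq> 0 \<Longrightarrow> cnj (w_boundary s l) = w_boundary (- s) l"
  by (simp add: w_boundary_def)

section \<open>Boundary values of \<open>omega\<close>, and the operators \<open>U_op\<close> and
  \<open>B_op\<close> in these terms\<close>

lemma omega_eq:
  assumes \<xi>: "\<xi> \<noteq> 0"
  shows "omega \<mu> \<xi> = 1 - cauchy wc (\<i> * (1 + \<mu>) / of_real \<xi>) / (\<i> * of_real \<xi>)"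
proof -
  have "\<i> * of_real v * of_real \<xi> + 1 + \<mu> = (of_real v - \<i> * (1 + \<mu>) / of_real \<xi>) * (\<i> * of_real \<xi>)" for v :: real
    using \<xi> by (simp add: field_simps)
  then have "(LINT v|lborel. wc v / (\<i> * of_real v * of_real \<xi> + 1 + \<mu>)) =
     (LINT v|lborel. wc v / (of_real v - \<i> * (1 + \<mu>) / of_real \<xi>) / (\<i> * of_real \<xi>))"
    by (simp only: divide_divide_eq_left)
  also have "\<dots> = cauchy wc (\<i> * (1 + \<mu>) / of_real \<xi>) / (\<i> * of_real \<xi>)"
    unfolding cauchy_def by (rule integral_divide_zero)
  finally show ?thesis by (simp add: omega_def)
qed

lemma scaled_at_right:
  assumes "\<xi> \<noteq> (0::real)"
  shows "filterlim (\<lambda>\<delta>. \<delta> / \<bar>\<xi>\<bar>) (at_right 0) (at_right 0)"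
proof (rule tendsto_imp_filterlim_at_right)
  have "((\<lambda>\<delta>. \<delta> / \<bar>\<xi>\<bar>) \<longlongrightarrow> 0 / \<bar>\<xi>\<bar>) (at_right 0)"
    using assms by (intro tendsto_intros) auto
  then show "((\<lambda>\<delta>. \<delta> / \<bar>\<xi>\<bar>) \<longlongrightarrow> 0) (at_right 0)" by simp
  show "\<forall>\<^sub>F \<delta> in at_right 0. \<delta> / \<bar>\<xi>\<bar> > 0"
    using eventually_at_right_less[of 0] by eventually_elim (use assms in simp)
qed

lemma cauchy_w_boundary_scaled:
  assumes "\<xi> \<noteq> 0"
  shows "((\<lambda>\<delta>. cauchy wc (Complex l (\<delta> / \<xi>))) \<longlongrightarrow> w_boundary \<xi> l) (at_right 0)"
proof -
  have "side_sign \<xi> * (\<delta> / \<bar>\<xi>\<bar>) = \<delta> / \<xi>" for \<delta>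
    using assms by (simp add: side_sign_def abs_if)
  then show ?thesis
    using filterlim_compose[OF cauchy_w_boundary[of l \<xi>] scaled_at_right[OF assms]] by simp
qed

text \<open>In the variable \<open>\<i> (1 + \<mu>) / \<xi>\<close> the approach by \<delta> becomes
  a height \<open>\<delta> / \<xi>\<close>, so the sign of \<xi> decides from which side the real
  line is reached.\<close>

lemma omega_plus_boundary:
  assumes \<xi>: "\<xi> \<noteq> 0"
  shows "omega_plus (- 1 - \<i> * of_real l * of_real \<xi>) \<xi> = 1 - w_boundary \<xi> l / (\<i> * of_real \<xi>)"
proof -
  have "\<i> * (1 + (- 1 - \<i> * of_real l * of_real \<xi> + of_real \<delta>)) / of_real \<xi> = Complex l (\<delta> / \<xi>)" for \<delta>
    using \<xi> by (simp add: complex_eq_iff Re_divide_of_real Im_divide_of_real)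
  then have "omega (- 1 - \<i> * of_real l * of_real \<xi> + of_real \<delta>) \<xi> = 1 - cauchy wc (Complex l (\<delta> / \<xi>)) / (\<i> * of_real \<xi>)" for \<delta>
    using omega_eq[OF \<xi>] by metis
  moreover have "((\<lambda>\<delta>. 1 - cauchy wc (Complex l (\<delta> / \<xi>)) / (\<i> * of_real \<xi>)) \<longlongrightarrow> 1 - w_boundary \<xi> l / (\<i> * of_real \<xi>)) (at_right 0)"
    using \<xi> by (intro tendsto_intros cauchy_w_boundary_scaled) auto
  ultimately show ?thesis
    unfolding omega_plus_def by (simp add: tendsto_Lim)
qed

text \<open>The reversed approach and the reversed sign of \<xi> cancel in
  \<open>\<delta> / \<xi>\<close>, so the boundary value is the same as for
  \<open>omega_plus\<close>; only the sign in front of it changes.\<close>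

lemma omega_minus_boundary:
  assumes \<xi>: "\<xi> \<noteq> 0"
  shows "omega_minus (- 1 + \<i> * of_real l * of_real \<xi>) (- \<xi>) = 1 + w_boundary \<xi> l / (\<i> * of_real \<xi>)"
proof -
  have "\<i> * (1 + (- 1 + \<i> * of_real l * of_real \<xi> - of_real \<delta>)) / of_real (- \<xi>) = Complex l (\<delta> / \<xi>)" for \<delta>
    using \<xi> by (simp add: complex_eq_iff Re_divide_of_real Im_divide_of_real)
  then have "omega (- 1 + \<i> * of_real l * of_real \<xi> - of_real \<delta>) (- \<xi>) = 1 - cauchy wc (Complex l (\<delta> / \<xi>)) / (\<i> * of_real (- \<xi>))" for \<delta>
    using omega_eq[of "- \<xi>"] \<xi> by (metis neg_equal_0_iff_equal)
  then have "omega (- 1 + \<i> * of_real l * of_real \<xi> - of_real \<delta>) (- \<xi>) = 1 + cauchy wc (Complex l (\<delta> / \<xi>)) / (\<i> * of_real \<xi>)" for \<delta>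
    by simp
  moreover have "((\<lambda>\<delta>. 1 + cauchy wc (Complex l (\<delta> / \<xi>)) / (\<i> * of_real \<xi>)) \<longlongrightarrow> 1 + w_boundary \<xi> l / (\<i> * of_real \<xi>)) (at_right 0)"
    using \<xi> by (intro tendsto_intros cauchy_w_boundary_scaled) auto
  ultimately show ?thesis
    unfolding omega_minus_def by (simp add: tendsto_Lim)
qed

text \<open>Conjugating \<open>omega_plus\<close> moves the boundary value of the Gaussian transform
  to the side of \<open>- \<xi>\<close>, which is the side on which \<open>S_hat\<close> is
  taken.\<close>

lemma U_op_eq:
  assumes \<xi>: "\<xi> \<noteq> 0"
  shows "U_op \<xi> f l = f l - S_hat (- sgn \<xi>) (\<lambda>z. f z * wc z) l / (\<i> * of_real \<xi> + w_boundary (- \<xi>) l)"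
proof -
  have "\<i> * of_real \<xi> * cnj (1 - w_boundary \<xi> l / (\<i> * of_real \<xi>)) = \<i> * of_real \<xi> + w_boundary (- \<xi>) l"
    using \<xi> by (simp add: w_boundary_cnj field_simps)
  then show ?thesis by (simp only: U_op_def omega_plus_boundary[OF \<xi>])
qed

lemma B_op_eq:
  assumes \<xi>: "\<xi> \<noteq> 0"
  shows "B_op \<xi> f l = f l + S_hat (- sgn \<xi>) (\<lambda>z. f z * wc z) l / (\<i> * of_real \<xi> - w_boundary (- \<xi>) l)"
proof -
  have "\<i> * of_real \<xi> * cnj (1 + w_boundary \<xi> l / (\<i> * of_real \<xi>)) = \<i> * of_real \<xi> - w_boundary (- \<xi>) l"
    using \<xi> by (simp add: w_boundary_cnj field_simps)
  then show ?thesis by (simp only: B_op_def omega_minus_boundary[OF \<xi>])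
qed

section \<open>The weighted space\<close>

lemma L2w_measurable: "f \<in> L2w \<Longrightarrow> f \<in> borel_measurable borel"
  and L2w_integrable: "f \<in> L2w \<Longrightarrow> integrable lborel (\<lambda>v. (cmod (f v))\<^sup>2 * w v)"
  by (auto simp: L2w_def)

lemma L2w_mult_integrable:
  assumes f: "f \<in> L2w" and g: "g \<in> L2w"
  shows "integrable lborel (\<lambda>v. f v * cnj (g v) * wc v)"
proof (rule Bochner_Integration.integrable_bound)
  show "integrable lborel (\<lambda>v. (cmod (f v))\<^sup>2 * w v + (cmod (g v))\<^sup>2 * w v)"
    using f g by (simp add: L2w_integrable)
  have [measurable]: "f \<in> borel_measurable borel" "g \<in> borel_measurable borel"
    using f g by (auto intro: L2w_measurable)
  show "(\<lambda>v. f v * cnj (g v) * wc v) \<in> borel_measurable lborel" by measurable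
  have "cmod (f v * cnj (g v) * wc v) \<le> (cmod (f v))\<^sup>2 * w v + (cmod (g v))\<^sup>2 * w v" for v
    using mult_right_mono[OF prod_le_sum_squares[of "cmod (f v)" "cmod (g v)"], of "w v"] w_pos[of v]
    by (simp add: norm_mult distrib_right abs_of_pos)
  then show "AE v in lborel. norm (f v * cnj (g v) * wc v) \<le> norm ((cmod (f v))\<^sup>2 * w v + (cmod (g v))\<^sup>2 * w v)"
    by (auto intro: order_trans[OF _ abs_ge_self])
qed

lemma bounded_L2w:
  assumes "f \<in> borel_measurable borel" "\<And>v. cmod (f v) \<le> B"
  shows "f \<in> L2w"
proof -
  have "integrable lborel (\<lambda>v. (cmod (f v))\<^sup>2 * w v)"
  proof (rule Bochner_Integration.integrable_bound)
    show "integrable lborel (\<lambda>v. B\<^sup>2 * w v)" using w_integrable by simp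
    show "(\<lambda>v. (cmod (f v))\<^sup>2 * w v) \<in> borel_measurable lborel" using assms by simp
    show "AE v in lborel. norm ((cmod (f v))\<^sup>2 * w v) \<le> norm (B\<^sup>2 * w v)"
      using assms(2) by (auto simp: abs_mult intro!: mult_right_mono power_mono)
  qed
  then show ?thesis using assms(1) by (simp add: L2w_def)
qed

text \<open>Pairing with the constant 1 gives integrability, and \<open>w \<le> 1\<close> gives
  \<open>w\<^sup>2 \<le> w\<close> and with it square integrability. So the transform of
  \<open>f w\<close> has boundary values in both senses.\<close>

lemma L2w_times_w:
  assumes f: "f \<in> L2w"
  shows "integrable lborel (\<lambda>v. f v * wc v)" "(\<lambda>v. f v * wc v) \<in> L2"
proof -
  have "(\<lambda>_. 1) \<in> L2w" by (rule bounded_L2w[where B = 1]) auto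
  from L2w_mult_integrable[OF f this] show "integrable lborel (\<lambda>v. f v * wc v)" by simp
  have [measurable]: "f \<in> borel_measurable borel" using f by (rule L2w_measurable)
  have "integrable lborel (\<lambda>v. (cmod (f v * wc v))\<^sup>2)"
  proof (rule Bochner_Integration.integrable_bound[OF L2w_integrable[OF f]])
    have "w v * w v \<le> 1 * w v" for v using w_pos[of v] w_le_1[of v] by (intro mult_right_mono) auto
    then have "(cmod (f v * wc v))\<^sup>2 \<le> (cmod (f v))\<^sup>2 * w v" for v
      using w_pos[of v] by (simp add: norm_mult power_mult_distrib power2_eq_square[of "w v"] mult_left_mono)
    then show "AE v in lborel. norm ((cmod (f v * wc v))\<^sup>2) \<le> norm ((cmod (f v))\<^sup>2 * w v)"
      by (auto intro: order_trans[OF _ abs_ge_self])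
  qed measurable
  then show "(\<lambda>v. f v * wc v) \<in> L2" by (simp add: L2_def)
qed

lemma L2w_cnj: "f \<in> L2w \<Longrightarrow> (\<lambda>v. cnj (f v)) \<in> L2w"
  by (simp add: L2w_def measurable_cnj)

text \<open>The lower counterpart of \<open>disp \<xi>\<close> is \<open>- disp (- \<xi>)\<close> after reflection, because the Cauchy
  transform of \<open>w\<close> is odd.\<close>

theorem boundary_integral_lower:
  assumes \<xi>: "\<xi> \<noteq> 0" "\<xi> \<noteq> - sqrt pi"
    and h: "integrable lborel h" "h \<in> L2" and k: "integrable lborel k" "k \<in> L2"
  shows "integrable lborel (\<lambda>x. 1 / (\<i> * of_real \<xi> - w_boundary (-1) x) * S_hat (-1) h x * S_hat (-1) k x)"
    "(LINT x|lborel. 1 / (\<i> * of_real \<xi> - w_boundary (-1) x) * S_hat (-1) h x * S_hat (-1) k x) =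
      - (2 * of_real pi * \<i> * upper_residue (- \<xi>) (\<lambda>t. h (- t)) (\<lambda>t. k (- t)))"
proof -
  define g where "g = (\<lambda>x. 1 / disp (- \<xi>) (of_real x) * S_hat 1 (\<lambda>t. h (- t)) x * S_hat 1 (\<lambda>t. k (- t)) x)"
  have up: "integrable lborel g" "(LINT x|lborel. g x) = 2 * of_real pi * \<i> * upper_residue (- \<xi>) (\<lambda>t. h (- t)) (\<lambda>t. k (- t))"
    unfolding g_def using \<xi> by (intro boundary_integral_upper integrable_reflect L2_reflect h k; force)+
  let ?f = "\<lambda>x. 1 / (\<i> * of_real \<xi> - w_boundary (-1) x) * S_hat (-1) h x * S_hat (-1) k x"
  have [measurable]: "S_hat (-1) h \<in> borel_measurable borel" "S_hat (-1) k \<in> borel_measurable borel"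
    by (intro S_hat_measurable h k)+
  have f: "?f \<in> borel_measurable lborel" by measurable
  have g: "(\<lambda>x. - g (- x)) \<in> borel_measurable lborel"
    using integrable_reflect[OF up(1)] by auto
  have eq: "AE x in lborel. ?f x = - g (- x)"
    using S_hat_reflect[OF h] S_hat_reflect[OF k]
  proof eventually_elim
    case (elim x)
    have "\<i> * of_real \<xi> - w_boundary (-1) x = - disp (- \<xi>) (of_real (- x))"
      by (simp add: disp_def faddeeva_reflect w_boundary_def)
    then show ?case by (simp add: g_def elim)
  qed
  show "integrable lborel ?f"
    using integrable_cong_AE[OF f g eq] integrable_reflect[OF up(1)] by simp
  have "(LINT x|lborel. ?f x) = (LINT x|lborel. - g (- x))"
    by (rule integral_cong_AE[OF f g eq])
  also have "\<dots> = - (LINT x|lborel. g x)"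
    using lborel_integral_real_affine[of "-1" g 0] by simp
  finally show "(LINT x|lborel. ?f x) = - (2 * of_real pi * \<i> * upper_residue (- \<xi>) (\<lambda>t. h (- t)) (\<lambda>t. k (- t)))"
    by (simp add: up(2))
qed

section \<open>The form of \<open>U\<^sup>*B\<close>\<close>

text \<open>Multiplied by \<open>c = 2 * pi * \<i>\<close>, the densities \<open>f w\<close>,
  \<open>cnj g w\<close> and \<open>w\<close> become jumps. Since \<open>c w\<close> is the
  difference of the two denominators, the term with \<open>1 / (Dp * Dm)\<close> splits into partial
  fractions, and these cancel exactly the products of boundary values from different sides.\<close>

lemma UB_integrand_eq:
  assumes \<xi>: "\<xi> \<noteq> 0" and f: "f \<in> L2w" and g: "g \<in> L2w"
    and nz: "\<And>l. \<i> * of_real \<xi> - w_boundary 1 l \<noteq> 0" "\<And>l. \<i> * of_real \<xi> - w_boundary (-1) l \<noteq> 0"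
  defines "h \<equiv> \<lambda>z. f z * wc z" and "k \<equiv> \<lambda>z. cnj (g z) * wc z"
  shows "AE l in lborel. B_op \<xi> f l * cnj (U_op \<xi> g l) * wc l = f l * cnj (g l) * wc l +
     1 / (2 * of_real pi * \<i>) * (1 / (\<i> * of_real \<xi> - w_boundary 1 l) * S_hat 1 h l * S_hat 1 k l
      - 1 / (\<i> * of_real \<xi> - w_boundary (-1) l) * S_hat (-1) h l * S_hat (-1) k l)"
proof -
  have h: "integrable lborel h" "h \<in> L2" unfolding h_def using L2w_times_w[OF f] by auto
  have k: "integrable lborel k" "k \<in> L2" unfolding k_def using L2w_times_w[OF L2w_cnj[OF g]] by auto
  have "(\<lambda>t. cnj (g t * wc t)) = k" by (simp add: k_def fun_eq_iff)
  moreover have "sgn \<xi> \<noteq> 0" using \<xi> by (simp add: sgn_if)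
  ultimately have conj: "AE l in lborel. cnj (S_hat (- sgn \<xi>) (\<lambda>z. g z * wc z) l) = S_hat (sgn \<xi>) k l"
    using S_hat_cnj[OF L2w_times_w[OF g], of "- sgn \<xi>"] by simp
  show ?thesis
    using conj S_hat_jump[OF h] S_hat_jump[OF k] w_boundary_jump
  proof eventually_elim
    case (elim l)
    define s where "s = sgn \<xi>"
    have s: "s = 1 \<or> s = -1" using \<xi> by (auto simp: s_def sgn_if)
    define Dp Dm where "Dp = \<i> * of_real \<xi> - w_boundary 1 l" and "Dm = \<i> * of_real \<xi> - w_boundary (-1) l"
    have Dnz: "Dp \<noteq> 0" "Dm \<noteq> 0" using nz by (auto simp: Dp_def Dm_def)
    define Fp Fm Hp Hm where "Fp = S_hat 1 h l" and "Fm = S_hat (-1) h l" and "Hp = S_hat 1 k l" and "Hm = S_hat (-1) k l"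
    define c where "c = 2 * of_real pi * \<i>"
    have c: "c \<noteq> 0" by (simp add: c_def)
    have jumps: "c * (f l * wc l) = Fp - Fm" "c * (cnj (g l) * wc l) = Hp - Hm" "c * wc l = Dm - Dp"
      using elim by (simp_all add: c_def Fp_def Fm_def Hp_def Hm_def Dp_def Dm_def h_def k_def)
    have wb: "w_boundary \<xi> l = w_boundary s l" "w_boundary (- \<xi>) l = w_boundary (- s) l"
      using \<xi> by (auto simp: w_boundary_def s_def sgn_if)
    have B: "B_op \<xi> f l = f l + S_hat (- s) h l / (\<i> * of_real \<xi> - w_boundary (- s) l)"
      unfolding B_op_eq[OF \<xi>] wb h_def s_def ..
    have "cnj (\<i> * of_real \<xi> + w_boundary (- \<xi>) l) = - (\<i> * of_real \<xi> - w_boundary s l)"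
      using \<xi> s unfolding wb by (auto simp: w_boundary_def)
    note wcnj = this
    have U: "cnj (U_op \<xi> g l) = cnj (g l) + S_hat s k l / (\<i> * of_real \<xi> - w_boundary s l)"
      unfolding U_op_eq[OF \<xi>]
      by (simp only: complex_cnj_diff complex_cnj_divide elim(1) wcnj divide_minus_right diff_minus_eq_add s_def)
    \<comment> \<open>The first alternative is \<xi> > 0, where \<open>B_op\<close> takes lower and
      the conjugate of \<open>U_op\<close> upper boundary values; for \<xi> < 0 it is the reverse.
      Both lead to the same symmetric expression.\<close>
    have BU: "B_op \<xi> f l * cnj (U_op \<xi> g l) = (f l + Fm / Dm) * (cnj (g l) + Hp / Dp) \<or>
        B_op \<xi> f l * cnj (U_op \<xi> g l) = (f l + Fp / Dp) * (cnj (g l) + Hm / Dm)"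
      using s unfolding B U by (auto simp: Dp_def Dm_def Fp_def Fm_def Hp_def Hm_def)
    have "c * ((f l + Fm / Dm) * (cnj (g l) + Hp / Dp) * wc l) =
      c * (f l * cnj (g l) * wc l) + (c * (f l * wc l)) * (Hp / Dp) + (c * (cnj (g l) * wc l)) * (Fm / Dm) + (c * wc l) * (Fm / Dm * (Hp / Dp))"
      by (simp add: algebra_simps)
    also have "\<dots> = c * (f l * cnj (g l) * wc l) + (Fp * Hp / Dp - Fm * Hm / Dm)"
      unfolding jumps using Dnz by (simp add: field_simps)
    finally have 1: "c * ((f l + Fm / Dm) * (cnj (g l) + Hp / Dp) * wc l) = c * (f l * cnj (g l) * wc l) + (Fp * Hp / Dp - Fm * Hm / Dm)" .
    have "c * ((f l + Fp / Dp) * (cnj (g l) + Hm / Dm) * wc l) =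
      c * (f l * cnj (g l) * wc l) + (c * (f l * wc l)) * (Hm / Dm) + (c * (cnj (g l) * wc l)) * (Fp / Dp) + (c * wc l) * (Fp / Dp * (Hm / Dm))"
      by (simp add: algebra_simps)
    also have "\<dots> = c * (f l * cnj (g l) * wc l) + (Fp * Hp / Dp - Fm * Hm / Dm)"
      unfolding jumps using Dnz by (simp add: field_simps)
    finally have 2: "c * ((f l + Fp / Dp) * (cnj (g l) + Hm / Dm) * wc l) = c * (f l * cnj (g l) * wc l) + (Fp * Hp / Dp - Fm * Hm / Dm)" .
    have "c * (B_op \<xi> f l * cnj (U_op \<xi> g l) * wc l) = c * (f l * cnj (g l) * wc l) + (Fp * Hp / Dp - Fm * Hm / Dm)"
      using BU 1 2 by metis
    then have "B_op \<xi> f l * cnj (U_op \<xi> g l) * wc l = f l * cnj (g l) * wc l + 1 / c * (Fp * Hp / Dp - Fm * Hm / Dm)"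
      using c by (simp add: field_simps)
    then show ?case
      by (simp add: c_def Dp_def Dm_def Fp_def Fm_def Hp_def Hm_def)
  qed
qed

lemma disp_real_nonzero:
  assumes "\<xi> \<noteq> 0" "\<xi> \<noteq> sqrt pi"
  shows "disp \<xi> (of_real x) \<noteq> 0"
  using disp_zero_iff[of "of_real x" \<xi>] assms axis_0 by auto

lemma U_op_measurable:
  assumes \<xi>: "\<xi> \<noteq> 0" and f: "f \<in> L2w"
  shows "U_op \<xi> f \<in> borel_measurable borel" "B_op \<xi> f \<in> borel_measurable borel"
proof -
  have [measurable]: "f \<in> borel_measurable borel" using f by (rule L2w_measurable)
  have [measurable]: "S_hat (- sgn \<xi>) (\<lambda>z. f z * wc z) \<in> borel_measurable borel"
    by (intro S_hat_measurable L2w_times_w f)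
  show "U_op \<xi> f \<in> borel_measurable borel" "B_op \<xi> f \<in> borel_measurable borel"
    unfolding U_op_eq[OF \<xi>, abs_def] B_op_eq[OF \<xi>, abs_def] by measurable
qed

text \<open>The lower boundary term is subtracted and its integral itself carries a minus sign, so
  the two residues are added. At most one of them is nonzero, depending on the sign of
  \<xi>.\<close>

theorem UB_form_eq:
  assumes \<xi>: "\<xi> \<noteq> 0" "\<bar>\<xi>\<bar> \<noteq> sqrt pi" and f: "f \<in> L2w" and g: "g \<in> L2w"
  defines "h \<equiv> \<lambda>z. f z * wc z" and "k \<equiv> \<lambda>z. cnj (g z) * wc z"
  shows "UB_form \<xi> f g = innerw f g + upper_residue \<xi> h k + upper_residue (- \<xi>) (\<lambda>t. h (- t)) (\<lambda>t. k (- t))"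
proof -
  have \<xi>': "\<xi> \<noteq> sqrt pi" "\<xi> \<noteq> - sqrt pi" using \<xi>(2) by auto
  have h: "integrable lborel h" "h \<in> L2" unfolding h_def using L2w_times_w[OF f] by auto
  have k: "integrable lborel k" "k \<in> L2" unfolding k_def using L2w_times_w[OF L2w_cnj[OF g]] by auto
  have Dp: "\<i> * of_real \<xi> - w_boundary 1 l = disp \<xi> (of_real l)" for l
    by (simp add: disp_def w_boundary_def)
  have Dm: "\<i> * of_real \<xi> - w_boundary (-1) l = - disp (- \<xi>) (of_real (- l))" for l
    by (simp add: disp_def faddeeva_reflect w_boundary_def)
  have nz: "\<i> * of_real \<xi> - w_boundary 1 l \<noteq> 0" "\<i> * of_real \<xi> - w_boundary (-1) l \<noteq> 0" for l
    unfolding Dp Dm using disp_real_nonzero[of \<xi> l] disp_real_nonzero[of "- \<xi>" "- l"] \<xi>(1) \<xi>'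
    by (auto simp: minus_equation_iff)
  let ?p = "\<lambda>l. 1 / (\<i> * of_real \<xi> - w_boundary 1 l) * S_hat 1 h l * S_hat 1 k l"
  let ?m = "\<lambda>l. 1 / (\<i> * of_real \<xi> - w_boundary (-1) l) * S_hat (-1) h l * S_hat (-1) k l"
  have p: "integrable lborel ?p" "(LINT l|lborel. ?p l) = 2 * of_real pi * \<i> * upper_residue \<xi> h k"
    unfolding Dp using boundary_integral_upper[OF \<xi>(1) \<xi>'(1) h k] by auto
  have m: "integrable lborel ?m"
    "(LINT l|lborel. ?m l) = - (2 * of_real pi * \<i> * upper_residue (- \<xi>) (\<lambda>t. h (- t)) (\<lambda>t. k (- t)))"
    using boundary_integral_lower[OF \<xi>(1) \<xi>'(2) h k] by auto
  note fg = L2w_mult_integrable[OF f g]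
  have int: "integrable lborel (\<lambda>l. f l * cnj (g l) * wc l + 1 / (2 * of_real pi * \<i>) * (?p l - ?m l))"
    by (intro Bochner_Integration.integrable_add fg integrable_mult_right Bochner_Integration.integrable_diff p m)
  have "UB_form \<xi> f g = (LINT l|lborel. B_op \<xi> f l * cnj (U_op \<xi> g l) * wc l)"
    using \<xi> by (simp add: UB_form_def)
  also have "\<dots> = (LINT l|lborel. f l * cnj (g l) * wc l + 1 / (2 * of_real pi * \<i>) * (?p l - ?m l))"
  proof (rule integral_cong_AE)
    have [measurable]: "B_op \<xi> f \<in> borel_measurable borel" "U_op \<xi> g \<in> borel_measurable borel"
      using U_op_measurable[OF \<xi>(1)] f g by auto
    show "(\<lambda>l. B_op \<xi> f l * cnj (U_op \<xi> g l) * wc l) \<in> borel_measurable lborel" by measurable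
    show "(\<lambda>l. f l * cnj (g l) * wc l + 1 / (2 * of_real pi * \<i>) * (?p l - ?m l)) \<in> borel_measurable lborel"
      using int by (rule borel_measurable_integrable)
    show "AE l in lborel. B_op \<xi> f l * cnj (U_op \<xi> g l) * wc l = f l * cnj (g l) * wc l + 1 / (2 * of_real pi * \<i>) * (?p l - ?m l)"
      unfolding h_def k_def by (rule UB_integrand_eq[OF \<xi>(1) f g nz])
  qed
  also have "\<dots> = innerw f g + 1 / (2 * of_real pi * \<i>) * ((LINT l|lborel. ?p l) - (LINT l|lborel. ?m l))"
    unfolding innerw_def
    by (simp only: Bochner_Integration.integral_add[OF fg integrable_mult_right[OF Bochner_Integration.integrable_diff[OF p(1) m(1)]]]
        integral_mult_right_zero Bochner_Integration.integral_diff[OF p(1) m(1)])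
  also have "\<dots> = innerw f g + upper_residue \<xi> h k + upper_residue (- \<xi>) (\<lambda>t. h (- t)) (\<lambda>t. k (- t))"
    unfolding p(2) m(2) by (simp add: field_simps)
  finally show ?thesis .
qed

section \<open>The resolvent and the Riesz projection\<close>

lemma symbol_bounds:
  assumes \<mu>: "Re \<mu> > -1"
  shows "\<i> * of_real v * of_real \<xi> + 1 + \<mu> \<noteq> 0"
    "cmod (1 / (\<i> * of_real v * of_real \<xi> + 1 + \<mu>)) \<le> 1 / (1 + Re \<mu>)"
proof -
  have "Re (\<i> * of_real v * of_real \<xi> + 1 + \<mu>) = 1 + Re \<mu>" by simp
  then have ge: "1 + Re \<mu> \<le> cmod (\<i> * of_real v * of_real \<xi> + 1 + \<mu>)"
    using complex_Re_le_cmod[of "\<i> * of_real v * of_real \<xi> + 1 + \<mu>"] by simp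
  then show "cmod (1 / (\<i> * of_real v * of_real \<xi> + 1 + \<mu>)) \<le> 1 / (1 + Re \<mu>)"
    using \<mu> by (simp add: norm_divide frac_le)
  show "\<i> * of_real v * of_real \<xi> + 1 + \<mu> \<noteq> 0" using ge \<mu> by auto
qed

lemma symbol_measurable: "(\<lambda>v. 1 / (\<i> * of_real v * of_real \<xi> + 1 + \<mu>)) \<in> borel_measurable borel"
  by measurable

lemma L2w_mult_bounded:
  assumes f: "f \<in> L2w" and r: "r \<in> borel_measurable borel" and B: "\<And>x. cmod (r x) \<le> B"
  shows "(\<lambda>x. f x * r x) \<in> L2w"
proof -
  have "integrable lborel (\<lambda>x. (cmod (f x * r x))\<^sup>2 * w x)"
  proof (rule Bochner_Integration.integrable_bound)
    show "integrable lborel (\<lambda>x. B\<^sup>2 * ((cmod (f x))\<^sup>2 * w x))"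
      using f by (intro integrable_mult_right L2w_integrable)
    have [measurable]: "f \<in> borel_measurable borel" "r \<in> borel_measurable borel" using f r by (auto intro: L2w_measurable)
    show "(\<lambda>x. (cmod (f x * r x))\<^sup>2 * w x) \<in> borel_measurable lborel" by measurable
    have "(cmod (f x * r x))\<^sup>2 * w x \<le> B\<^sup>2 * ((cmod (f x))\<^sup>2 * w x)" for x
    proof -
      have "(cmod (r x))\<^sup>2 * ((cmod (f x))\<^sup>2 * w x) \<le> B\<^sup>2 * ((cmod (f x))\<^sup>2 * w x)"
        using B w_pos[of x] by (intro mult_right_mono power_mono mult_nonneg_nonneg) (auto intro: less_imp_le)
      then show ?thesis by (simp add: norm_mult power_mult_distrib mult_ac)
    qed
    then show "AE x in lborel. norm ((cmod (f x * r x))\<^sup>2 * w x) \<le> norm (B\<^sup>2 * ((cmod (f x))\<^sup>2 * w x))"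
      using w_pos by (intro always_eventually allI) (simp add: abs_mult abs_of_pos)
  qed
  then show ?thesis using L2w_measurable[OF f] r by (simp add: L2w_def)
qed

lemma L2w_add:
  assumes f: "f \<in> L2w" and g: "g \<in> L2w"
  shows "(\<lambda>x. f x + g x) \<in> L2w"
proof -
  have [measurable]: "f \<in> borel_measurable borel" "g \<in> borel_measurable borel" using f g by (auto intro: L2w_measurable)
  have "integrable lborel (\<lambda>x. (cmod (f x + g x))\<^sup>2 * w x)"
  proof (rule Bochner_Integration.integrable_bound)
    show "integrable lborel (\<lambda>x. 2 * ((cmod (f x))\<^sup>2 * w x) + 2 * ((cmod (g x))\<^sup>2 * w x))"
      using f g by (intro Bochner_Integration.integrable_add integrable_mult_right L2w_integrable)
    show "(\<lambda>x. (cmod (f x + g x))\<^sup>2 * w x) \<in> borel_measurable lborel" by measurable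
    have "(cmod (f x + g x))\<^sup>2 * w x \<le> 2 * ((cmod (f x))\<^sup>2 * w x) + 2 * ((cmod (g x))\<^sup>2 * w x)" for x
    proof -
      have "(cmod (f x + g x))\<^sup>2 \<le> (cmod (f x) + cmod (g x))\<^sup>2"
        by (intro power_mono norm_triangle_ineq) auto
      then have "(cmod (f x + g x))\<^sup>2 \<le> 2 * (cmod (f x))\<^sup>2 + 2 * (cmod (g x))\<^sup>2"
        using sum_squares_bound[of "cmod (f x)" "cmod (g x)"] by (simp add: power2_sum)
      from mult_right_mono[OF this, of "w x"] show ?thesis using w_pos[of x] by (simp add: distrib_right mult.assoc)
    qed
    moreover have "0 \<le> (cmod (f x + g x))\<^sup>2 * w x" for x using w_pos[of x] by simp
    ultimately show "AE x in lborel. norm ((cmod (f x + g x))\<^sup>2 * w x) \<le> norm (2 * ((cmod (f x))\<^sup>2 * w x) + 2 * ((cmod (g x))\<^sup>2 * w x))"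
      by (intro always_eventually allI) (metis abs_ge_self abs_of_nonneg order_trans real_norm_def)
  qed
  then show ?thesis by (simp add: L2w_def)
qed

lemma const_L2w: "(\<lambda>_. c) \<in> L2w"
  by (rule bounded_L2w[where B = "cmod c"]) auto

lemma innerw_add:
  assumes "f \<in> L2w" "f' \<in> L2w" "g \<in> L2w"
  shows "innerw (\<lambda>v. f v + f' v) g = innerw f g + innerw f' g"
  using L2w_mult_integrable[OF assms(1,3)] L2w_mult_integrable[OF assms(2,3)]
  by (simp add: innerw_def distrib_right)

lemma innerw_cong_AE:
  assumes "f \<in> borel_measurable borel" "f' \<in> borel_measurable borel" "g \<in> L2w" "AE v in lborel. f v = f' v"
  shows "innerw f g = innerw f' g"
proof -
  have [measurable]: "g \<in> borel_measurable borel" using assms by (auto intro: L2w_measurable)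
  show ?thesis
    unfolding innerw_def using assms by (intro integral_cong_AE) (measurable, auto)
qed

lemma integral_symbol:
  assumes \<xi>: "\<xi> \<noteq> 0"
  shows "(LINT v|lborel. h v * (1 / (\<i> * of_real v * of_real \<xi> + 1 + \<mu>))) =
    cauchy h (\<i> * (1 + \<mu>) / of_real \<xi>) / (\<i> * of_real \<xi>)"
proof -
  have "\<i> * of_real v * of_real \<xi> + 1 + \<mu> = (of_real v - \<i> * (1 + \<mu>) / of_real \<xi>) * (\<i> * of_real \<xi>)" for v :: real
    using \<xi> by (simp add: field_simps)
  then have "(LINT v|lborel. h v * (1 / (\<i> * of_real v * of_real \<xi> + 1 + \<mu>))) =
     (LINT v|lborel. h v / (of_real v - \<i> * (1 + \<mu>) / of_real \<xi>) / (\<i> * of_real \<xi>))"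
    by (simp only: divide_divide_eq_left times_divide_eq_right mult_1_right)
  also have "\<dots> = cauchy h (\<i> * (1 + \<mu>) / of_real \<xi>) / (\<i> * of_real \<xi>)"
    unfolding cauchy_def by (rule integral_divide_zero)
  finally show ?thesis .
qed

text \<open>The operator is multiplication by \<open>- S\<close> plus a rank-one term once \<mu> is
  subtracted, so a solution has the form \<open>(c - f) / S\<close> with \<open>c\<close> its own
  mean. Taking means leaves the scalar equation \<open>c * omega \<mu> \<xi> = - a\<close>, solvable
  because \<open>omega\<close> does not vanish.\<close>

lemma resolvent_inner:
  assumes \<xi>: "\<xi> \<noteq> 0" and \<mu>: "Re \<mu> > -1" and nz: "omega \<mu> \<xi> \<noteq> 0" and f: "f \<in> L2w" and g: "g \<in> L2w"
  defines "Z \<equiv> \<i> * (1 + \<mu>) / of_real \<xi>"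
  shows "innerw (resolvent \<xi> \<mu> f) g =
    - (cauchy (\<lambda>v. f v * wc v) Z / (\<i> * of_real \<xi>)) * (cauchy (\<lambda>v. cnj (g v) * wc v) Z / (\<i> * of_real \<xi>)) / omega \<mu> \<xi>
    - cauchy (\<lambda>v. f v * cnj (g v) * wc v) Z / (\<i> * of_real \<xi>)"
proof -
  define S where "S = (\<lambda>v::real. \<i> * of_real v * of_real \<xi> + 1 + \<mu>)"
  define r where "r = (\<lambda>v. 1 / S v)"
  have S_nz: "S v \<noteq> 0" and r_bd: "cmod (r v) \<le> 1 / (1 + Re \<mu>)" for v
    using symbol_bounds[OF \<mu>, of v \<xi>] by (auto simp: S_def r_def)
  have [measurable]: "r \<in> borel_measurable borel" unfolding r_def S_def by (rule symbol_measurable)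
  have r_int: "(LINT v|lborel. h v * r v) = cauchy h Z / (\<i> * of_real \<xi>)" for h
    unfolding r_def S_def Z_def by (rule integral_symbol[OF \<xi>])
  have [measurable]: "f \<in> borel_measurable borel" using f by (rule L2w_measurable)
  define a where "a = cauchy (\<lambda>v. f v * wc v) Z / (\<i> * of_real \<xi>)"
  have om: "omega \<mu> \<xi> = 1 - (LINT v|lborel. wc v * r v)"
    by (simp add: omega_def r_def S_def)
  have fr: "(\<lambda>v. f v * r v) \<in> L2w" by (rule L2w_mult_bounded[OF f _ r_bd]) measurable
  have cr: "(\<lambda>v. c * r v) \<in> L2w" for c by (rule L2w_mult_bounded[OF const_L2w _ r_bd]) measurable
  have fr': "(\<lambda>v. - 1 * (f v * r v)) \<in> L2w"
    using L2w_mult_bounded[OF fr, of "\<lambda>_. - 1" 1] by (simp add: mult.commute)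
  define H where "H = (\<lambda>c v. c * r v + - 1 * (f v * r v))"
  have H_L2w: "H c \<in> L2w" for c unfolding H_def by (intro L2w_add cr fr')
  have H_inner: "innerw (H c) g' = c * (cauchy (\<lambda>v. cnj (g' v) * wc v) Z / (\<i> * of_real \<xi>))
      - cauchy (\<lambda>v. f v * cnj (g' v) * wc v) Z / (\<i> * of_real \<xi>)" if "g' \<in> L2w" for c g'
  proof -
    have "innerw (\<lambda>v. c * r v) g' = (LINT v|lborel. c * ((cnj (g' v) * wc v) * r v))"
      unfolding innerw_def by (simp add: mult_ac)
    also have "\<dots> = c * (cauchy (\<lambda>v. cnj (g' v) * wc v) Z / (\<i> * of_real \<xi>))"
      unfolding integral_mult_right_zero r_int ..
    finally have 1: "innerw (\<lambda>v. c * r v) g' = c * (cauchy (\<lambda>v. cnj (g' v) * wc v) Z / (\<i> * of_real \<xi>))" .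
    have "innerw (\<lambda>v. - 1 * (f v * r v)) g' = (LINT v|lborel. - 1 * ((f v * cnj (g' v) * wc v) * r v))"
      unfolding innerw_def by (simp add: mult_ac)
    also have "\<dots> = - 1 * (cauchy (\<lambda>v. f v * cnj (g' v) * wc v) Z / (\<i> * of_real \<xi>))"
      unfolding integral_mult_right_zero r_int ..
    finally have 2: "innerw (\<lambda>v. - 1 * (f v * r v)) g' = - 1 * (cauchy (\<lambda>v. f v * cnj (g' v) * wc v) Z / (\<i> * of_real \<xi>))" .
    show ?thesis unfolding H_def innerw_add[OF cr fr' that] 1 2 by simp
  qed
  have H_mean: "innerw (H c) (\<lambda>_. 1) = c * (1 - omega \<mu> \<xi>) - a" for c
  proof -
    have "cauchy wc Z / (\<i> * of_real \<xi>) = 1 - omega \<mu> \<xi>" unfolding om r_int by simp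
    then show ?thesis using H_inner[OF const_L2w[of 1], of c] by (simp add: a_def)
  qed
  define c0 where "c0 = - a / omega \<mu> \<xi>"
  have eqn: "L \<xi> h v - \<mu> * h v = f v \<longleftrightarrow> h v = H (innerw h (\<lambda>_. 1)) v" for h v
  proof -
    have "L \<xi> h v - \<mu> * h v = innerw h (\<lambda>_. 1) - S v * h v"
      by (simp add: L_def V_def S_def algebra_simps)
    moreover have "H (innerw h (\<lambda>_. 1)) v = (innerw h (\<lambda>_. 1) - f v) / S v"
      by (simp add: H_def r_def diff_divide_distrib)
    moreover have "c - S v * y = f v \<longleftrightarrow> y = (c - f v) / S v" for c y
      using S_nz[of v] by (auto simp: eq_divide_eq algebra_simps)
    ultimately show ?thesis by simp
  qed
  have "innerw (H c0) (\<lambda>_. 1) = c0"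
    unfolding H_mean c0_def using nz by (simp add: field_simps)
  then have Heq: "L \<xi> (H c0) v - \<mu> * H c0 v = f v" for v by (simp add: eqn)
  have "L \<xi> (H c0) = (\<lambda>v. H c0 v * \<mu> + f v)"
    using Heq by (auto simp: fun_eq_iff algebra_simps)
  moreover have "(\<lambda>v. H c0 v * \<mu> + f v) \<in> L2w"
    by (intro L2w_add f L2w_mult_bounded[OF H_L2w, of _ "cmod \<mu>"]) auto
  ultimately have "H c0 \<in> dom_L \<xi>" using H_L2w by (simp add: dom_L_def)
  then have "\<exists>h. h \<in> dom_L \<xi> \<and> (AE v in lborel. L \<xi> h v - \<mu> * h v = f v)"
    using Heq by (intro exI[of _ "H c0"]) auto
  from someI_ex[OF this] have res: "resolvent \<xi> \<mu> f \<in> dom_L \<xi>"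
    "AE v in lborel. L \<xi> (resolvent \<xi> \<mu> f) v - \<mu> * resolvent \<xi> \<mu> f v = f v"
    unfolding resolvent_def by auto
  \<comment> \<open>\<open>resolvent\<close> is some solution up to null sets. It is determined
    through its own mean, which satisfies the scalar equation; \<open>H c0\<close> only served to
    show that a solution exists.\<close>
  define R where "R = resolvent \<xi> \<mu> f"
  define c where "c = innerw R (\<lambda>_. 1)"
  have R: "R \<in> borel_measurable borel" using res(1) by (simp add: R_def dom_L_def L2w_measurable)
  have RH: "AE v in lborel. R v = H c v" using res(2) unfolding R_def[symmetric] eqn c_def .
  have same: "innerw R g' = innerw (H c) g'" if "g' \<in> L2w" for g'
    by (rule innerw_cong_AE[OF R L2w_measurable[OF H_L2w] that RH])
  have "c = c * (1 - omega \<mu> \<xi>) - a" using same[OF const_L2w[of 1]] H_mean by (simp add: c_def)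
  then have "c * omega \<mu> \<xi> = - a" by (simp add: algebra_simps eq_neg_iff_add_eq_0)
  then have "c = - a / omega \<mu> \<xi>" using nz by (simp add: field_simps)
  then show ?thesis
    using same[OF g] H_inner[OF g, of c] by (simp add: R_def a_def)
qed

section \<open>The eigenvalue and the residue of the resolvent\<close>

lemma omega_has_derivative:
  assumes \<xi>: "\<xi> \<noteq> 0" and \<mu>: "Re \<mu> > -1"
  shows "((\<lambda>\<mu>. omega \<mu> \<xi>) has_field_derivative
    ((- 2 - 2 * (\<i> * (1 + \<mu>) / of_real \<xi>) * cauchy wc (\<i> * (1 + \<mu>) / of_real \<xi>)) / of_real (- (\<xi>\<^sup>2)))) (at \<mu>)"
proof -
  let ?Z = "\<lambda>\<mu>. \<i> * (1 + \<mu>) / complex_of_real \<xi>"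
  have Im: "Im (?Z \<mu>) \<noteq> 0" using \<xi> \<mu> by (simp add: Im_divide_of_real)
  have "(?Z has_field_derivative (\<i> / of_real \<xi>)) (at \<mu>)"
    using \<xi> by (auto intro!: derivative_eq_intros)
  from DERIV_chain2[OF cauchy_w_derivative[OF Im] this]
  have "((\<lambda>\<mu>. 1 - cauchy wc (?Z \<mu>) / (\<i> * of_real \<xi>)) has_field_derivative
      (0 - (- 2 - 2 * ?Z \<mu> * cauchy wc (?Z \<mu>)) * (\<i> / of_real \<xi>) / (\<i> * of_real \<xi>))) (at \<mu>)"
    by (intro DERIV_diff DERIV_const DERIV_cdivide)
  moreover have "0 - X * (\<i> / of_real \<xi>) / (\<i> * of_real \<xi>) = X / of_real (- (\<xi>\<^sup>2))" for X :: complex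
    using \<xi> by (simp add: power2_eq_square field_simps)
  ultimately show ?thesis unfolding omega_eq[OF \<xi>] by metis
qed

lemma cauchy_w_axis_signed:
  assumes \<xi>: "\<xi> \<noteq> 0" and y: "y > 0"
  shows "cauchy wc (\<i> * of_real (sgn \<xi> * y)) = \<i> * of_real (sgn \<xi> * axis_value y)"
proof -
  have base: "cauchy wc (\<i> * of_real y) = \<i> * of_real (axis_value y)"
    using faddeeva_axis[of y] cauchy_w_eq_faddeeva[of "Complex 0 y"] y by (simp add: Complex_eq)
  show ?thesis
    using \<xi> base cauchy_w_odd[of "\<i> * of_real y"] by (cases "\<xi> > 0") (auto simp: sgn_if)
qed

lemma omega_real:
  assumes \<xi>: "\<xi> \<noteq> 0" and l: "l > -1"
  shows "omega (of_real l) \<xi> = of_real (1 - axis_value ((1 + l) / \<bar>\<xi>\<bar>) / \<bar>\<xi>\<bar>)"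
proof -
  have "(1 + l) / \<bar>\<xi>\<bar> > 0" using \<xi> l by simp
  moreover have "sgn \<xi> * ((1 + l) / \<bar>\<xi>\<bar>) = (1 + l) / \<xi>"
    using \<xi> by (simp add: sgn_if minus_divide_left)
  then have "\<i> * (1 + of_real l) / of_real \<xi> = \<i> * complex_of_real (sgn \<xi> * ((1 + l) / \<bar>\<xi>\<bar>))" by simp
  moreover have "\<i> * of_real (sgn \<xi> * X) / (\<i> * of_real \<xi>) = complex_of_real (X / \<bar>\<xi>\<bar>)" for X
    using \<xi> by (simp add: sgn_if)
  ultimately show ?thesis
    unfolding omega_eq[OF \<xi>] by (simp only: cauchy_w_axis_signed[OF \<xi>]) simp
qed

text \<open>The substitution \<open>y = (1 + l) / |\<xi>|\<close> turns the zeros of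
  \<open>omega\<close> on the interval into solutions of \<open>axis_value y = |\<xi>|\<close>.
  Injectivity of \<open>axis_value\<close> justifies the definite description, and
  \<open>y * |\<xi>| < 1\<close> gives the upper bound 0.\<close>

lemma lambda_star_eq:
  assumes \<xi>: "\<xi> \<noteq> 0" and y: "y > 0" "axis_value y = \<bar>\<xi>\<bar>"
  shows "lambda_star \<xi> = y * \<bar>\<xi>\<bar> - 1" "-1 < lambda_star \<xi>" "lambda_star \<xi> < 0" "omega (of_real (lambda_star \<xi>)) \<xi> = 0"
proof -
  have lt: "y * \<bar>\<xi>\<bar> < 1" using axis_mult_less_1[of y] y by simp
  have pos: "y * \<bar>\<xi>\<bar> > 0" using y \<xi> by simp
  have zero: "omega (of_real (y * \<bar>\<xi>\<bar> - 1)) \<xi> = 0"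
    using omega_real[OF \<xi>, of "y * \<bar>\<xi>\<bar> - 1"] pos \<xi> y by simp
  show eq: "lambda_star \<xi> = y * \<bar>\<xi>\<bar> - 1"
    unfolding lambda_star_def
  proof (rule the_equality)
    show "y * \<bar>\<xi>\<bar> - 1 \<in> {-1<..0} \<and> omega (of_real (y * \<bar>\<xi>\<bar> - 1)) \<xi> = 0"
      using zero lt pos by simp
    fix l assume l: "l \<in> {-1<..0} \<and> omega (of_real l) \<xi> = 0"
    then have "complex_of_real (1 - axis_value ((1 + l) / \<bar>\<xi>\<bar>) / \<bar>\<xi>\<bar>) = 0" using omega_real[OF \<xi>, of l] by simp
    then have "axis_value ((1 + l) / \<bar>\<xi>\<bar>) = \<bar>\<xi>\<bar>" unfolding of_real_eq_0_iff using \<xi> by (simp add: field_simps)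
    then have "(1 + l) / \<bar>\<xi>\<bar> = y" using axis_inj[of "(1 + l) / \<bar>\<xi>\<bar>" y] y l by simp
    then show "l = y * \<bar>\<xi>\<bar> - 1" using \<xi> by (simp add: field_simps)
  qed
  show "-1 < lambda_star \<xi>" "lambda_star \<xi> < 0" "omega (of_real (lambda_star \<xi>)) \<xi> = 0"
    using eq lt pos zero by simp_all
qed

text \<open>Only the rank-one part \<open>a * b / omega\<close> of the resolvent is singular at the
  eigenvalue; \<open>d\<close> is holomorphic there and drops out. The derivative of
  \<open>omega\<close> at the zero is \<open>2 (1 - y |\<xi>|) / \<xi>\<^sup>2\<close>. Its
  \<open>\<xi>\<^sup>2\<close> cancels against \<open>(\<i> \<xi>)\<^sup>2\<close> from
  \<open>a\<close> and \<open>b\<close>, which leaves the minus sign.\<close>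

theorem riesz_form_eq:
  assumes \<xi>: "\<xi> \<noteq> 0" and y: "y > 0" "axis_value y = \<bar>\<xi>\<bar>" and f: "f \<in> L2w" and g: "g \<in> L2w"
  defines "Z0 \<equiv> \<i> * of_real (sgn \<xi> * y)"
  shows "riesz_form \<xi> f g = - (cauchy (\<lambda>v. f v * wc v) Z0 * cauchy (\<lambda>v. cnj (g v) * wc v) Z0 / (2 * of_real (1 - y * \<bar>\<xi>\<bar>)))"
proof -
  note ls = lambda_star_eq[OF \<xi> y]
  define l where "l = complex_of_real (lambda_star \<xi>)"
  define Z where "Z = (\<lambda>\<mu>. \<i> * (1 + \<mu>) / complex_of_real \<xi>)"
  define D where "D = {\<mu>. Re \<mu> > -1}"
  have D: "open D" "convex D" unfolding D_def by (rule open_halfspace_Re_gt, rule convex_halfspace_Re_gt)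
  have lD: "l \<in> D" using ls by (simp add: l_def D_def)
  have "sgn \<xi> * y = (1 + lambda_star \<xi>) / \<xi>" using \<xi> ls(1) by (simp add: sgn_if)
  then have Zl: "Z l = Z0" by (simp add: Z_def Z0_def l_def)
  have ZD: "Z ` D \<subseteq> {z. Im z \<noteq> 0}"
    using \<xi> by (auto simp: Z_def D_def Im_divide_of_real)
  have Zhol: "Z holomorphic_on D"
    unfolding Z_def using \<xi> by (intro holomorphic_intros) auto
  have chol: "(\<lambda>\<mu>. cauchy h (Z \<mu>) / (\<i> * of_real \<xi>)) holomorphic_on D" if h: "integrable lborel h" for h
  proof -
    have "(cauchy h \<circ> Z) holomorphic_on D"
      by (rule holomorphic_on_compose_gen[OF Zhol cauchy_holomorphic[OF h] ZD])
    then show ?thesis using \<xi> by (intro holomorphic_on_divide holomorphic_on_const) (auto simp: o_def)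
  qed
  define a b d where "a = (\<lambda>\<mu>. cauchy (\<lambda>v. f v * wc v) (Z \<mu>) / (\<i> * of_real \<xi>))"
    and "b = (\<lambda>\<mu>. cauchy (\<lambda>v. cnj (g v) * wc v) (Z \<mu>) / (\<i> * of_real \<xi>))"
    and "d = (\<lambda>\<mu>. cauchy (\<lambda>v. f v * cnj (g v) * wc v) (Z \<mu>) / (\<i> * of_real \<xi>))"
  have hol: "a holomorphic_on D" "b holomorphic_on D" "d holomorphic_on D"
    unfolding a_def b_def d_def
    by (intro chol L2w_times_w f L2w_cnj g L2w_mult_integrable)+
  have om_hol: "(\<lambda>\<mu>. omega \<mu> \<xi>) holomorphic_on D"
    using omega_has_derivative[OF \<xi>] D(1) by (auto simp: holomorphic_on_open D_def)
  \<comment> \<open>With the simple zero divided out, \<open>q\<close> has no zeros near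
    \<open>l\<close>, and the singular part of the resolvent becomes a holomorphic function over
    \<open>\<mu> - l\<close>.\<close>
  define q where "q = (\<lambda>\<mu>. if \<mu> = l then deriv (\<lambda>\<mu>. omega \<mu> \<xi>) l else (omega \<mu> \<xi> - omega l \<xi>) / (\<mu> - l))"
  have q_hol: "q holomorphic_on D" unfolding q_def by (rule pole_lemma_open[OF om_hol D(1)])
  have om_l: "omega l \<xi> = 0" using ls by (simp add: l_def)
  have ql: "q l = of_real (2 * (1 - y * \<bar>\<xi>\<bar>) / \<xi>\<^sup>2)"
  proof -
    have "cauchy wc (Z l) = \<i> * of_real \<xi>"
      unfolding Zl Z0_def using cauchy_w_axis_signed[OF \<xi> y(1)] y \<xi> by (simp add: sgn_if)
    then have zc: "Z l * cauchy wc (Z l) = - (1 + l)"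
      using \<xi> by (simp add: Z_def) (simp add: algebra_simps)
    have "Re l > -1" using lD by (simp add: D_def)
    then have "q l = (- 2 - 2 * Z l * cauchy wc (Z l)) / of_real (- (\<xi>\<^sup>2))"
      using DERIV_imp_deriv[OF omega_has_derivative[OF \<xi>]] by (simp add: q_def Z_def)
    also have "\<dots> = (- 2 + 2 * (1 + l)) / of_real (- (\<xi>\<^sup>2))"
      unfolding mult.assoc[of 2 "Z l"] zc by simp
    also have "\<dots> = of_real ((- 2 + 2 * (1 + (y * \<bar>\<xi>\<bar> - 1))) / (- (\<xi>\<^sup>2)))"
      unfolding l_def ls(1) by simp
    also have "(- 2 + 2 * (1 + (y * \<bar>\<xi>\<bar> - 1))) / (- (\<xi>\<^sup>2)) = 2 * (1 - y * \<bar>\<xi>\<bar>) / \<xi>\<^sup>2"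
      using \<xi> by (simp add: field_simps)
    finally show ?thesis .
  qed
  have ql_nz: "q l \<noteq> 0" unfolding ql of_real_eq_0_iff using ls \<xi> by simp
  have "isCont q l" using q_hol D lD by (meson continuous_on_eq_continuous_at holomorphic_on_imp_continuous_on)
  then obtain r1 where r1: "r1 > 0" "\<And>\<mu>. dist l \<mu> < r1 \<Longrightarrow> q \<mu> \<noteq> 0"
    using continuous_at_avoid[of l q 0] ql_nz by blast
  obtain r2 where r2: "r2 > 0" "ball l r2 \<subseteq> D" using D(1) lD by (auto simp: open_contains_ball)
  define r0 where "r0 = min r1 r2"
  have r0: "r0 > 0" "ball l r0 \<subseteq> D" "\<And>\<mu>. \<mu> \<in> ball l r0 \<Longrightarrow> q \<mu> \<noteq> 0"
    using r1 r2 by (auto simp: r0_def)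
  have "- 1 / (2 * of_real pi * \<i>) * contour_integral (circlepath l r) (\<lambda>\<mu>. innerw (resolvent \<xi> \<mu> f) g) = a l * b l / q l"
    if r: "0 < r" "r < r0" for r
  proof -
    have sub: "cball l r \<subseteq> ball l r0" using r by auto
    have abq: "(\<lambda>\<mu>. a \<mu> * b \<mu> / q \<mu>) holomorphic_on ball l r0"
      using r0 hol q_hol by (intro holomorphic_intros) (auto intro: holomorphic_on_subset)
    have "((\<lambda>\<mu>. a \<mu> * b \<mu> / q \<mu> / (\<mu> - l)) has_contour_integral 2 * of_real pi * \<i> * (a l * b l / q l)) (circlepath l r)"
    proof (rule Cauchy_integral_circlepath_simple)
      show "(\<lambda>\<mu>. a \<mu> * b \<mu> / q \<mu>) holomorphic_on cball l r" using abq sub by (rule holomorphic_on_subset)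
      show "norm (l - l) < r" using r by simp
    qed
    moreover have "(d has_contour_integral 0) (circlepath l r)"
    proof (rule Cauchy_theorem_disc_simple)
      show "d holomorphic_on ball l r0" using hol(3) r0(2) by (rule holomorphic_on_subset)
    qed (use sub r in auto)
    ultimately have "((\<lambda>\<mu>. - (a \<mu> * b \<mu> / q \<mu> / (\<mu> - l)) - d \<mu>) has_contour_integral
        - (2 * of_real pi * \<i> * (a l * b l / q l)) - 0) (circlepath l r)"
      by (intro has_contour_integral_diff has_contour_integral_neg)
    then have "((\<lambda>\<mu>. innerw (resolvent \<xi> \<mu> f) g) has_contour_integral
        - (2 * of_real pi * \<i> * (a l * b l / q l)) - 0) (circlepath l r)"
    proof (rule has_contour_integral_eq)
      fix \<mu> assume "\<mu> \<in> path_image (circlepath l r)"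
      then have \<mu>: "\<mu> \<noteq> l" "\<mu> \<in> ball l r0" using r by auto
      then have "\<mu> \<in> D" using r0 by blast
      have "omega \<mu> \<xi> = q \<mu> * (\<mu> - l)" using \<mu>(1) by (simp add: q_def om_l)
      moreover have "omega \<mu> \<xi> \<noteq> 0" using \<mu> r0(3)[OF \<mu>(2)] calculation by simp
      ultimately show "- (a \<mu> * b \<mu> / q \<mu> / (\<mu> - l)) - d \<mu> = innerw (resolvent \<xi> \<mu> f) g"
        using resolvent_inner[OF \<xi> _ _ f g, of \<mu>] \<open>\<mu> \<in> D\<close>
        by (simp add: a_def b_def d_def Z_def D_def)
    qed
    then show ?thesis by (simp add: contour_integral_unique)
  qed
  moreover have "\<forall>\<^sub>F r in at_right 0. 0 < r \<and> r < r0"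
    by (rule eventually_between_at_right[OF r0(1)])
  ultimately have "((\<lambda>r. - 1 / (2 * of_real pi * \<i>) * contour_integral (circlepath l r) (\<lambda>\<mu>. innerw (resolvent \<xi> \<mu> f) g)) \<longlongrightarrow> a l * b l / q l) (at_right 0)"
    by (intro tendsto_eventually) (auto elim: eventually_mono)
  then have "riesz_form \<xi> f g = a l * b l / q l"
    unfolding riesz_form_def l_def by (intro tendsto_Lim) auto
  also have "\<dots> = - (cauchy (\<lambda>v. f v * wc v) Z0 * cauchy (\<lambda>v. cnj (g v) * wc v) Z0 / (2 * of_real (1 - y * \<bar>\<xi>\<bar>)))"
    unfolding ql a_def b_def Zl using \<xi> by (simp add: power2_eq_square)
  finally show ?thesis .
qed

lemma upper_residue_outside: "\<not> (0 < \<xi> \<and> \<xi> < sqrt pi) \<Longrightarrow> upper_residue \<xi> h k = 0"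
  unfolding upper_residue_def by (rule if_not_P)

text \<open>For \<xi> < 0 the pole lies on the negative imaginary axis. Reflection changes the sign
  of both transforms, so their product agrees with the residue formed on the upper side.\<close>

lemma P_form_eq:
  assumes \<xi>: "\<xi> \<noteq> 0" "\<bar>\<xi>\<bar> \<noteq> sqrt pi" and f: "f \<in> L2w" and g: "g \<in> L2w"
  defines "h \<equiv> \<lambda>z. f z * wc z" and "k \<equiv> \<lambda>z. cnj (g z) * wc z"
  shows "P_form \<xi> f g = - (upper_residue \<xi> h k + upper_residue (- \<xi>) (\<lambda>t. h (- t)) (\<lambda>t. k (- t)))"
proof (cases "\<bar>\<xi>\<bar> < sqrt pi")
  case True
  have "\<bar>\<xi>\<bar> > 0" using \<xi> by simp
  then obtain y where y: "y > 0" "axis_value y = \<bar>\<xi>\<bar>" "y * \<bar>\<xi>\<bar> < 1" using axis_root True by blast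
  have P: "P_form \<xi> f g = - (cauchy h (\<i> * of_real (sgn \<xi> * y)) * cauchy k (\<i> * of_real (sgn \<xi> * y)) / (2 * of_real (1 - y * \<bar>\<xi>\<bar>)))"
    unfolding h_def k_def P_form_def using True riesz_form_eq[OF \<xi>(1) y(1,2) f g] by simp
  have C: "Complex 0 y = \<i> * of_real y" by (simp add: complex_eq_iff)
  show ?thesis
  proof (cases "\<xi> > 0")
    case pos: True
    then show ?thesis
      using P upper_residue_eq[OF y(1), of \<xi>] upper_residue_outside[of "- \<xi>"] y by (simp add: C)
  next
    case False
    then have neg: "\<xi> < 0" "\<bar>\<xi>\<bar> = - \<xi>" "sgn \<xi> = -1" using \<xi> by auto
    have refl: "cauchy (\<lambda>t. u (- t)) (Complex 0 y) = - cauchy u (\<i> * of_real (sgn \<xi> * y))" for u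
      using cauchy_reflect[of u "- Complex 0 y"] neg by (simp add: C)
    show ?thesis
      using P upper_residue_eq[OF y(1), of "- \<xi>" "\<lambda>t. h (- t)" "\<lambda>t. k (- t)"] upper_residue_outside[of \<xi>] y neg
      by (simp add: refl)
  qed
next
  case False
  then show ?thesis
    using \<xi> upper_residue_outside[of \<xi>] upper_residue_outside[of "- \<xi>"] by (auto simp: P_form_def abs_if split: if_splits)
qed

text \<open>The projection has rank one. Its value is a multiple of \<open>1 / (v - Z0)\<close>, the
  eigenfunction of the operator at the eigenvalue, which is bounded since \<open>Z0\<close> is not
  real.\<close>

lemma P_form_represented:
  assumes \<xi>: "\<xi> \<noteq> 0" "\<bar>\<xi>\<bar> \<noteq> sqrt pi" and f: "f \<in> L2w"
  obtains p where "represents p (P_form \<xi> f)"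
proof (cases "\<bar>\<xi>\<bar> < sqrt pi")
  case True
  have "\<bar>\<xi>\<bar> > 0" using \<xi> by simp
  then obtain y where y: "y > 0" "axis_value y = \<bar>\<xi>\<bar>" "y * \<bar>\<xi>\<bar> < 1" using axis_root True by blast
  define Z0 where "Z0 = \<i> * complex_of_real (sgn \<xi> * y)"
  have Z0: "Im Z0 \<noteq> 0" using \<xi> y by (simp add: Z0_def sgn_if)
  define c where "c = - (cauchy (\<lambda>v. f v * wc v) Z0 / (2 * of_real (1 - y * \<bar>\<xi>\<bar>)))"
  define p where "p = (\<lambda>v. c * (1 / (of_real v - Z0)))"
  have "p \<in> L2w"
    unfolding p_def
  proof (rule L2w_mult_bounded[OF const_L2w])
    show "(\<lambda>v. 1 / (complex_of_real v - Z0)) \<in> borel_measurable borel" by measurable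
    show "cmod (1 / (of_real v - Z0)) \<le> 1 / \<bar>Im Z0\<bar>" for v
      using cmod_kernel_ge[of Z0 v] Z0 by (simp add: norm_divide frac_le)
  qed
  moreover have "innerw p g = P_form \<xi> f g" if g: "g \<in> L2w" for g
  proof -
    have "innerw p g = (LINT v|lborel. c * (cnj (g v) * wc v / (of_real v - Z0)))"
      by (simp add: innerw_def p_def mult_ac)
    also have "\<dots> = c * cauchy (\<lambda>v. cnj (g v) * wc v) Z0"
      unfolding cauchy_def by (rule integral_mult_right_zero)
    also have "\<dots> = P_form \<xi> f g"
      unfolding P_form_def using True riesz_form_eq[OF \<xi>(1) y(1,2) f g] by (simp add: c_def Z0_def)
    finally show ?thesis .
  qed
  ultimately show thesis by (intro that[of p]) (simp add: represents_def)
next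
  case False
  then have "P_form \<xi> f g = 0" for g using \<xi> by (simp add: P_form_def)
  then show thesis using const_L2w[of 0] by (intro that[of "\<lambda>_. 0"]) (simp add: represents_def innerw_def)
qed

theorem resolution_of_identity:
  assumes \<xi>: "\<xi> \<noteq> 0" "\<bar>\<xi>\<bar> \<noteq> sqrt pi" and f: "f \<in> L2w" and g: "g \<in> L2w"
  shows "UB_form \<xi> f g + P_form \<xi> f g = innerw f g"
  using UB_form_eq[OF assms] P_form_eq[OF assms] by simp

section \<open>Functionals in \<open>Hm1w\<close>, and slices in \<xi>\<close>

lemma innerw_Cauchy_Schwarz:
  assumes f: "f \<in> L2w" and g: "g \<in> L2w"
  shows "cmod (innerw f g) \<le> normw f * normw g"
proof -
  have [measurable]: "f \<in> borel_measurable borel" "g \<in> borel_measurable borel"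
    using f g by (auto intro: L2w_measurable)
  have sq: "(cmod (u v * of_real (sqrt (w v))))\<^sup>2 = (cmod (u v))\<^sup>2 * w v" for u :: "real \<Rightarrow> complex" and v
    using w_pos[of v] by (simp add: norm_mult power_mult_distrib less_imp_le)
  have L2: "(\<lambda>v. u v * of_real (sqrt (w v))) \<in> L2" if u: "u \<in> L2w" for u
  proof -
    have [measurable]: "u \<in> borel_measurable borel" using u by (rule L2w_measurable)
    show ?thesis using L2w_integrable[OF u] by (simp add: L2_def sq)
  qed
  have n: "sqrt (normsq (\<lambda>v. u v * of_real (sqrt (w v)))) = normw u" for u
    unfolding normw_def normsq_def sq ..
  have "normw (\<lambda>v. cnj (g v)) = normw g" by (simp add: normw_def)
  moreover have "innerw f g = (LINT v|lborel. (f v * of_real (sqrt (w v))) * (cnj (g v) * of_real (sqrt (w v))))"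
    unfolding innerw_def
  proof (intro Bochner_Integration.integral_cong refl)
    fix v
    have "complex_of_real (sqrt (w v)) * of_real (sqrt (w v)) = wc v"
      using w_pos[of v] by (simp flip: of_real_mult)
    then show "f v * cnj (g v) * wc v = (f v * of_real (sqrt (w v))) * (cnj (g v) * of_real (sqrt (w v)))"
      by (metis (no_types, opaque_lifting) mult.assoc mult.commute)
  qed
  ultimately show ?thesis
    using L2_Cauchy_Schwarz[OF L2[OF f] L2[OF L2w_cnj[OF g]]] by (simp add: n)
qed

lemma innerw_Hm1w:
  assumes f: "f \<in> L2w"
  shows "innerw f \<in> Hm1w"
proof -
  have "innerw f (\<lambda>v. g v + c * h v) = innerw f g + cnj c * innerw f h" if "g \<in> L2w" "h \<in> L2w" for g h c
  proof -
    have "innerw f (\<lambda>v. g v + c * h v) = (LINT v|lborel. f v * cnj (g v) * wc v + cnj c * (f v * cnj (h v) * wc v))"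
      unfolding innerw_def by (simp add: algebra_simps)
    also have "\<dots> = innerw f g + (LINT v|lborel. cnj c * (f v * cnj (h v) * wc v))"
      unfolding innerw_def
      by (intro Bochner_Integration.integral_add integrable_mult_right L2w_mult_integrable f that)
    also have "(LINT v|lborel. cnj c * (f v * cnj (h v) * wc v)) = cnj c * innerw f h"
      unfolding innerw_def by (rule integral_mult_right_zero)
    finally show ?thesis .
  qed
  moreover have "cmod (innerw f g) \<le> normw f * sqrt ((normw g)\<^sup>2 + (normw g')\<^sup>2)" if "g \<in> L2w" for g g'
  proof -
    have "0 \<le> (LINT v|lborel. (cmod (f v))\<^sup>2 * w v)"
      by (intro Bochner_Integration.integral_nonneg mult_nonneg_nonneg less_imp_le[OF w_pos]) simp
    then have "normw f \<ge> 0" by (simp add: normw_def)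
    moreover have "normw g \<le> sqrt ((normw g)\<^sup>2 + (normw g')\<^sup>2)" by (rule real_sqrt_sum_squares_ge1)
    ultimately have "normw f * normw g \<le> normw f * sqrt ((normw g)\<^sup>2 + (normw g')\<^sup>2)"
      by (intro mult_left_mono)
    then show ?thesis using innerw_Cauchy_Schwarz[OF f that] by simp
  qed
  ultimately show ?thesis by (auto simp: Hm1w_def H1w_def intro!: exI[of _ "normw f"])
qed

text \<open>Lets the sum of the two forms inherit antilinearity and boundedness from
  \<open>innerw\<close> through the resolution of the identity, instead of proving them for each
  form.\<close>

lemma Hm1w_cong:
  assumes "\<Phi> \<in> Hm1w" "\<And>g. g \<in> L2w \<Longrightarrow> \<Psi> g = \<Phi> g"
  shows "\<Psi> \<in> Hm1w"
proof -
  have lin: "(\<lambda>v. g v + c * h v) \<in> L2w" if "g \<in> H1w" "h \<in> H1w" for g h c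
    using that L2w_add[of g "\<lambda>v. c * h v"] L2w_mult_bounded[of h "\<lambda>_. c" "cmod c"]
    by (auto simp: H1w_def mult.commute)
  obtain C where C: "\<And>g g'. g \<in> L2w \<Longrightarrow> g' \<in> L2w \<Longrightarrow> has_weak_deriv g g' \<Longrightarrow>
      cmod (\<Phi> g) \<le> C * sqrt ((normw g)\<^sup>2 + (normw g')\<^sup>2)"
    using assms(1) unfolding Hm1w_def by blast
  have "\<Psi> (\<lambda>v. g v + c * h v) = \<Psi> g + cnj c * \<Psi> h" if gh: "g \<in> H1w" "h \<in> H1w" for g h c
  proof -
    have "g \<in> L2w" "h \<in> L2w" using gh by (auto simp: H1w_def)
    then show ?thesis using assms lin[OF gh] gh unfolding Hm1w_def by simp
  qed
  moreover have "\<exists>C. \<forall>g\<in>L2w. \<forall>g'\<in>L2w. has_weak_deriv g g' \<longrightarrow> cmod (\<Psi> g) \<le> C * sqrt ((normw g)\<^sup>2 + (normw g')\<^sup>2)"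
    using C assms(2) by (intro exI[of _ C]) simp
  ultimately show ?thesis unfolding Hm1w_def by blast
qed

lemma L2_L2w_slices:
  assumes "f \<in> L2_L2w"
  shows "AE \<xi> in lborel. f \<xi> \<in> L2w"
proof -
  have meas: "(\<lambda>(\<xi>, v). f \<xi> v) \<in> borel_measurable (lborel \<Otimes>\<^sub>M lborel)"
    and int: "integrable (lborel \<Otimes>\<^sub>M lborel) (\<lambda>(\<xi>, v). (cmod (f \<xi> v))\<^sup>2 * w v)"
    using assms by (auto simp: L2_L2w_def)
  have "f \<xi> \<in> borel_measurable lborel" for \<xi>
    using measurable_Pair2[OF meas, of \<xi>] by simp
  moreover have "AE \<xi> in lborel. integrable lborel (\<lambda>v. (cmod (f \<xi> v))\<^sup>2 * w v)"
    using lborel_pair.AE_integrable_fst[OF int] .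
  ultimately show ?thesis by (auto simp: L2w_def)
qed

lemma AE_noncritical: "AE \<xi> in lborel. \<xi> \<noteq> 0 \<and> \<bar>\<xi>\<bar> \<noteq> sqrt pi"
  using AE_lborel_singleton[of 0] AE_lborel_singleton[of "sqrt pi"] AE_lborel_singleton[of "- sqrt pi"]
  by eventually_elim auto

theorem theorem7p9:
  shows "(\<forall>f \<in> L2_H1w. AE \<xi> in lborel.
            Hm1w_eq (innerw (f \<xi>)) (\<lambda>g. UB_form \<xi> (f \<xi>) g + P_form \<xi> (f \<xi>) g))
       \<and> (\<forall>f \<in> L2_L2w.
            (\<exists>K. compact K \<and> K \<subseteq> {- sqrt pi<..<sqrt pi} \<and>
               (AE \<xi> in lborel. \<xi> \<notin> K \<longrightarrow> (AE v in lborel. f \<xi> v = 0))) \<longrightarrow>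
            (AE \<xi> in lborel. \<exists>u p. represents u (UB_form \<xi> (f \<xi>)) \<and>
               represents p (P_form \<xi> (f \<xi>)) \<and> (AE v in lborel. f \<xi> v = u v + p v)))"
proof (intro conjI ballI impI)
  fix f assume "f \<in> L2_H1w"
  then have "f \<in> L2_L2w" by (simp add: L2_H1w_def)
  from L2_L2w_slices[OF this] AE_noncritical
  show "AE \<xi> in lborel. Hm1w_eq (innerw (f \<xi>)) (\<lambda>g. UB_form \<xi> (f \<xi>) g + P_form \<xi> (f \<xi>) g)"
  proof eventually_elim
    case (elim \<xi>)
    then have eq: "UB_form \<xi> (f \<xi>) g + P_form \<xi> (f \<xi>) g = innerw (f \<xi>) g" if "g \<in> L2w" for g
      using resolution_of_identity[of \<xi> "f \<xi>" g] that by simp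
    show ?case
      unfolding Hm1w_eq_def using innerw_Hm1w[OF elim(1)] Hm1w_cong[OF innerw_Hm1w[OF elim(1)] eq] eq
      by (auto simp: H1w_def)
  qed
next
  fix f assume "f \<in> L2_L2w"
  from L2_L2w_slices[OF this] AE_noncritical
  show "AE \<xi> in lborel. \<exists>u p. represents u (UB_form \<xi> (f \<xi>)) \<and>
     represents p (P_form \<xi> (f \<xi>)) \<and> (AE v in lborel. f \<xi> v = u v + p v)"
  proof eventually_elim
    case (elim \<xi>)
    then have \<xi>: "\<xi> \<noteq> 0" "\<bar>\<xi>\<bar> \<noteq> sqrt pi" and f: "f \<xi> \<in> L2w" by auto
    obtain p where p: "represents p (P_form \<xi> (f \<xi>))" by (rule P_form_represented[OF \<xi> f])
    then have pL: "p \<in> L2w" by (simp add: represents_def)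
    have mp: "(\<lambda>v. - 1 * p v) \<in> L2w"
      using L2w_mult_bounded[OF pL, of "\<lambda>_. - 1" 1] by (simp add: mult.commute)
    \<comment> \<open>The form of \<open>U\<^sup>*B\<close> is represented indirectly: by the
      resolution of the identity it is the difference of the forms represented by
      \<open>f \<xi>\<close> and \<open>p\<close>.\<close>
    define u where "u = (\<lambda>v. f \<xi> v + - 1 * p v)"
    have "u \<in> L2w" unfolding u_def by (intro L2w_add f mp)
    moreover have "innerw u g = UB_form \<xi> (f \<xi>) g" if g: "g \<in> L2w" for g
    proof -
      have "innerw u g = innerw (f \<xi>) g + innerw (\<lambda>v. - 1 * p v) g"
        unfolding u_def by (rule innerw_add[OF f mp g])
      also have "innerw (\<lambda>v. - 1 * p v) g = - innerw p g" by (simp add: innerw_def)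
      also have "innerw p g = P_form \<xi> (f \<xi>) g" using p g by (simp add: represents_def)
      finally show ?thesis unfolding resolution_of_identity[OF \<xi> f g, symmetric] by simp
    qed
    ultimately have "represents u (UB_form \<xi> (f \<xi>))" by (simp add: represents_def)
    moreover have "AE v in lborel. f \<xi> v = u v + p v" by (simp add: u_def)
    ultimately show ?case using p by blast
  qed
qed

end
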